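(* Let $\mathbb{X}$ be a Banach space with a basis. If $\ell_2$ is isomorphic to a complemented subspace of $\mathbb{X}$, then for any $0<a<1$ the space $\mathbb{X}$ has an almost greedy basis $\mathcal{B}$ with $\phi_m[\mathcal{B}]\approx m^{1/2}$ and $L_m[\mathcal{B}]\gtrsim(\log m)^a$ for $m\in\mathbb{N}$.
   Context: Banach spaces are real or complex and bases are Schauder bases. Let $\mathcal{B}=(\mathbf{x}_n)_{n=1}^\infty$ be a basis of $\mathbb{X}$ with coordinate functionals $(\mathbf{x}_n^* )_{n=1}^\infty$. For $A\subseteq\mathbb{N}$, the coordinate projection is $S_A[\mathcal{B}](f)=\sum_{n\in A}\mathbf{x}_n^*(f)\,\mathbf{x}_n$ (when well defined), and $\operatorname{supp}(f)=\{n:\mathbf{x}_n^*(f)\neq0\}$. The basis is almost greedy if there is a constant $C$ such that $\|f-S_A[\mathcal{B}](f)\|\le C\|f-S_B[\mathcal{B}](f)\|$ whenever $f\in\mathbb{X}$, $A,B\subseteq\mathbb{N}$, $|B|\le|A|<\infty$, and $|\mathbf{x}_j^*(f)|\le|\mathbf{x}_k^*(f)|$ for all $j\in\mathbb{N}\setminus A$ and $k\in A$. The fundamental function is $\phi_m[\mathcal{B}]=\sup_{|A|\le m}\|\sum_{j\in A}\mathbf{x}_j\|$. The w-conditionality constants are $$L_m[\mathcal{B}]=\sup\left\{\frac{\|S_A[\mathcal{B}](f)\|}{\|f\|}: f\ne0,\ \max(\operatorname{supp}(f))\le m,\ A\subseteq\mathbb{N}\right\}.$$ For families of nonnegative reals,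 $\alpha_i\lesssim\beta_i$ (equivalently $\beta_i\gtrsim\alpha_i$) means there is a constant $C$ with $\alpha_i\le C\beta_i$ for all $i$, and $\alpha_i\approx\beta_i$ means $\alpha_i\lesssim\beta_i$ and $\beta_i\lesssim\alpha_i$. *)

theory Defs
  imports "HOL-Analysis.Analysis"
begin

text \<open>
  The library's class \<open>banach\<close> only provides real scalars. To treat real and complex Banach spaces
  uniformly, the scalar multiplication is an explicit parameter \<open>sc\<close>, used with
  \<open>'k = real\<close> and \<open>sc = scaleR\<close>, or with \<open>'k = complex\<close>.
\<close>

locale banach_space_over = vector_space sc
  for sc :: "'k::real_normed_field \<Rightarrow> 'x::banach \<Rightarrow> 'x" +
  assumes norm_scale: "norm (sc c x) = norm c * norm x"
    and scale_of_real: "sc (of_real r) x = r *\<^sub>R x"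

lemma banach_space_over_scaleR: "banach_space_over (scaleR :: real \<Rightarrow> 'x::banach \<Rightarrow> 'x)"
  by unfold_locales (simp_all add: scaleR_add_right scaleR_add_left)

lemma banach_space_over_complex: "banach_space_over ((*) :: complex \<Rightarrow> complex \<Rightarrow> complex)"
  by unfold_locales (simp_all add: algebra_simps norm_mult scaleR_conv_of_real)

text \<open>
  Sequences are indexed from \<open>0\<close>: \<open>b n\<close> stands for the basis vector \<open>x\<^sub>n\<^sub>+\<^sub>1\<close>.
\<close>

definition schauder_basis ::
  "('k::real_normed_field \<Rightarrow> 'x::banach \<Rightarrow> 'x) \<Rightarrow> (nat \<Rightarrow> 'x) \<Rightarrow> bool" where
  "schauder_basis sc b \<longleftrightarrow> (\<forall>f. \<exists>!c. (\<lambda>n. sc (c n) (b n)) sums f)"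

definition coord ::
  "('k::real_normed_field \<Rightarrow> 'x::banach \<Rightarrow> 'x) \<Rightarrow> (nat \<Rightarrow> 'x) \<Rightarrow> nat \<Rightarrow> 'x \<Rightarrow> 'k" where
  "coord sc b n f = (THE c. (\<lambda>n. sc (c n) (b n)) sums f) n"

definition supp ::
  "('k::real_normed_field \<Rightarrow> 'x::banach \<Rightarrow> 'x) \<Rightarrow> (nat \<Rightarrow> 'x) \<Rightarrow> 'x \<Rightarrow> nat set" where
  "supp sc b f = {n. coord sc b n f \<noteq> 0}"

text \<open>
  The series below is meaningful only where it converges; it is used only for finite \<open>A\<close> or for
  \<open>f\<close> of finite support, where it is a finite sum.
\<close>

definition coord_proj ::
  "('k::real_normed_field \<Rightarrow> 'x::banach \<Rightarrow> 'x) \<Rightarrow> (nat \<Rightarrow> 'x) \<Rightarrow> nat set \<Rightarrow> 'x \<Rightarrow> 'x" where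
  "coord_proj sc b A f = (\<Sum>n. if n \<in> A then sc (coord sc b n f) (b n) else 0)"

definition almost_greedy ::
  "('k::real_normed_field \<Rightarrow> 'x::banach \<Rightarrow> 'x) \<Rightarrow> (nat \<Rightarrow> 'x) \<Rightarrow> bool" where
  "almost_greedy sc b \<longleftrightarrow>
    (\<exists>C::real. \<forall>f A B.
       finite A \<and> finite B \<and> card B \<le> card A \<and>
       (\<forall>j\<in>- A. \<forall>k\<in>A. norm (coord sc b j f) \<le> norm (coord sc b k f)) \<longrightarrow>
       norm (f - coord_proj sc b A f) \<le> C * norm (f - coord_proj sc b B f))"

text \<open>
  Suprema are taken in \<^typ>\<open>ennreal\<close>, so that an unbounded supremum is \<open>\<infinity>\<close> rather than an
  unspecified real number.
\<close>

definition fundamental_function :: "(nat \<Rightarrow> 'x::banach) \<Rightarrow> nat \<Rightarrow> ennreal" where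
  "fundamental_function b m = (SUP A\<in>{A. finite A \<and> card A \<le> m}. ennreal (norm (\<Sum>j\<in>A. b j)))"

text \<open>
  With indices starting at \<open>0\<close>, the condition \<open>max (supp f) \<le> m\<close> on the 1-based support becomes
  \<open>supp f \<subseteq> {..<m}\<close>.
\<close>

definition w_conditionality ::
  "('k::real_normed_field \<Rightarrow> 'x::banach \<Rightarrow> 'x) \<Rightarrow> (nat \<Rightarrow> 'x) \<Rightarrow> nat \<Rightarrow> ennreal" where
  "w_conditionality sc b m =
    (SUP (f, A)\<in>{(f, A). f \<noteq> 0 \<and> supp sc b f \<subseteq> {..<m}}.
       ennreal (norm (coord_proj sc b A f) / norm f))"

definition lesssim_on :: "'i set \<Rightarrow> ('i \<Rightarrow> ennreal) \<Rightarrow> ('i \<Rightarrow> ennreal) \<Rightarrow> bool" where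
  "lesssim_on I \<alpha> \<beta> \<longleftrightarrow> (\<exists>C::real. \<forall>i\<in>I. \<alpha> i \<le> ennreal C * \<beta> i)"

definition approx_on :: "'i set \<Rightarrow> ('i \<Rightarrow> ennreal) \<Rightarrow> ('i \<Rightarrow> ennreal) \<Rightarrow> bool" where
  "approx_on I \<alpha> \<beta> \<longleftrightarrow> lesssim_on I \<alpha> \<beta> \<and> lesssim_on I \<beta> \<alpha>"

definition ell2 :: "(nat \<Rightarrow> 'k::real_normed_field) set" where
  "ell2 = {u. summable (\<lambda>n. (norm (u n))\<^sup>2)}"

definition ell2_norm :: "(nat \<Rightarrow> 'k::real_normed_field) \<Rightarrow> real" where
  "ell2_norm u = sqrt (\<Sum>n. (norm (u n))\<^sup>2)"

definition complemented_subspace ::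
  "('k::real_normed_field \<Rightarrow> 'x::banach \<Rightarrow> 'x) \<Rightarrow> 'x set \<Rightarrow> bool" where
  "complemented_subspace sc Y \<longleftrightarrow>
    module.subspace sc Y \<and> closed Y \<and>
    (\<exists>P. Vector_Spaces.linear sc sc P \<and> (\<exists>K. \<forall>x. norm (P x) \<le> K * norm x) \<and>
         range P = Y \<and> (\<forall>y\<in>Y. P y = y))"

definition ell2_isomorphic_to ::
  "('k::real_normed_field \<Rightarrow> 'x::banach \<Rightarrow> 'x) \<Rightarrow> 'x set \<Rightarrow> bool" where
  "ell2_isomorphic_to sc Y \<longleftrightarrow>
    (\<exists>T. bij_betw T ell2 Y \<and>
         (\<forall>u\<in>ell2. \<forall>v\<in>ell2. T (\<lambda>n. u n + v n) = T u + T v) \<and>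
         (\<forall>c. \<forall>u\<in>ell2. T (\<lambda>n. c * u n) = sc c (T u)) \<and>
         (\<exists>K. \<forall>u\<in>ell2. norm (T u) \<le> K * ell2_norm u) \<and>
         (\<exists>K. \<forall>u\<in>ell2. ell2_norm u \<le> K * norm (T u)))"

end

theory Submission
  imports Defs "HOL-Library.Discrete_Functions"
begin

text \<open>
  If \<open>(y\<^sub>k)\<close> is a seminormalised basic sequence whose closed span is complemented by a copy of
  \<open>\<ell>\<^sub>2\<close>, one can put \<open>y\<^sub>k\<close> in front of the \<open>k\<close>-th dyadic block of the unit vectors of \<open>\<ell>\<^sub>2\<close> and apply in
  each block, of size \<open>2\<^sup>k\<close>, an orthogonal matrix whose first row is constant. The resulting basis
  (the construction of Dilworth, Kalton and Kutzarova) is almost greedy with fundamental function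
  \<open>m\<^sup>1\<^sup>/\<^sup>2\<close>, whatever \<open>(y\<^sub>k)\<close> is, and inherits the conditionality of the first \<open>k\<close> vectors \<open>y\<^sub>i\<close>
  within its first \<open>2\<^sup>k\<close> vectors.

  For \<open>(y\<^sub>k)\<close> we take the given basis interleaved with a basis of \<open>\<ell>\<^sub>2\<close> whose conditionality constants
  grow like \<open>m\<^sup>a\<close>; there is room for it because the space is isomorphic to its direct sum with
  \<open>\<ell>\<^sub>2\<close>. The latter basis comes from a discrete Sobolev norm of order \<open>a/2\<close> given by weighted Haar
  coefficients. Truncation of sequences is bounded for this norm and for its dual, as \<open>a/2 < 1/2\<close>, so the
  unit vectors \<open>x\<^sub>n\<close> and their duals \<open>z\<^sub>n\<close> both form bases. For blocks of \<open>N\<close> vectors, \<open>\<Sum> x\<^sub>n\<close> has norm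
  of order \<open>N\<^sup>(\<^sup>1\<^sup>+\<^sup>a\<^sup>)\<^sup>/\<^sup>2\<close> but \<open>\<Sum> z\<^sub>n\<close> only \<open>N\<^sup>(\<^sup>1\<^sup>-\<^sup>a\<^sup>)\<^sup>/\<^sup>2\<close>; hence for the basis \<open>x\<^sub>n \<plusminus> z\<^sub>n\<close> the
  projection of \<open>2 \<Sum> z\<^sub>n\<close> onto the vectors \<open>x\<^sub>n + z\<^sub>n\<close> increases the norm by a factor of order \<open>N\<^sup>a\<close>.
\<close>

section \<open>Schauder bases\<close>

text \<open>The weights use \<open>\<theta> = 2 powr a / 2\<close>, so that
  \<open>(2 * \<theta>) ^ k\<close> is \<open>N powr a\<close> for \<open>N = 2 ^ k\<close>, and the
  bounds \<open>1 / 2 < \<theta> < 1\<close> are \<open>0 < a < 1\<close>. The lower bound makes the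
  weighted Haar norm control all dyadic interval sums. The upper bound makes the geometric series in
  \<open>\<theta>\<close> converge, which keeps the unit vectors bounded and lets the effect of a
  cut decay from one interval length to the next. This is where the construction stops short of the
  exponent 1.

  The sequence \<open>y\<close> cannot spoil almost greediness, because the constant Haar row of
  block \<open>k\<close> lets it enter \<open>b j\<close> only with the factor
  \<open>2 powr (-k/2)\<close>, comparable to \<open>(j + 1) powr (-1/2)\<close>. Over any
  \<open>m\<close> indices these factors add up to at most a multiple of \<open>sqrt m\<close>,
  which is the size that the remaining part, an orthogonal transform of an l2 sequence, has anyway.

  The given basis has to be interleaved into \<open>y\<close> so that \<open>b\<close> spans the
  whole space. Little is known about it beyond normalisation, so the estimates for \<open>b\<close>
  rely only on uniform bounds for the vectors \<open>y j\<close> and their functionals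
  \<open>ys j\<close>.\<close>

context banach_space_over
begin

lemma bounded_bilinear_sc: "bounded_bilinear sc"
proof
  show "sc (a + a') b = sc a b + sc a' b" for a a' b by (rule scale_left_distrib)
  show "sc a (b + b') = sc a b + sc a b'" for a b b' by (rule scale_right_distrib)
  show "sc (r *\<^sub>R a) b = r *\<^sub>R sc a b" for r a b
    by (simp only: scaleR_conv_of_real [of r a] scale_scale[symmetric] scale_of_real)
  show "sc a (r *\<^sub>R b) = r *\<^sub>R sc a b" for r a b
    by (metis scale_left_commute scale_of_real)
  show "\<exists>K. \<forall>a b. norm (sc a b) \<le> norm a * norm b * K"
    by (rule exI[of _ 1]) (simp add: norm_scale)
qed

sublocale sc: bounded_bilinear sc
  by (rule bounded_bilinear_sc)

text \<open>\<open>bounded_linear\<close> speaks of real scalars only, so homogeneity over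
  \<open>'k\<close> is required separately.\<close>

definition scalar_linear :: "('x \<Rightarrow> 'k) \<Rightarrow> bool" where
  "scalar_linear \<phi> \<longleftrightarrow> bounded_linear \<phi> \<and> (\<forall>c x. \<phi> (sc c x) = c * \<phi> x)"

lemma coord_unique:
  assumes "schauder_basis sc b" "(\<lambda>n. sc (c n) (b n)) sums f"
  shows "coord sc b n f = c n"
proof -
  have "(THE c. (\<lambda>n. sc (c n) (b n)) sums f) = c"
    using assms unfolding schauder_basis_def by blast
  then show ?thesis by (simp add: coord_def)
qed

lemma coord_sums:
  assumes "schauder_basis sc b"
  shows "(\<lambda>n. sc (coord sc b n f) (b n)) sums f"
proof -
  obtain c where c: "(\<lambda>n. sc (c n) (b n)) sums f"
    using assms unfolding schauder_basis_def by blast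
  then show ?thesis
    using coord_unique[OF assms c] by simp
qed

lemma coord_add:
  assumes "schauder_basis sc b"
  shows "coord sc b n (f + g) = coord sc b n f + coord sc b n g"
proof (rule coord_unique[OF assms])
  show "(\<lambda>n. sc (coord sc b n f + coord sc b n g) (b n)) sums (f + g)"
    using sums_add[OF coord_sums[OF assms] coord_sums[OF assms]] by (simp add: sc.add_left)
qed

lemma coord_scale:
  assumes "schauder_basis sc b"
  shows "coord sc b n (sc c f) = c * coord sc b n f"
proof (rule coord_unique[OF assms])
  show "(\<lambda>n. sc (c * coord sc b n f) (b n)) sums (sc c f)"
    using bounded_linear.sums[OF sc.bounded_linear_right coord_sums[OF assms]] by simp
qed

lemma coord_scaleR:
  assumes "schauder_basis sc b"
  shows "coord sc b n (r *\<^sub>R f) = r *\<^sub>R coord sc b n f"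
  using coord_scale[OF assms, of n "of_real r" f] by (simp add: scale_of_real scaleR_conv_of_real)

lemma coord_finite_sum:
  assumes "schauder_basis sc b" "finite F"
  shows "coord sc b n (\<Sum>j\<in>F. sc (c j) (b j)) = (if n \<in> F then c n else 0)"
proof (rule coord_unique[OF assms(1)])
  have "(\<lambda>n. if n \<in> F then sc (c n) (b n) else 0) sums (\<Sum>j\<in>F. sc (c j) (b j))"
    by (rule sums_If_finite_set[OF assms(2)])
  moreover have "(\<lambda>n. if n \<in> F then sc (c n) (b n) else 0) = (\<lambda>n. sc (if n \<in> F then c n else 0) (b n))"
    by (auto simp: sc.zero_left)
  ultimately show "(\<lambda>n. sc (if n \<in> F then c n else 0) (b n)) sums (\<Sum>j\<in>F. sc (c j) (b j))"
    by simp
qed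

lemma schauder_basis_nonzero:
  assumes "schauder_basis sc b"
  shows "b n \<noteq> 0"
proof
  assume "b n = 0"
  have "coord sc b n (\<Sum>j\<in>{n}. sc 1 (b j)) = 1"
    using coord_finite_sum[OF assms, of "{n}" n "\<lambda>_. 1"] by simp
  moreover have "coord sc b n (\<Sum>j\<in>{}. sc 1 (b j)) = 0"
    using coord_finite_sum[OF assms, of "{}" n "\<lambda>_. 1"] by simp
  ultimately show False
    using \<open>b n = 0\<close> by simp
qed

lemma coord_proj_finite:
  assumes "finite A"
  shows "coord_proj sc b A f = (\<Sum>n\<in>A. sc (coord sc b n f) (b n))"
  unfolding coord_proj_def using suminf_finite[OF assms, of "\<lambda>n. if n \<in> A then sc (coord sc b n f) (b n) else 0"]
  by simp

lemma sums_biorthogonal_unique: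
  assumes \<phi>: "scalar_linear \<phi>"
    and bi: "\<And>m. \<phi> (b m) = (if m = n then 1 else 0)"
    and s: "(\<lambda>n. sc (c n) (b n)) sums f"
  shows "\<phi> f = c n"
proof -
  have "(\<lambda>m. \<phi> (sc (c m) (b m))) sums \<phi> f"
    using \<phi> bounded_linear.sums[OF _ s] unfolding scalar_linear_def by blast
  moreover have "\<phi> (sc (c m) (b m)) = (if m = n then c m else 0)" for m
    using \<phi> bi by (auto simp: scalar_linear_def)
  ultimately have "(\<lambda>m. if m = n then c m else 0) sums \<phi> f" by simp
  moreover have "(\<lambda>m. if m = n then c m else 0) sums c n"
    by (rule sums_single)
  ultimately show ?thesis by (rule sums_unique2)
qed

text \<open>Uniqueness of the coefficients comes from applying the continuous functionals to the
  series term by term.\<close>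

lemma schauder_basisI:
  assumes lin: "\<And>n. scalar_linear (bs n)"
    and bi: "\<And>m n. bs n (b m) = (if m = n then 1 else 0)"
    and s: "\<And>f. (\<lambda>n. sc (bs n f) (b n)) sums f"
  shows "schauder_basis sc b" and "coord sc b n f = bs n f"
proof -
  show b: "schauder_basis sc b"
    unfolding schauder_basis_def
  proof (intro allI ex1I)
    show "(\<lambda>n. sc (bs n f) (b n)) sums f" for f by (rule s)
    show "c = (\<lambda>n. bs n f)" if "(\<lambda>n. sc (c n) (b n)) sums f" for f c
      using sums_biorthogonal_unique[OF lin bi that] by auto
  qed
  show "coord sc b n f = bs n f"
    by (rule coord_unique[OF b s])
qed

end

section \<open>Uniform bound for the partial sums of a basis\<close>

lemma closed_cover_interior:
  fixes A :: "nat \<Rightarrow> 'a::complete_space set"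
  assumes "\<And>n. closed (A n)" "(\<Union>n. A n) = UNIV"
  shows "\<exists>n. interior (A n) \<noteq> {}"
proof (rule ccontr)
  assume "\<not> ?thesis"
  then have "(euclidean::'a topology) interior_of \<Union>(range A) = {}"
    using assms(1)
    by (intro Baire_category_alt disjI1 completely_metrizable_space_euclidean) auto
  then show False
    using assms(2) by simp
qed

text \<open>Both \<open>x\<close> and \<open>x + y\<close> lie in the ball, so \<open>y\<close> is a
  difference of two points of the closure; this moves the centre of the ball to 0.\<close>

lemma symmetric_ball_closure:
  fixes A :: "'a::real_normed_vector set"
  assumes "ball x r \<subseteq> closure A" "norm y < r" "0 < \<epsilon>"
  shows "\<exists>p\<in>A. \<exists>q\<in>A. norm (y - (p - q)) < \<epsilon>"
proof -
  have "0 < r"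
    using assms(2) norm_ge_zero[of y] by linarith
  then have "x \<in> closure A" "x + y \<in> closure A"
    using assms(1,2) by (auto simp: subset_iff dist_norm)
  then obtain p q where pq: "p \<in> A" "dist p (x + y) < \<epsilon> / 2" "q \<in> A" "dist q x < \<epsilon> / 2"
    unfolding closure_approachable using assms(3) by (meson half_gt_zero)
  have "norm (y - (p - q)) = norm ((q - x) - (p - (x + y)))"
    by (simp add: algebra_simps)
  also have "\<dots> \<le> norm (q - x) + norm (p - (x + y))"
    by (rule norm_triangle_ineq4)
  also have "\<dots> < \<epsilon>"
    using pq by (simp add: dist_norm)
  finally show ?thesis using pq by blast
qed

text \<open>The sort \<open>euclidean_space\<close> covers real and complex scalars at once and
  supplies their completeness and their inner product.\<close>

locale euclidean_banach_space_over = banach_space_over sc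
  for sc :: "'k::{real_normed_field,euclidean_space} \<Rightarrow> 'x::banach \<Rightarrow> 'x"
begin

text \<open>
  The Baire category theorem provides, for each \<open>y\<close>, an approximation whose partial sums are
  controlled by \<open>norm y\<close>; iterating, every \<open>f\<close> becomes a series of such vectors, whose
  expansions add up to the expansion of \<open>f\<close>.
\<close>

lemma schauder_basis_constant:
  assumes b: "schauder_basis sc b"
  shows "\<exists>K. \<forall>n f. norm (\<Sum>i<n. sc (coord sc b i f) (b i)) \<le> K * norm f"
proof -
  define s where "s n f = (\<Sum>i<n. sc (coord sc b i f) (b i))" for n f
  have s_add: "s n (f + g) = s n f + s n g" for n f g
    by (simp add: s_def coord_add[OF b] sc.add_left sum.distrib)
  have s_scaleR: "s n (r *\<^sub>R f) = r *\<^sub>R s n f" for n r f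
    by (simp add: s_def coord_scaleR[OF b] sc.scaleR_left scaleR_sum_right)
  have s_diff: "s n (f - g) = s n f - s n g" for n f g
    using s_add[of n "f - g" g] by simp
  have s_zero: "s n 0 = 0" for n
    using s_scaleR[of n 0 0] by simp
  have s_lim: "(\<lambda>n. s n f) \<longlonglongrightarrow> f" for f
    using coord_sums[OF b, of f] by (simp add: sums_def s_def)
  define A where "A k = {f. \<forall>n. norm (s n f) \<le> real k}" for k
  have "\<exists>k. f \<in> closure (A k)" for f
  proof -
    obtain K where "\<And>n. norm (s n f) \<le> K"
      using convergent_imp_Bseq[OF convergentI[OF s_lim[of f]]] unfolding Bseq_def by auto
    moreover obtain k where "K \<le> real k"
      using real_arch_simple by blast
    ultimately have "f \<in> A k"
      unfolding A_def by (auto intro: order_trans)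
    then have "f \<in> closure (A k)"
      using closure_subset[of "A k"] by (rule rev_subsetD)
    then show ?thesis ..
  qed
  then have "(\<Union>k. closure (A k)) = UNIV"
    by auto
  then obtain k where "interior (closure (A k)) \<noteq> {}"
    using closed_cover_interior[of "\<lambda>k. closure (A k)"] by auto
  then obtain x where "x \<in> interior (closure (A k))" by blast
  then obtain r where r: "0 < r" "ball x r \<subseteq> closure (A k)"
    using mem_interior by metis
  \<comment> \<open>The factor \<open>t = r / (2 * norm y)\<close> brings \<open>y\<close> into the
    ball; a difference of two points of \<open>A k\<close> has partial sums of norm at most
    \<open>2 * k\<close>, and dividing by \<open>t\<close> gives \<open>4 * k / r\<close>.\<close>
  define M where "M = 4 * real k / r"
  have M0: "0 \<le> M" using r by (simp add: M_def)
  have approx: "\<exists>z. norm (y - z) \<le> \<epsilon> \<and> (\<forall>n. norm (s n z) \<le> M * norm y)" if eps: "0 < \<epsilon>" for y \<epsilon>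
  proof (cases "y = 0")
    case True
    then show ?thesis using that by (intro exI[of _ 0]) (simp add: s_zero)
  next
    case False
    define t where "t = r / (2 * norm y)"
    have t: "0 < t" "norm (t *\<^sub>R y) < r" using False r by (auto simp: t_def)
    obtain p q where pq: "p \<in> A k" "q \<in> A k" "norm (t *\<^sub>R y - (p - q)) < t * \<epsilon>"
      using symmetric_ball_closure[OF r(2) t(2), of "t * \<epsilon>"] mult_pos_pos[OF t(1) eps] by blast
    have "norm (y - (1 / t) *\<^sub>R (p - q)) = (1 / t) * norm (t *\<^sub>R y - (p - q))"
    proof -
      have "y - (1 / t) *\<^sub>R (p - q) = (1 / t) *\<^sub>R (t *\<^sub>R y - (p - q))"
        using t by (simp add: scaleR_diff_right)
      then show ?thesis using t by simp
    qed
    also have "\<dots> \<le> (1 / t) * (t * \<epsilon>)"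
      using pq(3) t by (intro mult_left_mono) auto
    also have "\<dots> = \<epsilon>" using t by simp
    finally have "norm (y - (1 / t) *\<^sub>R (p - q)) \<le> \<epsilon>" .
    moreover have "norm (s n ((1 / t) *\<^sub>R (p - q))) \<le> M * norm y" for n
    proof -
      have "norm (s n p) \<le> real k" "norm (s n q) \<le> real k"
        using pq unfolding A_def by auto
      then have "norm (s n p - s n q) \<le> 2 * real k"
        using norm_triangle_ineq4[of "s n p" "s n q"] by linarith
      then have "(1 / t) * norm (s n p - s n q) \<le> (1 / t) * (2 * real k)"
        using t by (intro mult_left_mono) auto
      also have "\<dots> = M * norm y" using r False by (simp add: t_def M_def)
      finally show ?thesis using t by (simp add: s_scaleR s_diff)
    qed
    ultimately show ?thesis by blast
  qed
  have main: "norm (s n f) \<le> 2 * M * norm f" for n f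
  proof (cases "f = 0")
    case True
    then show ?thesis by (simp add: s_zero)
  next
    case False
    define R where "R = norm f"
    have R: "0 < R" using False by (simp add: R_def)
    \<comment> \<open>The approximation at stage \<open>i\<close> leaves a residual of norm at most
      \<open>R / 2 ^ (i + 1)\<close>, so the summands and all their partial sums decay
      geometrically.\<close>
    define Z where "Z y i = (SOME z. norm (y - z) \<le> R * (1/2) ^ Suc i \<and>
      (\<forall>n. norm (s n z) \<le> M * norm y))" for y i
    have "norm (y - Z y i) \<le> R * (1/2) ^ Suc i \<and> (\<forall>n. norm (s n (Z y i)) \<le> M * norm y)" for y i
      unfolding Z_def by (rule someI_ex, rule approx) (use R in simp)
    then have Z: "\<And>y i. norm (y - Z y i) \<le> R * (1/2) ^ Suc i"
      "\<And>y i n. norm (s n (Z y i)) \<le> M * norm y" by blast+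
    define Y where "Y = rec_nat f (\<lambda>i y. y - Z y i)"
    define z where "z i = Z (Y i) i" for i
    have Y0: "Y 0 = f" and YS: "Y (Suc i) = Y i - z i" for i
      by (auto simp: Y_def z_def)
    have Yn: "norm (Y i) \<le> R * (1/2) ^ i" for i
      using Z(1) by (cases i) (auto simp: Y0 YS z_def R_def)
    have sz: "norm (s n (z i)) \<le> M * R * (1/2) ^ i" for n i
      unfolding z_def mult.assoc
      by (rule order_trans[OF Z(2)[of n "Y i" i] mult_left_mono[OF Yn M0]])
    have zsum: "(\<Sum>i<n. z i) = f - Y n" for n
      by (induction n) (auto simp: Y0 YS)
    have sumM: "(\<lambda>i. M * R * (1/2) ^ i) sums (2 * M * R)"
      using sums_mult[OF power_half_series, of "2 * M * R"] by (simp add: mult_ac)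
    have coord_bound: "norm (coord sc b j (z i)) \<le> 2 * M * R / norm (b j) * (1/2) ^ i" for i j
    proof -
      have "sc (coord sc b j (z i)) (b j) = s (Suc j) (z i) - s j (z i)"
        by (simp add: s_def)
      from arg_cong[OF this, of norm]
      have "norm (coord sc b j (z i)) * norm (b j) \<le> 2 * (M * R * (1/2) ^ i)"
        using norm_triangle_ineq4[of "s (Suc j) (z i)" "s j (z i)"] sz[of "Suc j" i] sz[of j i]
        unfolding norm_scale[symmetric] by linarith
      moreover have "0 < norm (b j)"
        using schauder_basis_nonzero[OF b, of j] by simp
      ultimately have "norm (coord sc b j (z i)) \<le> 2 * (M * R * (1/2) ^ i) / norm (b j)"
        by (simp only: pos_le_divide_eq)
      then show ?thesis by simp
    qed
    \<comment> \<open>These are the candidate coefficients of \<open>f\<close>; once their series is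
      known to converge to \<open>f\<close>, uniqueness of the expansion identifies them with
      \<open>coord\<close>.\<close>
    define c where "c j = (\<Sum>i. coord sc b j (z i))" for j
    have c: "(\<lambda>i. coord sc b j (z i)) sums c j" for j
      unfolding c_def
    proof (rule summable_sums)
      show "summable (\<lambda>i. coord sc b j (z i))"
      proof (rule summable_comparison_test'[OF _ coord_bound])
        show "summable (\<lambda>i. 2 * M * R / norm (b j) * (1/2) ^ i)"
          using sums_mult[OF power_half_series, of "4 * M * R / norm (b j)"] by (simp add: sums_iff)
      qed
    qed
    define S where "S n = (\<Sum>j<n. sc (c j) (b j))" for n
    have Ssum: "(\<lambda>i. s n (z i)) sums S n" for n
      unfolding s_def S_def
      by (intro sums_sum bounded_linear.sums[OF sc.bounded_linear_left] c)
    have SM: "norm (S n) \<le> 2 * M * R" for n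
      by (rule norm_sums_le[OF Ssum sumM sz])
    have tail: "norm (S n - (\<Sum>i<I. s n (z i))) \<le> 2 * M * R * (1/2) ^ I" for n I
    proof (rule norm_sums_le)
      show "(\<lambda>i. s n (z (i + I))) sums (S n - (\<Sum>i<I. s n (z i)))"
        by (rule sums_split_initial_segment[OF Ssum])
      show "(\<lambda>i. M * R * (1/2) ^ (i + I)) sums (2 * M * R * (1/2) ^ I)"
        using sums_mult2[OF sumM, of "(1/2) ^ I"] by (simp add: power_add mult_ac)
      show "norm (s n (z (i + I))) \<le> M * R * (1/2) ^ (i + I)" for i
        by (rule sz)
    qed
    have "S \<longlonglongrightarrow> f"
    proof (rule LIMSEQ_I)
      fix e :: real assume e: "0 < e"
      have "(\<lambda>I. (2 * M + 1) * R * (1/2) ^ I) \<longlonglongrightarrow> (2 * M + 1) * R * 0"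
        by (intro tendsto_intros LIMSEQ_power_zero) simp
      then have "\<forall>\<^sub>F I in sequentially. (2 * M + 1) * R * (1/2) ^ I < e / 2"
        using e by (intro order_tendstoD(2)) auto
      then obtain I where I: "(2 * M + 1) * R * (1/2) ^ I < e / 2"
        by (auto simp: eventually_sequentially)
      have "(\<lambda>n. \<Sum>i<I. s n (z i)) \<longlonglongrightarrow> (\<Sum>i<I. z i)"
        by (intro tendsto_sum s_lim)
      then have "\<forall>\<^sub>F n in sequentially. norm ((\<Sum>i<I. s n (z i)) - (\<Sum>i<I. z i)) < e / 2"
        using LIMSEQ_D[of "\<lambda>n. \<Sum>i<I. s n (z i)" _ "e / 2"] e
        by (auto simp: eventually_sequentially)
      then obtain no where no: "\<And>n. n \<ge> no \<Longrightarrow> norm ((\<Sum>i<I. s n (z i)) - (\<Sum>i<I. z i)) < e / 2"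
        by (auto simp: eventually_sequentially)
      show "\<exists>no. \<forall>n\<ge>no. norm (S n - f) < e"
      proof (intro exI allI impI)
        fix n assume "no \<le> n"
        \<comment> \<open>Three errors: the tail of the series in \<open>i\<close>, the expansions
          of finitely many \<open>z i\<close> cut at \<open>n\<close>, and the residual
          \<open>Y I\<close>. The first and the last are small by the choice of \<open>I\<close>,
          the middle one for large \<open>n\<close>.\<close>
        have "S n - f = (S n - (\<Sum>i<I. s n (z i))) + ((\<Sum>i<I. s n (z i)) - (\<Sum>i<I. z i)) - Y I"
          by (simp add: zsum)
        also have "norm \<dots> \<le> norm (S n - (\<Sum>i<I. s n (z i)))
            + norm ((\<Sum>i<I. s n (z i)) - (\<Sum>i<I. z i)) + norm (Y I)"
          by (smt (verit) norm_triangle_ineq norm_triangle_ineq4)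
        also have "\<dots> < e"
          using tail[of n I] no[OF \<open>no \<le> n\<close>] Yn[of I] I by (simp add: algebra_simps)
        finally show "norm (S n - f) < e" .
      qed
    qed
    then have "(\<lambda>j. sc (c j) (b j)) sums f"
      by (simp add: sums_def S_def[abs_def])
    then have "coord sc b j f = c j" for j
      by (rule coord_unique[OF b])
    then have "s n f = S n" by (simp add: s_def S_def)
    then show ?thesis using SM by (simp add: R_def)
  qed
  then show ?thesis unfolding s_def by blast
qed

text \<open>The \<open>n\<close>-th term is a difference of consecutive partial sums, so the uniform
  bound on these bounds the coordinate.\<close>

lemma scalar_linear_coord:
  assumes b: "schauder_basis sc b"
  shows "scalar_linear (coord sc b n)"
proof -
  obtain K where K: "\<And>n f. norm (\<Sum>i<n. sc (coord sc b i f) (b i)) \<le> K * norm f"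
    using schauder_basis_constant[OF b] by blast
  have "norm (coord sc b n f) \<le> norm f * (2 * K / norm (b n))" for f
  proof -
    define s where "s n = (\<Sum>i<n. sc (coord sc b i f) (b i))" for n
    have "sc (coord sc b n f) (b n) = s (Suc n) - s n"
      by (simp add: s_def)
    from arg_cong[OF this, of norm] have "norm (sc (coord sc b n f) (b n)) \<le> 2 * (K * norm f)"
      using norm_triangle_ineq4[of "s (Suc n)" "s n"] K[of f "Suc n"] K[of f n]
      unfolding s_def[symmetric] by linarith
    moreover have "0 < norm (b n)"
      using schauder_basis_nonzero[OF b, of n] by simp
    ultimately have "norm (coord sc b n f) \<le> 2 * (K * norm f) / norm (b n)"
      by (simp only: norm_scale pos_le_divide_eq)
    then show ?thesis by (simp add: mult_ac)
  qed
  then have "bounded_linear (coord sc b n)"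
    by (intro bounded_linear_intro[where K = "2 * K / norm (b n)"])
       (auto simp: coord_add[OF b] coord_scaleR[OF b])
  then show ?thesis
    by (simp add: scalar_linear_def coord_scale[OF b])
qed

end

section \<open>A criterion for almost greediness\<close>

text \<open>Initial segments are the worst case: the induction adds a largest element
  \<open>j\<close>, which is at least the number \<open>n\<close> of the earlier ones, so its term
  is at most \<open>1 / sqrt (n + 1)\<close> and telescopes against
  \<open>2 * sqrt n\<close>.\<close>

lemma sum_inverse_sqrt_le:
  assumes "finite F"
  shows "(\<Sum>j\<in>F. 1 / sqrt (real (j + 1))) \<le> 2 * sqrt (real (card F))"
  using assms
proof (induction F rule: finite_linorder_max_induct)
  case empty
  then show ?case by simp
next
  case (insert j F)
  define n where "n = card F"
  have "F \<subseteq> {..<j}" using insert by auto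
  then have "n \<le> j" unfolding n_def by (metis card_lessThan card_mono finite_lessThan)
  have "1 / sqrt (real (j + 1)) \<le> 1 / sqrt (real (n + 1))"
    using \<open>n \<le> j\<close> by (intro divide_left_mono) auto
  also have "\<dots> \<le> 2 * (sqrt (real (n + 1)) - sqrt (real n))"
  proof -
    define p q where "p = sqrt (real (n + 1))" and "q = sqrt (real n)"
    have "0 < p" "0 \<le> q" "q \<le> p" "(p - q) * (p + q) = 1"
      by (auto simp: p_def q_def algebra_simps)
    moreover have "(p - q) * (p + q) \<le> (p - q) * (2 * p)"
      using \<open>q \<le> p\<close> by (intro mult_left_mono) auto
    ultimately have "1 / p \<le> 2 * (p - q)"
      by (simp add: field_simps)
    then show ?thesis by (simp only: p_def q_def)
  qed
  finally show ?case
    using insert by (auto simp: n_def)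
qed

lemma norm_diff_add_le:
  fixes x y z :: "'a::real_normed_vector"
  shows "norm (x - y + z) \<le> norm x + norm y + norm z"
  using norm_triangle_ineq[of "x - y" z] norm_triangle_ineq4[of x y] by linarith

lemma real_sqrt_mult_le_of_card:
  fixes t R :: real
  assumes "0 \<le> t" "0 \<le> R" "real n * t\<^sup>2 \<le> R\<^sup>2"
  shows "t * sqrt (real n) \<le> R"
proof -
  have "t * sqrt (real n) = sqrt (real n * t\<^sup>2)"
    using assms by (simp add: real_sqrt_mult)
  also have "\<dots> \<le> sqrt (R\<^sup>2)" using assms(3) by (rule real_sqrt_le_mono)
  finally show ?thesis using assms(2) by simp
qed

text \<open>
  The two estimates say that the coordinates split into a square summable part and a part
  \<open>\<alpha>\<close> that decays like \<open>(j + 1) powr (-1/2)\<close>, and that conversely the norm is controlled by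
  the \<open>\<ell>\<^sub>2\<close>-norm plus the dual weighted \<open>\<ell>\<^sub>1\<close>-norm of the coordinates.
\<close>

locale sqrt_democratic_basis = euclidean_banach_space_over sc
  for sc :: "'k::{real_normed_field,euclidean_space} \<Rightarrow> 'x::banach \<Rightarrow> 'x" +
  fixes b :: "nat \<Rightarrow> 'x" and K :: real and \<alpha> :: "nat \<Rightarrow> 'x \<Rightarrow> 'k"
  assumes basis: "schauder_basis sc b"
    and K_ge_1: "1 \<le> K"
    and upper: "finite D \<Longrightarrow> norm (\<Sum>j\<in>D. sc (a j) (b j)) \<le>
        K * sqrt (\<Sum>j\<in>D. (norm (a j))\<^sup>2) + K * (\<Sum>j\<in>D. norm (a j) / sqrt (real (j + 1)))"
    and lower_square: "finite F \<Longrightarrow>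
        (\<Sum>j\<in>F. (norm (coord sc b j f - \<alpha> j f))\<^sup>2) \<le> K\<^sup>2 * (norm f)\<^sup>2"
    and lower_decay: "norm (\<alpha> j f) \<le> K * norm f / sqrt (real (j + 1))"
begin

text \<open>The square sum contributes \<open>t * sqrt (card F)\<close> and the weighted sum twice
  as much, hence the factor 3.\<close>

lemma norm_flat_le:
  assumes "finite F" "0 \<le> t" "\<And>j. j \<in> F \<Longrightarrow> norm (a j) \<le> t"
  shows "norm (\<Sum>j\<in>F. sc (a j) (b j)) \<le> 3 * K * t * sqrt (real (card F))"
proof -
  have "sqrt (\<Sum>j\<in>F. (norm (a j))\<^sup>2) \<le> sqrt (\<Sum>j\<in>F. t\<^sup>2)"
    using assms by (intro real_sqrt_le_mono sum_mono power_mono) auto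
  also have "\<dots> = t * sqrt (real (card F))"
    using assms by (simp add: real_sqrt_mult)
  finally have 1: "K * sqrt (\<Sum>j\<in>F. (norm (a j))\<^sup>2) \<le> K * (t * sqrt (real (card F)))"
    using K_ge_1 by (intro mult_left_mono) auto
  have "(\<Sum>j\<in>F. norm (a j) / sqrt (real (j + 1))) \<le> (\<Sum>j\<in>F. t * (1 / sqrt (real (j + 1))))"
    using assms by (intro sum_mono) (auto simp: divide_right_mono)
  also have "\<dots> \<le> t * (2 * sqrt (real (card F)))"
    unfolding sum_distrib_left[symmetric]
    using assms by (intro mult_left_mono sum_inverse_sqrt_le) auto
  finally have 2: "K * (\<Sum>j\<in>F. norm (a j) / sqrt (real (j + 1))) \<le> K * (t * (2 * sqrt (real (card F))))"
    using K_ge_1 by (intro mult_left_mono) auto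
  show ?thesis
    using upper[OF assms(1), of a] 1 2 by (simp add: algebra_simps)
qed

text \<open>A coordinate of size \<open>t\<close> has a part of size \<open>t / 2\<close> either in
  the square summable component, where Chebyshev's inequality counts the indices, or in the decaying
  component, where only indices below \<open>B\<close> are possible.\<close>

lemma large_coordinates_le:
  assumes "finite F" "0 < t" "\<And>j. j \<in> F \<Longrightarrow> t \<le> norm (coord sc b j f)"
  shows "t * sqrt (real (card F)) \<le> 3 * K * norm f"
proof -
  define F1 F2 where "F1 = {j \<in> F. t / 2 \<le> norm (coord sc b j f - \<alpha> j f)}"
    and "F2 = {j \<in> F. t / 2 \<le> norm (\<alpha> j f)}"
  define B where "B = 4 * K\<^sup>2 * (norm f)\<^sup>2 / t\<^sup>2"
  have fin: "finite F1" "finite F2" using assms by (auto simp: F1_def F2_def)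
  have "F \<subseteq> F1 \<union> F2"
  proof
    fix j assume "j \<in> F"
    then have "t \<le> norm (coord sc b j f - \<alpha> j f) + norm (\<alpha> j f)"
      using assms(3) norm_triangle_ineq[of "coord sc b j f - \<alpha> j f" "\<alpha> j f"] by force
    then show "j \<in> F1 \<union> F2" using \<open>j \<in> F\<close> by (auto simp: F1_def F2_def)
  qed
  then have card: "card F \<le> card F1 + card F2"
    using fin by (meson card_Un_le card_mono finite_UnI order_trans)
  have "real (card F1) * (t / 2)\<^sup>2 = (\<Sum>j\<in>F1. (t / 2)\<^sup>2)" by simp
  also have "\<dots> \<le> (\<Sum>j\<in>F1. (norm (coord sc b j f - \<alpha> j f))\<^sup>2)"
    using assms(2) by (intro sum_mono power_mono) (auto simp: F1_def)
  also have "\<dots> \<le> K\<^sup>2 * (norm f)\<^sup>2" by (rule lower_square[OF fin(1)])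
  finally have 1: "real (card F1) * t\<^sup>2 \<le> 4 * K\<^sup>2 * (norm f)\<^sup>2"
    by (simp add: power_divide)
  have "F2 \<subseteq> {..<nat \<lfloor>B\<rfloor>}"
  proof
    fix j assume "j \<in> F2"
    then have "t / 2 \<le> norm (\<alpha> j f)" by (simp add: F2_def)
    also note lower_decay[of j f]
    finally have "t / 2 \<le> K * norm f / sqrt (real (j + 1))" .
    then have "t * sqrt (real (j + 1)) \<le> 2 * K * norm f"
      by (simp add: field_simps)
    then have "(t * sqrt (real (j + 1)))\<^sup>2 \<le> (2 * K * norm f)\<^sup>2"
      using assms(2) by (intro power_mono) auto
    then have "real (j + 1) \<le> B"
      using assms(2) by (simp add: B_def power_mult_distrib field_simps)
    then have "int (j + 1) \<le> \<lfloor>B\<rfloor>" by (simp add: le_floor_iff)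
    then show "j \<in> {..<nat \<lfloor>B\<rfloor>}" by auto
  qed
  then have "card F2 \<le> nat \<lfloor>B\<rfloor>" by (metis card_lessThan card_mono finite_lessThan)
  then have "real (card F2) \<le> B"
    by (smt (verit) B_def divide_nonneg_nonneg mult_nonneg_nonneg of_nat_floor of_nat_mono zero_le_power2)
  then have 2: "real (card F2) * t\<^sup>2 \<le> 4 * K\<^sup>2 * (norm f)\<^sup>2"
    using assms(2) by (simp add: B_def field_simps)
  have "real (card F) * t\<^sup>2 \<le> (real (card F1) + real (card F2)) * t\<^sup>2"
    using card by (intro mult_right_mono) auto
  \<comment> \<open>Each of the two counts contributes a factor 4; their sum 8 is rounded up to the
    square 9.\<close>
  also have "\<dots> \<le> (3 * K * norm f)\<^sup>2"
  proof -
    have "0 \<le> K\<^sup>2 * (norm f)\<^sup>2" "(3 * K * norm f)\<^sup>2 = 9 * (K\<^sup>2 * (norm f)\<^sup>2)"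
      by (simp_all add: power_mult_distrib)
    then show ?thesis
      using 1 2 unfolding distrib_right mult.assoc by linarith
  qed
  finally show ?thesis
    using assms(2) K_ge_1 by (intro real_sqrt_mult_le_of_card) auto
qed

text \<open>
  Quasi-greediness. Beyond \<open>m = \<lfloor>4 K\<^sup>2 (norm f)\<^sup>2 / t\<^sup>2\<rfloor>\<close> the decaying part is below \<open>t / 2\<close>, so
  large coordinates are dominated there by their square summable part; up to \<open>m\<close> one passes to the
  complement of \<open>D\<close>, at the cost of a partial sum of the basis.
\<close>

lemma threshold_projection_bounded:
  "\<exists>C\<ge>0. \<forall>f D t. finite D \<longrightarrow> 0 < t \<longrightarrow> (\<forall>j\<in>D. t \<le> norm (coord sc b j f)) \<longrightarrow>
     (\<forall>j\<in>-D. norm (coord sc b j f) \<le> t) \<longrightarrow>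
     norm (\<Sum>j\<in>D. sc (coord sc b j f) (b j)) \<le> C * norm f"
proof -
  obtain K0 where K0: "\<And>n f. norm (\<Sum>i<n. sc (coord sc b i f) (b i)) \<le> K0 * norm f"
    using schauder_basis_constant[OF basis] by blast
  show ?thesis
  proof (rule exI[of _ "\<bar>K0\<bar> + 10 * K\<^sup>2"], intro conjI allI impI)
    fix f D and t :: real
    assume D: "finite D" and t: "0 < t" and large: "\<forall>j\<in>D. t \<le> norm (coord sc b j f)"
      and small: "\<forall>j\<in>-D. norm (coord sc b j f) \<le> t"
    define a where "a j = coord sc b j f" for j
    define R where "R = norm f"
    define B where "B = 4 * K\<^sup>2 * R\<^sup>2 / t\<^sup>2"
    define m where "m = nat \<lfloor>B\<rfloor>"
    define D' where "D' = D - {..<m}"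
    define q where "q j = norm (a j - \<alpha> j f)" for j
    show "norm (\<Sum>j\<in>D. sc (coord sc b j f) (b j)) \<le> (\<bar>K0\<bar> + 10 * K\<^sup>2) * norm f"
    proof (cases "R = 0")
      case True
      then have "f = 0" by (simp add: R_def)
      then have "coord sc b j f = 0" for j
        using coord_finite_sum[OF basis, of "{}"] by simp
      then have "D = {}" using large t by force
      then show ?thesis by simp
    next
      case False
      then have R: "0 < R" by (simp add: R_def)
      have B0: "0 \<le> B" by (simp add: B_def)
      have "{..<m} = ({..<m} - D) \<union> (D \<inter> {..<m})" by auto
      then have "(\<Sum>j<m. sc (a j) (b j)) =
          (\<Sum>j\<in>{..<m} - D. sc (a j) (b j)) + (\<Sum>j\<in>D \<inter> {..<m}. sc (a j) (b j))"
        by (metis (no_types, lifting) D Diff_disjoint Diff_eq finite_Diff finite_Int finite_lessThan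
            inf_commute inf_left_commute inf_bot_right sum.union_disjoint Compl_disjoint2 Int_assoc)
      moreover have "(\<Sum>j\<in>D. sc (a j) (b j)) =
          (\<Sum>j\<in>D \<inter> {..<m}. sc (a j) (b j)) + (\<Sum>j\<in>D'. sc (a j) (b j))"
        unfolding D'_def using D by (rule sum.Int_Diff)
      ultimately have split: "(\<Sum>j\<in>D. sc (a j) (b j)) = (\<Sum>j<m. sc (a j) (b j))
          - (\<Sum>j\<in>{..<m} - D. sc (a j) (b j)) + (\<Sum>j\<in>D'. sc (a j) (b j))" by simp
      have first: "norm (\<Sum>j<m. sc (a j) (b j)) \<le> \<bar>K0\<bar> * R"
        unfolding a_def R_def
        by (rule order_trans[OF K0[of f m]]) (simp add: mult_right_mono)
      have "norm (\<Sum>j\<in>{..<m} - D. sc (a j) (b j)) \<le> 3 * K * (t * sqrt (real (card ({..<m} - D))))"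
        using norm_flat_le[of "{..<m} - D" t a] small t by (simp add: a_def mult.assoc)
      also have "\<dots> \<le> 3 * K * (t * sqrt (real m))"
        using K_ge_1 t card_mono[of "{..<m}" "{..<m} - D"]
        by (intro mult_left_mono real_sqrt_le_mono) auto
      also have "t * sqrt (real m) \<le> 2 * K * R"
      proof (rule real_sqrt_mult_le_of_card)
        have "real m \<le> B" using B0 by (simp add: m_def)
        then show "real m * t\<^sup>2 \<le> (2 * K * R)\<^sup>2"
          using t by (simp add: B_def power_mult_distrib field_simps)
      qed (use t R K_ge_1 in auto)
      finally have second: "norm (\<Sum>j\<in>{..<m} - D. sc (a j) (b j)) \<le> 6 * K\<^sup>2 * R"
        using K_ge_1 by (simp add: power2_eq_square)
      have qt: "t / 2 \<le> q j" "norm (a j) \<le> 2 * q j" "1 / sqrt (real (j + 1)) \<le> t / (2 * K * R)"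
        if "j \<in> D'" for j
      proof -
        have "m \<le> j" using that by (simp add: D'_def)
        then have "B \<le> real (j + 1)" unfolding m_def by linarith
        then have "(2 * K * R)\<^sup>2 \<le> (t * sqrt (real (j + 1)))\<^sup>2"
          using t by (simp add: B_def power_mult_distrib field_simps)
        then have "2 * K * R \<le> t * sqrt (real (j + 1))"
          using t by (rule_tac power2_le_imp_le) auto
        then show *: "1 / sqrt (real (j + 1)) \<le> t / (2 * K * R)"
          using R K_ge_1 by (simp add: field_simps)
        have "norm (\<alpha> j f) \<le> K * R * (1 / sqrt (real (j + 1)))"
          using lower_decay[of j f] by (simp add: R_def)
        also have "\<dots> \<le> K * R * (t / (2 * K * R))"
          using * R K_ge_1 by (intro mult_left_mono) auto
        also have "\<dots> = t / 2" using R K_ge_1 by simp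
        finally have "norm (\<alpha> j f) \<le> t / 2" .
        moreover have "norm (a j) \<le> q j + norm (\<alpha> j f)"
          using norm_triangle_ineq[of "a j - \<alpha> j f" "\<alpha> j f"] by (simp add: q_def)
        moreover have "t \<le> norm (a j)" using large that by (auto simp: a_def D'_def)
        ultimately show "t / 2 \<le> q j" "norm (a j) \<le> 2 * q j" by linarith+
      qed
      have finD': "finite D'" using D by (simp add: D'_def)
      have qsum: "(\<Sum>j\<in>D'. (q j)\<^sup>2) \<le> K\<^sup>2 * R\<^sup>2"
        using lower_square[OF finD', of f] by (simp add: q_def a_def R_def)
      have "sqrt (\<Sum>j\<in>D'. (norm (a j))\<^sup>2) \<le> sqrt (\<Sum>j\<in>D'. 4 * (q j)\<^sup>2)"
        using power_mono[OF qt(2), of _ 2] by (intro real_sqrt_le_mono sum_mono) (simp add: power_mult_distrib)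
      also have "\<dots> \<le> sqrt ((2 * K * R)\<^sup>2)"
        unfolding sum_distrib_left[symmetric]
        using qsum by (intro real_sqrt_le_mono) (simp add: power_mult_distrib)
      finally have "K * sqrt (\<Sum>j\<in>D'. (norm (a j))\<^sup>2) \<le> K * (2 * K * R)"
        using R K_ge_1 by (intro mult_left_mono) auto
      then have l2: "K * sqrt (\<Sum>j\<in>D'. (norm (a j))\<^sup>2) \<le> 2 * K\<^sup>2 * R"
        by (simp add: power2_eq_square mult_ac)
      \<comment> \<open>On \<open>D'\<close> the weight \<open>1 / sqrt (j + 1)\<close> is at most
        \<open>t / (2 * K * R)\<close>, hence at most \<open>q j / (K * R)\<close>; this converts
        the weighted sum into a square sum.\<close>
      have "(\<Sum>j\<in>D'. norm (a j) / sqrt (real (j + 1))) \<le> (\<Sum>j\<in>D'. 2 / (K * R) * (q j)\<^sup>2)"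
      proof (rule sum_mono)
        fix j assume j: "j \<in> D'"
        have "norm (a j) * (1 / sqrt (real (j + 1))) \<le> (2 * q j) * (t / (2 * K * R))"
          using qt[OF j] t R K_ge_1 by (intro mult_mono) auto
        also have "\<dots> \<le> (2 * q j) * (2 * q j / (2 * K * R))"
          using qt[OF j] t R K_ge_1 by (intro mult_left_mono divide_right_mono) auto
        also have "\<dots> = 2 / (K * R) * (q j)\<^sup>2" by (simp add: power2_eq_square)
        finally show "norm (a j) / sqrt (real (j + 1)) \<le> 2 / (K * R) * (q j)\<^sup>2" by simp
      qed
      also have "\<dots> \<le> 2 / (K * R) * (K\<^sup>2 * R\<^sup>2)"
        unfolding sum_distrib_left[symmetric]
        using qsum R K_ge_1 by (intro mult_left_mono) auto
      also have "\<dots> = 2 * K * R" using R K_ge_1 by (simp add: power2_eq_square)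
      finally have "K * (\<Sum>j\<in>D'. norm (a j) / sqrt (real (j + 1))) \<le> K * (2 * K * R)"
        using K_ge_1 by (intro mult_left_mono) auto
      moreover have "K * (2 * K * R) = 2 * K\<^sup>2 * R" by (simp add: power2_eq_square)
      ultimately have third: "norm (\<Sum>j\<in>D'. sc (a j) (b j)) \<le> 4 * K\<^sup>2 * R"
        using upper[OF finD', of a] l2 by linarith
      have "norm (\<Sum>j\<in>D. sc (a j) (b j)) \<le> norm (\<Sum>j<m. sc (a j) (b j))
          + norm (\<Sum>j\<in>{..<m} - D. sc (a j) (b j)) + norm (\<Sum>j\<in>D'. sc (a j) (b j))"
        unfolding split by (rule norm_diff_add_le)
      then show ?thesis
        using first second third by (simp add: a_def R_def algebra_simps)
    qed
  qed simp
qed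

text \<open>With \<open>g = f - S B\<close> one has
  \<open>f - S A = g - S (A - B) + S (B - A)\<close>. The set \<open>A - B\<close> is a threshold
  set for \<open>g\<close>. On \<open>B - A\<close> the coordinates of \<open>f\<close> are at most
  \<open>t\<close>, and this set has no more elements than \<open>A - B\<close>, where the
  coordinates of \<open>g\<close> are at least \<open>t\<close>.\<close>

lemma almost_greedy: "almost_greedy sc b"
proof -
  obtain C where C: "0 \<le> C" and thr: "\<And>f D t. finite D \<Longrightarrow> 0 < t \<Longrightarrow>
      (\<forall>j\<in>D. t \<le> norm (coord sc b j f)) \<Longrightarrow> (\<forall>j\<in>-D. norm (coord sc b j f) \<le> t) \<Longrightarrow>
      norm (\<Sum>j\<in>D. sc (coord sc b j f) (b j)) \<le> C * norm f"
    using threshold_projection_bounded by blast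
  show ?thesis
    unfolding almost_greedy_def
  proof (rule exI[of _ "1 + C + 9 * K\<^sup>2"], intro allI impI, elim conjE)
    fix f and A B :: "nat set"
    assume A: "finite A" and B: "finite B" and AB: "card B \<le> card A"
      and greedy: "\<forall>j\<in>- A. \<forall>k\<in>A. norm (coord sc b j f) \<le> norm (coord sc b k f)"
    define a where "a j = coord sc b j f" for j
    define S where "S E = (\<Sum>j\<in>E. sc (a j) (b j))" for E
    define g where "g = f - S B"
    have SA: "coord_proj sc b A f = S A" and SB: "coord_proj sc b B f = S B"
      using A B by (simp_all add: coord_proj_finite S_def a_def)
    have "norm (f - S A) \<le> (1 + C + 9 * K\<^sup>2) * norm g"
    proof (cases "A = {}")
      case True
      then have "B = {}" using AB B by simp
      then have "norm (f - S A) = 1 * norm g"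
        using True by (simp add: g_def S_def)
      also have "\<dots> \<le> (1 + C + 9 * K\<^sup>2) * norm g"
        using C by (intro mult_right_mono) auto
      finally show ?thesis .
    next
      case False
      define t where "t = Min ((\<lambda>j. norm (a j)) ` A)"
      have tA: "t \<le> norm (a j)" if "j \<in> A" for j
        using A that by (simp add: t_def)
      have "t \<in> (\<lambda>j. norm (a j)) ` A"
        unfolding t_def using A False by (intro Min_in) auto
      then obtain k where k: "k \<in> A" "t = norm (a k)" by blast
      have tnA: "norm (a j) \<le> t" if "j \<notin> A" for j
        using greedy k that by (auto simp: a_def)
      show ?thesis
      proof (cases "t = 0")
        case True
        \<comment> \<open>With threshold 0 every coordinate outside \<open>A\<close> vanishes, so
          \<open>f\<close> is its own projection.\<close>
        then have "sc (a j) (b j) = 0" if "j \<notin> A" for j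
          using tnA[OF that] by (simp add: sc.zero_left)
        then have "f = S A"
          using sums_finite[OF A, of "\<lambda>j. sc (a j) (b j)"] coord_sums[OF basis, of f]
          unfolding S_def a_def using sums_unique2 by blast
        then show ?thesis using C by simp
      next
        case False
        then have t: "0 < t" using k(2) by simp
        have cg: "coord sc b j g = (if j \<in> B then 0 else a j)" for j
        proof -
          have "a j = coord sc b j g + coord sc b j (S B)"
            using coord_add[OF basis, of j g "S B"] by (simp add: g_def a_def)
          moreover have "coord sc b j (S B) = (if j \<in> B then a j else 0)"
            unfolding S_def by (rule coord_finite_sum[OF basis B])
          ultimately show ?thesis by (simp split: if_splits)
        qed
        have "norm (\<Sum>j\<in>A - B. sc (coord sc b j g) (b j)) \<le> C * norm g"
          using A t tA tnA by (intro thr[of _ t]) (auto simp: cg)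
        moreover have "(\<Sum>j\<in>A - B. sc (coord sc b j g) (b j)) = S (A - B)"
          unfolding S_def by (rule sum.cong) (auto simp: cg)
        ultimately have 1: "norm (S (A - B)) \<le> C * norm g" by simp
        have "card (B - A) \<le> card (A - B)"
          by (rule card_le_sym_Diff[OF B A AB])
        then have "3 * K * t * sqrt (real (card (B - A))) \<le> 3 * K * (t * sqrt (real (card (A - B))))"
          using K_ge_1 t by simp
        also have "\<dots> \<le> 3 * K * (3 * K * norm g)"
          using A t tA K_ge_1 by (intro mult_left_mono large_coordinates_le) (auto simp: cg)
        finally have 2: "norm (S (B - A)) \<le> 9 * K\<^sup>2 * norm g"
          using norm_flat_le[of "B - A" t a] B t tnA
          by (simp add: S_def power2_eq_square)
        have "S A = S (A \<inter> B) + S (A - B)" "S B = S (B \<inter> A) + S (B - A)"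
          unfolding S_def by (rule sum.Int_Diff[OF A], rule sum.Int_Diff[OF B])
        then have "f - S A = g - S (A - B) + S (B - A)"
          by (simp add: g_def Int_commute)
        also have "norm \<dots> \<le> norm g + norm (S (A - B)) + norm (S (B - A))"
          by (rule norm_diff_add_le)
        finally show ?thesis
          using 1 2 by (simp add: algebra_simps)
      qed
    qed
    then show "norm (f - coord_proj sc b A f) \<le> (1 + C + 9 * K\<^sup>2) * norm (f - coord_proj sc b B f)"
      by (simp add: SA SB g_def)
  qed
qed

text \<open>Unit coefficients are flat, which gives the upper estimate, and large, which gives the
  lower one; for the latter the segment \<open>{..<m}\<close> suffices as a test set.\<close>

lemma fundamental_function_approx:
  "approx_on {1..} (fundamental_function b) (\<lambda>m. ennreal (real m powr (1/2)))"
  unfolding approx_on_def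
proof
  have unit: "(\<Sum>j\<in>A. sc 1 (b j)) = (\<Sum>j\<in>A. b j)" for A
    by simp
  show "lesssim_on {1..} (fundamental_function b) (\<lambda>m. ennreal (real m powr (1/2)))"
    unfolding lesssim_on_def
  proof (intro exI[of _ "3 * K"] ballI)
    fix m :: nat
    have "norm (\<Sum>j\<in>A. b j) \<le> 3 * K * real m powr (1/2)" if "finite A" "card A \<le> m" for A
    proof -
      have "norm (\<Sum>j\<in>A. b j) \<le> 3 * K * sqrt (real (card A))"
        using norm_flat_le[of A 1 "\<lambda>_. 1"] that by simp
      also have "\<dots> \<le> 3 * K * sqrt (real m)"
        using K_ge_1 that by simp
      finally show ?thesis by (simp add: powr_half_sqrt)
    qed
    then show "fundamental_function b m \<le> ennreal (3 * K) * ennreal (real m powr (1/2))"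
      unfolding fundamental_function_def using K_ge_1
      by (auto intro!: SUP_least ennreal_leI simp: ennreal_mult[symmetric])
  qed
  show "lesssim_on {1..} (\<lambda>m. ennreal (real m powr (1/2))) (fundamental_function b)"
    unfolding lesssim_on_def
  proof (intro exI[of _ "3 * K"] ballI)
    fix m :: nat
    have "1 * sqrt (real (card {..<m})) \<le> 3 * K * norm (\<Sum>j<m. b j)"
      by (rule large_coordinates_le)
         (use coord_finite_sum[OF basis, of "{..<m}" _ "\<lambda>_. 1"] in simp_all)
    then have "ennreal (real m powr (1/2)) \<le> ennreal (3 * K) * ennreal (norm (\<Sum>j<m. b j))"
      using K_ge_1 by (auto intro!: ennreal_leI simp: ennreal_mult[symmetric] powr_half_sqrt)
    also have "\<dots> \<le> ennreal (3 * K) * fundamental_function b m"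
      unfolding fundamental_function_def
      by (intro mult_left_mono SUP_upper2[of "{..<m}"]) auto
    finally show "ennreal (real m powr (1/2)) \<le> ennreal (3 * K) * fundamental_function b m" .
  qed
qed

end

section \<open>Weighted Haar matrices\<close>

lemma sum_lessThan_double:
  fixes f :: "nat \<Rightarrow> 'a::comm_monoid_add"
  shows "(\<Sum>n<2 * N. f n) = (\<Sum>n<N. f n) + (\<Sum>n<N. f (N + n))"
proof -
  have "(\<Sum>n<2 * N. f n) = (\<Sum>n<N. f n) + (\<Sum>n=N..<N + N. f n)"
    by (simp add: lessThan_atLeast0 sum.atLeastLessThan_concat mult_2)
  also have "(\<Sum>n=N..<N + N. f n) = (\<Sum>n<N. f (N + n))"
    using sum.shift_bounds_nat_ivl[of f 0 N N] by (simp add: lessThan_atLeast0 add.commute)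
  finally show ?thesis .
qed

lemma sum_from_1_double:
  fixes f :: "nat \<Rightarrow> 'a::comm_monoid_add"
  assumes "0 < N"
  shows "(\<Sum>n=1..<2 * N. f n) = (\<Sum>n=1..<N. f n) + f N + (\<Sum>n=1..<N. f (N + n))"
proof -
  have "(\<Sum>n=1..<2 * N. f n) = (\<Sum>n=1..<N. f n) + (\<Sum>n=N..<N + N. f n)"
    using assms by (simp add: sum.atLeastLessThan_concat mult_2)
  also have "(\<Sum>n=N..<N + N. f n) = f N + (\<Sum>n=Suc N..<N + N. f n)"
    using assms by (simp add: sum.atLeast_Suc_lessThan)
  also have "(\<Sum>n=Suc N..<N + N. f n) = (\<Sum>n=1..<N. f (N + n))"
    using sum.shift_bounds_nat_ivl[of f 1 N N] by (simp add: add.commute)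
  finally show ?thesis by (simp add: add.assoc)
qed

lemma sqrt_2_power_squared: "(sqrt 2 ^ k)\<^sup>2 = 2 ^ k"
  by (simp add: real_sqrt_power[symmetric])

section \<open>Square sums under matrices\<close>

lemma sum_norm_sq_matrix:
  fixes c :: "'n \<Rightarrow> 'a::real_inner" and u :: "'r \<Rightarrow> 'n \<Rightarrow> real"
  shows "(\<Sum>r\<in>R. (norm (\<Sum>n\<in>A. u r n *\<^sub>R c n))\<^sup>2) =
    (\<Sum>n\<in>A. \<Sum>m\<in>A. (\<Sum>r\<in>R. u r n * u r m) * (c n \<bullet> c m))"
proof -
  have "(norm (\<Sum>n\<in>A. u r n *\<^sub>R c n))\<^sup>2 = (\<Sum>n\<in>A. \<Sum>m\<in>A. u r n * u r m * (c n \<bullet> c m))" for r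
    by (simp add: power2_norm_eq_inner inner_sum_left inner_sum_right mult_ac inner_commute)
  then have "(\<Sum>r\<in>R. (norm (\<Sum>n\<in>A. u r n *\<^sub>R c n))\<^sup>2) =
      (\<Sum>r\<in>R. \<Sum>n\<in>A. \<Sum>m\<in>A. u r n * u r m * (c n \<bullet> c m))"
    by simp
  also have "\<dots> = (\<Sum>n\<in>A. \<Sum>r\<in>R. \<Sum>m\<in>A. u r n * u r m * (c n \<bullet> c m))"
    by (rule sum.swap)
  also have "\<dots> = (\<Sum>n\<in>A. \<Sum>m\<in>A. \<Sum>r\<in>R. u r n * u r m * (c n \<bullet> c m))"
    by (intro sum.cong refl sum.swap)
  finally show ?thesis by (simp add: sum_distrib_right)
qed

text \<open>The expanded square sum sees only the Gram matrix of the columns. Exchanging the roles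
  of the indices gives the version for rows.\<close>

lemma orthonormal_columns_isometry:
  fixes c :: "'n \<Rightarrow> 'a::real_inner" and u :: "'r \<Rightarrow> 'n \<Rightarrow> real"
  assumes "finite A" "\<And>n m. n \<in> A \<Longrightarrow> m \<in> A \<Longrightarrow> (\<Sum>r\<in>R. u r n * u r m) = of_bool (n = m)"
  shows "(\<Sum>r\<in>R. (norm (\<Sum>n\<in>A. u r n *\<^sub>R c n))\<^sup>2) = (\<Sum>n\<in>A. (norm (c n))\<^sup>2)"
proof -
  have "(\<Sum>r\<in>R. (norm (\<Sum>n\<in>A. u r n *\<^sub>R c n))\<^sup>2) = (\<Sum>n\<in>A. \<Sum>m\<in>A. of_bool (n = m) * (c n \<bullet> c m))"
    unfolding sum_norm_sq_matrix using assms(2) by (intro sum.cong) auto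
  also have "\<dots> = (\<Sum>n\<in>A. (norm (c n))\<^sup>2)"
  proof (rule sum.cong[OF refl])
    fix n assume "n \<in> A"
    have "(\<Sum>m\<in>A. of_bool (n = m) * (c n \<bullet> c m)) = (\<Sum>m\<in>A. if n = m then c n \<bullet> c m else 0)"
      by (rule sum.cong) auto
    then show "(\<Sum>m\<in>A. of_bool (n = m) * (c n \<bullet> c m)) = (norm (c n))\<^sup>2"
      using \<open>n \<in> A\<close> assms(1) by (simp add: power2_norm_eq_inner)
  qed
  finally show ?thesis .
qed

text \<open>Duality: if \<open>d\<close> is the image of \<open>c\<close> under the transpose, the
  square of its norm \<open>D\<close> is the pairing of \<open>c\<close> with \<open>M\<close>
  applied to \<open>d\<close>, which is at most \<open>C * D\<close> times the norm of
  \<open>c\<close>; one factor \<open>D\<close> cancels.\<close>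

lemma transpose_bounded:
  fixes M :: "'r \<Rightarrow> 's \<Rightarrow> real" and c :: "'r \<Rightarrow> 'a::real_inner"
  assumes bound: "\<And>c::'s \<Rightarrow> 'a. L2_set (\<lambda>r. norm (\<Sum>s\<in>S. M r s *\<^sub>R c s)) R \<le> C * L2_set (\<lambda>s. norm (c s)) S"
    and "0 \<le> C"
  shows "L2_set (\<lambda>s. norm (\<Sum>r\<in>R. M r s *\<^sub>R c r)) S \<le> C * L2_set (\<lambda>r. norm (c r)) R"
proof -
  define d where "d s = (\<Sum>r\<in>R. M r s *\<^sub>R c r)" for s
  define D where "D = L2_set (\<lambda>s. norm (d s)) S"
  have D0: "0 \<le> D" by (simp add: D_def)
  have "D\<^sup>2 = (\<Sum>s\<in>S. d s \<bullet> (\<Sum>r\<in>R. M r s *\<^sub>R c r))"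
    by (simp add: D_def L2_set_def sum_nonneg power2_norm_eq_inner flip: d_def)
  also have "\<dots> = (\<Sum>s\<in>S. \<Sum>r\<in>R. c r \<bullet> (M r s *\<^sub>R d s))"
    by (simp add: inner_sum_right inner_commute)
  also have "\<dots> = (\<Sum>r\<in>R. c r \<bullet> (\<Sum>s\<in>S. M r s *\<^sub>R d s))"
    unfolding inner_sum_right by (rule sum.swap)
  also have "\<dots> \<le> (\<Sum>r\<in>R. \<bar>norm (c r)\<bar> * \<bar>norm (\<Sum>s\<in>S. M r s *\<^sub>R d s)\<bar>)"
    by (rule sum_mono) (simp add: norm_cauchy_schwarz)
  also have "\<dots> \<le> L2_set (\<lambda>r. norm (c r)) R * L2_set (\<lambda>r. norm (\<Sum>s\<in>S. M r s *\<^sub>R d s)) R"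
    by (rule L2_set_mult_ineq)
  also have "\<dots> \<le> L2_set (\<lambda>r. norm (c r)) R * (C * D)"
    unfolding D_def by (intro mult_left_mono bound) simp
  finally have "D * D \<le> (C * L2_set (\<lambda>r. norm (c r)) R) * D"
    by (simp add: power2_eq_square mult_ac)
  then have "D \<le> C * L2_set (\<lambda>r. norm (c r)) R"
    using D0 assms(2) by (cases "D = 0") auto
  then show ?thesis by (simp add: D_def d_def)
qed

text \<open>For the inner row \<open>\<rho> = 0\<close> this is the orthogonal 2 by 2 matrix forming
  normalised sum and difference, otherwise the identity. \<open>\<alpha>\<close> is the half
  containing the row and \<open>\<gamma>\<close> the half containing the column.\<close>

definition haar_rotation :: "nat \<Rightarrow> nat \<Rightarrow> nat \<Rightarrow> real" where
  "haar_rotation \<rho> \<alpha> \<gamma> =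
    (if \<rho> = 0 then (if \<alpha> = 1 \<and> \<gamma> = 1 then -1 else 1) / sqrt 2 else of_bool (\<alpha> = \<gamma>))"

text \<open>
  \<open>haar k\<close> is the orthogonal matrix of size \<open>2 ^ k\<close> of the discrete Haar system. Row \<open>0\<close> is
  constant; doubling the size replaces the two constant rows of the halves by their normalised
  sum (row \<open>0\<close>) and difference (row \<open>2 ^ k\<close>). \<open>haar_level k r\<close> is the binary logarithm of the
  size of the support of row \<open>r\<close>.
\<close>

fun haar :: "nat \<Rightarrow> nat \<Rightarrow> nat \<Rightarrow> real" where
  "haar 0 r n = 1"
| "haar (Suc k) r n =
    haar_rotation (r mod 2 ^ k) (r div 2 ^ k) (n div 2 ^ k) * haar k (r mod 2 ^ k) (n mod 2 ^ k)"

fun haar_level :: "nat \<Rightarrow> nat \<Rightarrow> nat" where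
  "haar_level 0 r = 0"
| "haar_level (Suc k) r = (if r mod 2 ^ k = 0 then Suc k else haar_level k (r mod 2 ^ k))"

lemma haar_level_0 [simp]: "haar_level k 0 = k"
  by (cases k) auto

lemma haar_0: "haar k 0 n = (1 / sqrt 2) ^ k"
  by (induction k arbitrary: n) (auto simp: haar_rotation_def)

lemma less_double_cases:
  fixes r N :: nat
  assumes "r < 2 * N"
  obtains \<alpha> \<rho> where "r div N = \<alpha>" "r mod N = \<rho>" "r = \<alpha> * N + \<rho>" "\<alpha> = 0 \<or> \<alpha> = 1" "\<rho> < N"
proof -
  have "0 < N" using assms by (cases N) auto
  then have "r div N < 2" "r mod N < N" using assms by (auto simp: less_mult_imp_div_less)
  moreover from this have "r div N = 0 \<or> r div N = 1" by linarith
  ultimately show ?thesis using that[of "r div N" "r mod N"] by simp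
qed

text \<open>On each half of the columns the product of two rows is a product of rotation entries
  times a product of rows of the smaller matrix, so only the orthonormality of the 2 by 2 matrices
  remains to be checked.\<close>

lemma haar_rows_orthonormal:
  assumes "r < 2 ^ k" "s < 2 ^ k"
  shows "(\<Sum>n<2 ^ k. haar k r n * haar k s n) = of_bool (r = s)"
  using assms
proof (induction k arbitrary: r s)
  case 0
  then show ?case by simp
next
  case (Suc k)
  define N :: nat where "N = 2 ^ k"
  obtain \<alpha> \<rho> where r: "r div N = \<alpha>" "r mod N = \<rho>" "r = \<alpha> * N + \<rho>" "\<alpha> = 0 \<or> \<alpha> = 1" "\<rho> < N"
    using less_double_cases[of r N] Suc.prems by (auto simp: N_def)
  obtain \<beta> \<sigma> where s: "s div N = \<beta>" "s mod N = \<sigma>" "s = \<beta> * N + \<sigma>" "\<beta> = 0 \<or> \<beta> = 1" "\<sigma> < N"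
    using less_double_cases[of s N] Suc.prems by (auto simp: N_def)
  have IH: "(\<Sum>n<N. haar k \<rho> n * haar k \<sigma> n) = of_bool (\<rho> = \<sigma>)"
    using Suc.IH[of \<rho> \<sigma>] r s by (simp add: N_def)
  have "(\<Sum>n<2 ^ Suc k. haar (Suc k) r n * haar (Suc k) s n) =
      (\<Sum>n<N. haar_rotation \<rho> \<alpha> 0 * haar_rotation \<sigma> \<beta> 0 * (haar k \<rho> n * haar k \<sigma> n)) +
      (\<Sum>n<N. haar_rotation \<rho> \<alpha> 1 * haar_rotation \<sigma> \<beta> 1 * (haar k \<rho> n * haar k \<sigma> n))"
    unfolding power_Suc sum_lessThan_double
    by (intro arg_cong2[where f = "(+)"] sum.cong)
       (auto simp: r(1,2) s(1,2) N_def[symmetric])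
  also have "\<dots> = (haar_rotation \<rho> \<alpha> 0 * haar_rotation \<sigma> \<beta> 0 + haar_rotation \<rho> \<alpha> 1 * haar_rotation \<sigma> \<beta> 1)
      * of_bool (\<rho> = \<sigma>)"
    unfolding sum_distrib_left[symmetric] IH by (simp add: distrib_right)
  also have "\<dots> = of_bool (r = s)"
    using r(3-5) s(3-5) by (auto simp: haar_rotation_def)
  finally show ?case .
qed

lemma haar_columns_orthonormal:
  assumes "n < 2 ^ k" "m < 2 ^ k"
  shows "(\<Sum>r<2 ^ k. haar k r n * haar k r m) = of_bool (n = m)"
  using assms
proof (induction k arbitrary: n m)
  case 0
  then show ?case by simp
next
  case (Suc k)
  define N :: nat where "N = 2 ^ k"
  obtain \<alpha> \<rho> where n: "n div N = \<alpha>" "n mod N = \<rho>" "n = \<alpha> * N + \<rho>" "\<alpha> = 0 \<or> \<alpha> = 1" "\<rho> < N"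
    using less_double_cases[of n N] Suc.prems by (auto simp: N_def)
  obtain \<beta> \<sigma> where m: "m div N = \<beta>" "m mod N = \<sigma>" "m = \<beta> * N + \<sigma>" "\<beta> = 0 \<or> \<beta> = 1" "\<sigma> < N"
    using less_double_cases[of m N] Suc.prems by (auto simp: N_def)
  have IH: "(\<Sum>r<N. haar k r \<rho> * haar k r \<sigma>) = of_bool (\<rho> = \<sigma>)"
    using Suc.IH[of \<rho> \<sigma>] n m by (simp add: N_def)
  have rot: "haar_rotation r 0 \<alpha> * haar_rotation r 0 \<beta> + haar_rotation r 1 \<alpha> * haar_rotation r 1 \<beta> = of_bool (\<alpha> = \<beta>)"
    for r
    using n(4) m(4) by (auto simp: haar_rotation_def)
  have "(\<Sum>r<2 ^ Suc k. haar (Suc k) r n * haar (Suc k) r m) =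
      (\<Sum>r<N. haar_rotation r 0 \<alpha> * haar_rotation r 0 \<beta> * (haar k r \<rho> * haar k r \<sigma>)) +
      (\<Sum>r<N. haar_rotation r 1 \<alpha> * haar_rotation r 1 \<beta> * (haar k r \<rho> * haar k r \<sigma>))"
    unfolding power_Suc sum_lessThan_double
    by (intro arg_cong2[where f = "(+)"] sum.cong)
       (auto simp: n(1,2) m(1,2) N_def[symmetric])
  also have "\<dots> = (\<Sum>r<N. (haar_rotation r 0 \<alpha> * haar_rotation r 0 \<beta> + haar_rotation r 1 \<alpha> * haar_rotation r 1 \<beta>) * (haar k r \<rho> * haar k r \<sigma>))"
    unfolding sum.distrib[symmetric] distrib_right ..
  also have "\<dots> = of_bool (\<alpha> = \<beta>) * of_bool (\<rho> = \<sigma>)"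
    unfolding rot sum_distrib_left[symmetric] IH ..
  also have "\<dots> = of_bool (n = m)"
    using n(3-5) m(3-5) by auto
  finally show ?case .
qed

text \<open>Row 0 is constant, so a row sum is a multiple of the inner product with row 0.\<close>

lemma sum_haar_row:
  assumes "r < 2 ^ k"
  shows "(\<Sum>n<2 ^ k. haar k r n) = of_bool (r = 0) * sqrt 2 ^ k"
proof -
  have "(\<Sum>n<2 ^ k. haar k r n) * (1 / sqrt 2) ^ k = of_bool (r = 0)"
    using haar_rows_orthonormal[OF assms, of 0] by (simp add: haar_0 sum_distrib_right)
  then show ?thesis by (simp add: field_simps)
qed

definition truncate :: "nat \<Rightarrow> (nat \<Rightarrow> 'a::zero) \<Rightarrow> nat \<Rightarrow> 'a" where
  "truncate m c n = (if n < m then c n else 0)"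

text \<open>
  Truncation of a sequence is easily seen to be bounded for \<open>interval_energy\<close>, a sum over dyadic
  intervals, since only one interval of each length meets the cut; this carries over to the
  equivalent \<open>haar_energy\<close>.
\<close>

locale haar_weights =
  fixes \<theta> :: real
  assumes \<theta>: "1 / 2 < \<theta>" "\<theta> < 1"
begin

text \<open>Doubling the size recombines the rows 0 of the two halves and keeps all others; leaving
  row 0 out gives a quantity that is additive over the halves up to one new row.\<close>

definition haar_detail :: "nat \<Rightarrow> (nat \<Rightarrow> 'a::real_inner) \<Rightarrow> real" where
  "haar_detail k c = (\<Sum>r=1..<2 ^ k. (2 * \<theta>) ^ haar_level k r *
     (norm (\<Sum>n<2 ^ k. haar k r n *\<^sub>R c n))\<^sup>2)"

definition haar_energy :: "nat \<Rightarrow> (nat \<Rightarrow> 'a::real_inner) \<Rightarrow> real" where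
  "haar_energy k c = (\<Sum>r<2 ^ k. (2 * \<theta>) ^ haar_level k r *
     (norm (\<Sum>n<2 ^ k. haar k r n *\<^sub>R c n))\<^sup>2)"

fun interval_energy :: "nat \<Rightarrow> (nat \<Rightarrow> 'a::real_inner) \<Rightarrow> real" where
  "interval_energy 0 c = (norm (c 0))\<^sup>2"
| "interval_energy (Suc k) c = interval_energy k c + interval_energy k (\<lambda>n. c (2 ^ k + n)) +
     \<theta> ^ Suc k * (norm (\<Sum>n<2 ^ Suc k. c n))\<^sup>2"

lemma haar_detail_0: "haar_detail 0 c = 0"
  by (simp add: haar_detail_def)

text \<open>The new row \<open>2 ^ k\<close> is the normalised difference of the two half sums. The
  square of its normalisation is \<open>(1 / 2) ^ Suc k\<close>, which turns the weight
  \<open>(2 * \<theta>) ^ Suc k\<close> into \<open>\<theta> ^ Suc k\<close>.\<close>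

lemma haar_detail_Suc:
  "haar_detail (Suc k) c = haar_detail k c + haar_detail k (\<lambda>n. c (2 ^ k + n)) +
     \<theta> ^ Suc k * (norm ((\<Sum>n<2 ^ k. c n) - (\<Sum>n<2 ^ k. c (2 ^ k + n))))\<^sup>2"
proof -
  define N :: nat where "N = 2 ^ k"
  have N: "0 < N" by (simp add: N_def)
  define h where "h r = (\<Sum>n<2 * N. haar (Suc k) r n *\<^sub>R c n)" for r
  have h: "h r = (\<Sum>n<N. (haar_rotation (r mod N) (r div N) 0 * haar k (r mod N) n) *\<^sub>R c n) +
      (\<Sum>n<N. (haar_rotation (r mod N) (r div N) 1 * haar k (r mod N) n) *\<^sub>R c (N + n))" for r
    unfolding h_def sum_lessThan_double
    by (intro arg_cong2[where f = "(+)"] sum.cong) (auto simp: N_def)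
  have h1: "h r = (\<Sum>n<N. haar k r n *\<^sub>R c n)" and h2: "h (N + r) = (\<Sum>n<N. haar k r n *\<^sub>R c (N + n))"
    if "r \<in> {1..<N}" for r
    using that N by (simp_all add: h haar_rotation_def)
  have hN: "h N = ((1 / sqrt 2) * (1 / sqrt 2) ^ k) *\<^sub>R ((\<Sum>n<N. c n) - (\<Sum>n<N. c (N + n)))"
    using N by (simp add: h haar_rotation_def haar_0 scaleR_diff_right sum_negf flip: scaleR_sum_right)
  have sq: "((1 / sqrt 2) * (1 / sqrt 2) ^ k)\<^sup>2 = (1 / 2) ^ Suc k"
    by (simp add: power_divide power_mult_distrib sqrt_2_power_squared)
  have "haar_detail (Suc k) c = (\<Sum>r=1..<2 * N. (2 * \<theta>) ^ haar_level (Suc k) r * (norm (h r))\<^sup>2)"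
    by (simp add: haar_detail_def h_def N_def)
  also have "\<dots> = haar_detail k c + (2 * \<theta>) ^ Suc k * (norm (h N))\<^sup>2 + haar_detail k (\<lambda>n. c (N + n))"
    unfolding sum_from_1_double[OF N] haar_detail_def N_def[symmetric]
    using N by (intro arg_cong2[where f = "(+)"] sum.cong) (auto simp: h1 h2 N_def[symmetric])
  also have "(2 * \<theta>) ^ Suc k * (norm (h N))\<^sup>2
      = (2 * \<theta>) ^ Suc k * (1 / 2) ^ Suc k * (norm ((\<Sum>n<N. c n) - (\<Sum>n<N. c (N + n))))\<^sup>2"
  proof -
    have "(norm (x *\<^sub>R v))\<^sup>2 = x\<^sup>2 * (norm v)\<^sup>2" for x and v :: 'a
      by (simp add: power_mult_distrib)
    then show ?thesis by (simp only: hN sq mult.assoc)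
  qed
  also have "(2 * \<theta>) ^ Suc k * (1 / 2) ^ Suc k = \<theta> ^ Suc k"
    unfolding power_mult_distrib[symmetric] by simp
  finally show ?thesis by (simp add: N_def)
qed

lemma haar_energy_eq:
  "haar_energy k c = haar_detail k c + \<theta> ^ k * (norm (\<Sum>n<2 ^ k. c n))\<^sup>2"
proof -
  define h where "h r = (2 * \<theta>) ^ haar_level k r * (norm (\<Sum>n<2 ^ k. haar k r n *\<^sub>R c n))\<^sup>2" for r
  have "(\<Sum>r<2 ^ k. h r) = h 0 + (\<Sum>r=1..<2 ^ k. h r)"
    using sum.atLeast_Suc_lessThan[of 0 "2 ^ k" h] by (simp add: lessThan_atLeast0)
  then have "haar_energy k c = (2 * \<theta>) ^ k * (norm (\<Sum>n<2 ^ k. haar k 0 n *\<^sub>R c n))\<^sup>2 + haar_detail k c"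
    by (simp add: haar_energy_def haar_detail_def h_def)
  also have "(norm (\<Sum>n<2 ^ k. haar k 0 n *\<^sub>R c n))\<^sup>2 = (1 / 2) ^ k * (norm (\<Sum>n<2 ^ k. c n))\<^sup>2"
    by (simp add: haar_0 power_mult_distrib power_divide sqrt_2_power_squared flip: scaleR_sum_right)
  also have "(2 * \<theta>) ^ k * ((1 / 2) ^ k * (norm (\<Sum>n<2 ^ k. c n))\<^sup>2) = \<theta> ^ k * (norm (\<Sum>n<2 ^ k. c n))\<^sup>2"
    unfolding mult.assoc[symmetric] power_mult_distrib[symmetric] by simp
  finally show ?thesis by simp
qed

lemma interval_energy_nonneg: "0 \<le> interval_energy k c"
  using \<theta> by (induction k arbitrary: c) auto

lemma interval_energy_zero [simp]: "interval_energy k (\<lambda>_. 0) = 0"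
  by (induction k) auto

lemma interval_energy_sum_le: "\<theta> ^ k * (norm (\<Sum>n<2 ^ k. c n))\<^sup>2 \<le> interval_energy k c"
  by (cases k) (auto simp: interval_energy_nonneg)

lemma interval_energy_cong:
  "(\<And>n. n < 2 ^ k \<Longrightarrow> c n = d n) \<Longrightarrow> interval_energy k c = interval_energy k d"
proof (induction k arbitrary: c d)
  case (Suc k)
  have "interval_energy k c = interval_energy k d"
    "interval_energy k (\<lambda>n. c (2 ^ k + n)) = interval_energy k (\<lambda>n. d (2 ^ k + n))"
    by (rule Suc.IH, use Suc.prems in auto)+
  moreover have "(\<Sum>n<2 ^ Suc k. c n) = (\<Sum>n<2 ^ Suc k. d n)"
    using Suc.prems by (intro sum.cong) auto
  ultimately show ?case by (simp only: interval_energy.simps)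
qed simp

text \<open>The parallelogram law rewrites the two half sums through \<open>x + y\<close> and
  \<open>x - y\<close>, at the cost of the factor \<open>1 / (2 * \<theta>)\<close>. The constant
  solves \<open>C / (2 * \<theta>) + 1 = C\<close>, so that the new interval is absorbed; this is
  possible because \<open>2 * \<theta> > 1\<close>.\<close>

lemma interval_energy_le:
  "interval_energy k c \<le> 2 * \<theta> / (2 * \<theta> - 1) * haar_energy k c"
proof -
  define C where "C = 2 * \<theta> / (2 * \<theta> - 1)"
  have C: "C / (2 * \<theta>) + 1 = C" "0 \<le> C" "C / (2 * \<theta>) \<le> C" "1 \<le> C"
    using \<theta> by (auto simp: C_def field_simps)
  have "interval_energy k c \<le> C * (haar_detail k c + \<theta> ^ k * (norm (\<Sum>n<2 ^ k. c n))\<^sup>2)"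
  proof (induction k arbitrary: c)
    case 0
    then show ?case
      using mult_right_mono[OF C(4), of "(norm (c 0))\<^sup>2"] by (simp add: haar_detail_0)
  next
    case (Suc k)
    define x y where "x = (\<Sum>n<2 ^ k. c n)" and "y = (\<Sum>n<2 ^ k. c (2 ^ k + n))"
    have sum: "(\<Sum>n<2 ^ Suc k. c n) = x + y"
      unfolding power_Suc sum_lessThan_double x_def y_def ..
    have par: "(norm x)\<^sup>2 + (norm y)\<^sup>2 = ((norm (x + y))\<^sup>2 + (norm (x - y))\<^sup>2) / 2"
      by (simp add: power2_norm_eq_inner inner_simps)
    define T where "T = \<theta> ^ Suc k"
    have T: "0 \<le> T" "\<theta> ^ k = T / \<theta>" using \<theta> by (auto simp: T_def)
    have "interval_energy (Suc k) c \<le> C * (haar_detail k c + \<theta> ^ k * (norm x)\<^sup>2)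
        + C * (haar_detail k (\<lambda>n. c (2 ^ k + n)) + \<theta> ^ k * (norm y)\<^sup>2) + T * (norm (x + y))\<^sup>2"
      unfolding interval_energy.simps sum T_def
      using Suc.IH[of c] Suc.IH[of "\<lambda>n. c (2 ^ k + n)"] by (simp add: x_def y_def)
    also have "\<dots> = C * (haar_detail k c + haar_detail k (\<lambda>n. c (2 ^ k + n)))
        + C * (T / \<theta>) * ((norm x)\<^sup>2 + (norm y)\<^sup>2) + T * (norm (x + y))\<^sup>2"
      unfolding T(2) by (simp add: algebra_simps)
    also have "\<dots> = C * (haar_detail k c + haar_detail k (\<lambda>n. c (2 ^ k + n)))
        + (C / (2 * \<theta>)) * (T * (norm (x - y))\<^sup>2) + (C / (2 * \<theta>) + 1) * (T * (norm (x + y))\<^sup>2)"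
      unfolding par by (simp add: algebra_simps add_divide_distrib)
    also have "\<dots> \<le> C * (haar_detail k c + haar_detail k (\<lambda>n. c (2 ^ k + n)))
        + C * (T * (norm (x - y))\<^sup>2) + C * (T * (norm (x + y))\<^sup>2)"
    proof -
      have "C / (2 * \<theta>) * (T * (norm (x - y))\<^sup>2) \<le> C * (T * (norm (x - y))\<^sup>2)"
        using C(3) T(1) by (intro mult_right_mono) auto
      then show ?thesis unfolding C(1) by linarith
    qed
    also have "\<dots> = C * (haar_detail (Suc k) c + \<theta> ^ Suc k * (norm (\<Sum>n<2 ^ Suc k. c n))\<^sup>2)"
      unfolding haar_detail_Suc sum T_def x_def y_def by (simp add: algebra_simps)
    finally show ?case .
  qed
  then show ?thesis by (simp add: haar_energy_eq C_def)
qed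

text \<open>The induction is strengthened by subtracting the term of the top interval. The terms
  with weight \<open>\<theta> ^ k\<close> held back for the two halves then pay for the new
  difference \<open>x - y\<close>.\<close>

lemma haar_energy_le: "haar_energy k c \<le> 2 * interval_energy k c"
proof -
  have "haar_detail k c \<le> 2 * (interval_energy k c - \<theta> ^ k * (norm (\<Sum>n<2 ^ k. c n))\<^sup>2)"
  proof (induction k arbitrary: c)
    case 0
    then show ?case by (simp add: haar_detail_0)
  next
    case (Suc k)
    define x y where "x = (\<Sum>n<2 ^ k. c n)" and "y = (\<Sum>n<2 ^ k. c (2 ^ k + n))"
    have "(norm (x - y))\<^sup>2 \<le> 2 * ((norm x)\<^sup>2 + (norm y)\<^sup>2)"
      using zero_le_power2[of "norm (x + y)"] by (simp add: power2_norm_eq_inner inner_simps)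
    then have "\<theta> ^ Suc k * (norm (x - y))\<^sup>2 \<le> \<theta> ^ Suc k * (2 * ((norm x)\<^sup>2 + (norm y)\<^sup>2))"
      using \<theta> by (intro mult_left_mono) auto
    also have "\<dots> \<le> \<theta> ^ k * (2 * ((norm x)\<^sup>2 + (norm y)\<^sup>2))"
      using \<theta> by (intro mult_right_mono) auto
    finally show ?case
      using Suc.IH[of c] Suc.IH[of "\<lambda>n. c (2 ^ k + n)"]
      by (simp add: haar_detail_Suc x_def y_def algebra_simps)
  qed
  moreover have "\<theta> ^ k * (norm (\<Sum>n<2 ^ k. c n))\<^sup>2 \<ge> 0"
    using \<theta> by simp
  ultimately show ?thesis by (simp add: haar_energy_eq)
qed

text \<open>The induction carries the sum over the cut interval as an extra term with factor
  \<open>A\<close>. The square of \<open>norm (x + y)\<close> is split with a parameter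
  \<open>\<eta>\<close> such that \<open>\<theta> * (1 + \<eta>) = \<rho> < 1\<close>, and
  \<open>A\<close> solves \<open>(1 + A) * \<rho> = A\<close>, so the extra term reproduces itself.
  The intact half \<open>x\<close> is charged to its own interval term.\<close>

lemma interval_energy_truncate:
  "\<exists>B\<ge>0. \<forall>k m (c :: nat \<Rightarrow> 'a::real_inner). interval_energy k (truncate m c) \<le> B * interval_energy k c"
proof -
  define \<rho> where "\<rho> = (1 + \<theta>) / 2"
  define A where "A = \<rho> / (1 - \<rho>)"
  define \<eta> where "\<eta> = (1 - \<theta>) / (2 * \<theta>)"
  define B where "B = 1 + A + (1 + A) * (1 + 1 / \<eta>)"
  have \<rho>: "0 < \<rho>" "\<rho> < 1" "\<theta> < \<rho>" using \<theta> by (auto simp: \<rho>_def)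
  have A: "0 \<le> A" "(1 + A) * \<rho> = A" using \<rho> by (auto simp: A_def field_simps)
  have \<eta>: "0 < \<eta>" "\<theta> * (1 + \<eta>) = \<rho>" using \<theta> by (auto simp: \<eta>_def \<rho>_def field_simps)
  have pos: "0 \<le> (1 + A) * (1 + 1 / \<eta>)" using A \<eta> by auto
  then have B: "0 \<le> B" "1 + A \<le> B" "1 + (1 + A) * (1 + 1 / \<eta>) \<le> B" "1 \<le> B"
    using A by (auto simp: B_def)
  have "interval_energy k (truncate m c) + A * \<theta> ^ k * (norm (\<Sum>n<2 ^ k. truncate m c n))\<^sup>2
      \<le> B * interval_energy k c" for k m and c :: "nat \<Rightarrow> 'a"
  proof (induction k arbitrary: m c)
    case 0
    show ?case
      using mult_right_mono[OF B(2), of "(norm (c 0))\<^sup>2"] B(1)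
      by (auto simp: truncate_def distrib_right)
  next
    case (Suc k)
    define x y where "x = (\<Sum>n<2 ^ k. truncate m c n)" and "y = (\<Sum>n<2 ^ k. truncate m c (2 ^ k + n))"
    define c' where "c' n = c (2 ^ k + n)" for n
    have sum: "(\<Sum>n<2 ^ Suc k. truncate m c n) = x + y"
      unfolding power_Suc sum_lessThan_double x_def y_def ..
    define P Q where "P = interval_energy k (truncate m c)"
      and "Q = interval_energy k (\<lambda>n. truncate m c (2 ^ k + n))"
    have eq: "interval_energy (Suc k) (truncate m c) + A * \<theta> ^ Suc k * (norm (\<Sum>n<2 ^ Suc k. truncate m c n))\<^sup>2
        = P + Q + (1 + A) * \<theta> * (\<theta> ^ k * (norm (x + y))\<^sup>2)"
      unfolding interval_energy.simps sum P_def Q_def by (simp add: algebra_simps)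
    have le: "B * interval_energy k c + B * interval_energy k c' \<le> B * interval_energy (Suc k) c"
      using B(1) \<theta> by (simp add: distrib_left c'_def[abs_def])
    show ?case
    proof (cases "m \<le> 2 ^ k")
      case True
      then have "y = 0" by (simp add: y_def truncate_def)
      have "Q = interval_energy k (\<lambda>_. 0 :: 'a)"
        unfolding Q_def using True by (intro interval_energy_cong) (auto simp: truncate_def)
      then have "Q = 0" by simp
      have "(1 + A) * \<theta> \<le> A"
        using mult_left_mono[of \<theta> \<rho> "1 + A"] A \<rho>(3) by simp
      then have "(1 + A) * \<theta> * (\<theta> ^ k * (norm x)\<^sup>2) \<le> A * (\<theta> ^ k * (norm x)\<^sup>2)"
        using \<theta> by (intro mult_right_mono) auto
      then have "P + Q + (1 + A) * \<theta> * (\<theta> ^ k * (norm (x + y))\<^sup>2) \<le> B * interval_energy k c"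
        using Suc.IH[of m c] \<open>Q = 0\<close> \<open>y = 0\<close> by (simp add: P_def x_def mult.assoc)
      then show ?thesis
        unfolding eq using le mult_nonneg_nonneg[OF B(1) interval_energy_nonneg[of k c']] by linarith
    next
      case False
      \<comment> \<open>The cut lies beyond the left half, which is therefore intact; the truncation
        continues in the right half with cut \<open>m - 2 ^ k\<close>.\<close>
      have P: "P = interval_energy k c"
        unfolding P_def using False by (intro interval_energy_cong) (auto simp: truncate_def)
      have x: "x = (\<Sum>n<2 ^ k. c n)"
        unfolding x_def using False by (intro sum.cong) (auto simp: truncate_def)
      have tr: "(\<lambda>n. truncate m c (2 ^ k + n)) = truncate (m - 2 ^ k) c'"
        using False by (auto simp: truncate_def c'_def fun_eq_iff)
      have QB: "Q + A * \<theta> ^ k * (norm y)\<^sup>2 \<le> B * interval_energy k c'"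
        using Suc.IH[of "m - 2 ^ k" c'] unfolding Q_def y_def tr by (simp flip: tr)
      have xk: "\<theta> ^ k * (norm x)\<^sup>2 \<le> interval_energy k c"
        unfolding x by (rule interval_energy_sum_le)
      have "(norm (x + y))\<^sup>2 \<le> (norm x + norm y)\<^sup>2"
        by (intro power_mono norm_triangle_ineq) auto
      also have "\<dots> \<le> (1 + \<eta>) * (norm y)\<^sup>2 + (1 + 1 / \<eta>) * (norm x)\<^sup>2"
      proof -
        have "0 \<le> (norm x - \<eta> * norm y)\<^sup>2 / \<eta>" using \<eta> by auto
        also have "\<dots> = (norm x)\<^sup>2 / \<eta> - 2 * norm x * norm y + \<eta> * (norm y)\<^sup>2"
          using \<eta> by (simp add: power2_eq_square field_simps)
        finally show ?thesis by (simp add: power2_eq_square algebra_simps)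
      qed
      finally have "(1 + A) * \<theta> * (\<theta> ^ k * (norm (x + y))\<^sup>2)
          \<le> (1 + A) * \<theta> * (\<theta> ^ k * ((1 + \<eta>) * (norm y)\<^sup>2 + (1 + 1 / \<eta>) * (norm x)\<^sup>2))"
        using A \<theta> by (intro mult_left_mono) auto
      also have "\<dots> = (1 + A) * (\<theta> * (1 + \<eta>)) * (\<theta> ^ k * (norm y)\<^sup>2)
          + \<theta> * ((1 + A) * (1 + 1 / \<eta>) * (\<theta> ^ k * (norm x)\<^sup>2))"
        by (simp add: algebra_simps)
      also have "\<dots> = A * (\<theta> ^ k * (norm y)\<^sup>2) + \<theta> * ((1 + A) * (1 + 1 / \<eta>) * (\<theta> ^ k * (norm x)\<^sup>2))"
        by (simp only: \<eta>(2) A(2))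
      also have "\<dots> \<le> A * (\<theta> ^ k * (norm y)\<^sup>2) + 1 * ((1 + A) * (1 + 1 / \<eta>) * interval_energy k c)"
        using pos \<theta> xk by (intro add_mono order_refl mult_mono) (auto intro!: mult_nonneg_nonneg interval_energy_nonneg)
      finally have "P + Q + (1 + A) * \<theta> * (\<theta> ^ k * (norm (x + y))\<^sup>2) \<le>
          (1 + (1 + A) * (1 + 1 / \<eta>)) * interval_energy k c + B * interval_energy k c'"
        using QB P by (simp add: distrib_right mult.assoc)
      also have "\<dots> \<le> B * interval_energy k c + B * interval_energy k c'"
        using B(3) by (intro add_mono mult_right_mono order_refl interval_energy_nonneg)
      finally show ?thesis unfolding eq using le by linarith
    qed
  qed
  moreover have "0 \<le> A * \<theta> ^ k * (norm (\<Sum>n<2 ^ k. truncate m c n))\<^sup>2" for k m and c :: "nat \<Rightarrow> 'a"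
    using A \<theta> by auto
  ultimately show ?thesis using B(1) by (smt (verit))
qed

section \<open>The weighted Haar matrix and its dual\<close>

definition haar_weight :: "nat \<Rightarrow> nat \<Rightarrow> real" where
  "haar_weight k r = sqrt (2 * \<theta>) ^ haar_level k r"

text \<open>Multiplying the rows of an orthogonal matrix by weights, and dividing them by the same
  weights in \<open>light_haar\<close>, yields a matrix and its inverse transpose.\<close>

definition heavy_haar :: "nat \<Rightarrow> nat \<Rightarrow> nat \<Rightarrow> real" where
  "heavy_haar k r n = haar_weight k r * haar k r n"

definition light_haar :: "nat \<Rightarrow> nat \<Rightarrow> nat \<Rightarrow> real" where
  "light_haar k r n = haar k r n / haar_weight k r"

lemma haar_weight_ge_1: "1 \<le> haar_weight k r"
  using \<theta> by (simp add: haar_weight_def one_le_power)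

lemma heavy_light_columns:
  assumes "n < 2 ^ k" "m < 2 ^ k"
  shows "(\<Sum>r<2 ^ k. light_haar k r n * heavy_haar k r m) = of_bool (n = m)"
    and "(\<Sum>r<2 ^ k. heavy_haar k r n * light_haar k r m) = of_bool (n = m)"
proof -
  have "haar_weight k r \<noteq> 0" for r using haar_weight_ge_1[of k r] by auto
  then show "(\<Sum>r<2 ^ k. light_haar k r n * heavy_haar k r m) = of_bool (n = m)"
    "(\<Sum>r<2 ^ k. heavy_haar k r n * light_haar k r m) = of_bool (n = m)"
    using haar_columns_orthonormal[OF assms] by (simp_all add: light_haar_def heavy_haar_def)
qed

lemma heavy_light_rows:
  assumes "r < 2 ^ k" "s < 2 ^ k"
  shows "(\<Sum>n<2 ^ k. heavy_haar k r n * light_haar k s n) = of_bool (r = s)"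
    and "(\<Sum>n<2 ^ k. light_haar k r n * heavy_haar k s n) = of_bool (r = s)"
proof -
  have w: "haar_weight k r \<noteq> 0" for r using haar_weight_ge_1[of k r] by auto
  have "(\<Sum>n<2 ^ k. heavy_haar k r n * light_haar k s n)
      = haar_weight k r / haar_weight k s * (\<Sum>n<2 ^ k. haar k r n * haar k s n)"
    by (simp add: heavy_haar_def light_haar_def sum_distrib_left mult_ac)
  then show "(\<Sum>n<2 ^ k. heavy_haar k r n * light_haar k s n) = of_bool (r = s)"
    using w by (auto simp: haar_rows_orthonormal[OF assms])
  have "(\<Sum>n<2 ^ k. light_haar k r n * heavy_haar k s n)
      = haar_weight k s / haar_weight k r * (\<Sum>n<2 ^ k. haar k r n * haar k s n)"
    by (simp add: heavy_haar_def light_haar_def sum_distrib_left mult_ac)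
  then show "(\<Sum>n<2 ^ k. light_haar k r n * heavy_haar k s n) = of_bool (r = s)"
    using w by (auto simp: haar_rows_orthonormal[OF assms])
qed

lemma haar_energy_heavy:
  "haar_energy k c = (L2_set (\<lambda>r. norm (\<Sum>n<2 ^ k. heavy_haar k r n *\<^sub>R c n)) {..<2 ^ k})\<^sup>2"
proof -
  have "(2 * \<theta>) ^ haar_level k r * (norm (\<Sum>n<2 ^ k. haar k r n *\<^sub>R c n))\<^sup>2
      = (norm (\<Sum>n<2 ^ k. heavy_haar k r n *\<^sub>R c n))\<^sup>2" for r
  proof -
    have "(haar_weight k r)\<^sup>2 = (2 * \<theta>) ^ haar_level k r"
      using \<theta> by (simp add: haar_weight_def real_sqrt_power[symmetric])
    moreover have "(\<Sum>n<2 ^ k. heavy_haar k r n *\<^sub>R c n) = haar_weight k r *\<^sub>R (\<Sum>n<2 ^ k. haar k r n *\<^sub>R c n)"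
      by (simp add: heavy_haar_def scaleR_sum_right)
    ultimately show ?thesis by (simp add: power_mult_distrib)
  qed
  then show ?thesis by (simp add: haar_energy_def L2_set_def sum_nonneg)
qed

text \<open>The sequence \<open>d\<close> has the weighted Haar coefficients \<open>c\<close>, so
  the claim compares \<open>haar_energy\<close> of the truncated \<open>d\<close> with that of
  \<open>d\<close>. Both are passed to \<open>interval_energy\<close>, and \<open>C\<close> collects
  the constants of this passage and of the truncation.\<close>

lemma heavy_truncation_bounded:
  "\<exists>C\<ge>0. \<forall>k m (c :: nat \<Rightarrow> 'a::real_inner). m \<le> 2 ^ k \<longrightarrow>
     L2_set (\<lambda>r. norm (\<Sum>n<m. heavy_haar k r n *\<^sub>R (\<Sum>s<2 ^ k. light_haar k s n *\<^sub>R c s))) {..<2 ^ k}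
     \<le> C * L2_set (\<lambda>s. norm (c s)) {..<2 ^ k}"
proof -
  obtain B where B: "0 \<le> B" and trunc: "\<And>k m (c :: nat \<Rightarrow> 'a).
      interval_energy k (truncate m c) \<le> B * interval_energy k c"
    using interval_energy_truncate by blast
  define C where "C = 2 * (B * (2 * \<theta> / (2 * \<theta> - 1)))"
  have C: "0 \<le> C" using B \<theta> by (auto simp: C_def intro!: mult_nonneg_nonneg divide_nonneg_nonneg)
  show ?thesis
  proof (intro exI[of _ "sqrt C"] conjI allI impI)
    show "0 \<le> sqrt C" using C by simp
    fix k m :: nat and c :: "nat \<Rightarrow> 'a" assume m: "m \<le> 2 ^ k"
    define d where "d n = (\<Sum>s<2 ^ k. light_haar k s n *\<^sub>R c s)" for n
    have tr: "(\<Sum>n<m. heavy_haar k r n *\<^sub>R d n) = (\<Sum>n<2 ^ k. heavy_haar k r n *\<^sub>R truncate m d n)" for r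
      using m by (intro sum.mono_neutral_cong_left) (auto simp: truncate_def)
    have inv: "(\<Sum>n<2 ^ k. heavy_haar k r n *\<^sub>R d n) = c r" if "r < 2 ^ k" for r
    proof -
      have "(\<Sum>n<2 ^ k. heavy_haar k r n *\<^sub>R d n)
          = (\<Sum>s<2 ^ k. (\<Sum>n<2 ^ k. heavy_haar k r n * light_haar k s n) *\<^sub>R c s)"
        unfolding d_def scaleR_sum_right scaleR_sum_left scaleR_scaleR by (rule sum.swap)
      also have "\<dots> = (\<Sum>s<2 ^ k. if r = s then c s else 0)"
        using that by (intro sum.cong) (auto simp: heavy_light_rows)
      finally show ?thesis using that by simp
    qed
    have "(L2_set (\<lambda>r. norm (\<Sum>n<m. heavy_haar k r n *\<^sub>R d n)) {..<2 ^ k})\<^sup>2 = haar_energy k (truncate m d)"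
      unfolding tr haar_energy_heavy ..
    also have "\<dots> \<le> 2 * interval_energy k (truncate m d)" by (rule haar_energy_le)
    also have "\<dots> \<le> 2 * (B * interval_energy k d)" by (intro mult_left_mono trunc) simp
    also have "\<dots> \<le> 2 * (B * (2 * \<theta> / (2 * \<theta> - 1) * haar_energy k d))"
      using B by (intro mult_left_mono interval_energy_le) auto
    also have "\<dots> = C * haar_energy k d" by (simp add: C_def)
    also have "haar_energy k d = (L2_set (\<lambda>s. norm (c s)) {..<2 ^ k})\<^sup>2"
    proof -
      have "L2_set (\<lambda>r. norm (\<Sum>n<2 ^ k. heavy_haar k r n *\<^sub>R d n)) {..<2 ^ k}
          = L2_set (\<lambda>s. norm (c s)) {..<2 ^ k}"
        by (rule L2_set_cong) (simp_all add: inv)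
      then show ?thesis by (simp add: haar_energy_heavy)
    qed
    finally have "sqrt ((L2_set (\<lambda>r. norm (\<Sum>n<m. heavy_haar k r n *\<^sub>R d n)) {..<2 ^ k})\<^sup>2)
        \<le> sqrt (C * (L2_set (\<lambda>s. norm (c s)) {..<2 ^ k})\<^sup>2)"
      by (rule real_sqrt_le_mono)
    then show "L2_set (\<lambda>r. norm (\<Sum>n<m. heavy_haar k r n *\<^sub>R (\<Sum>s<2 ^ k. light_haar k s n *\<^sub>R c s))) {..<2 ^ k}
        \<le> sqrt C * L2_set (\<lambda>s. norm (c s)) {..<2 ^ k}"
      by (simp add: real_sqrt_mult d_def)
  qed
qed

text \<open>The second operator has the transposed matrix of the first, so it inherits the bound by
  duality.\<close>

lemma weighted_haar_truncation_bounded: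
  "\<exists>C\<ge>0. \<forall>k m (c :: nat \<Rightarrow> 'a::real_inner). m \<le> 2 ^ k \<longrightarrow>
     L2_set (\<lambda>r. norm (\<Sum>n<m. heavy_haar k r n *\<^sub>R (\<Sum>s<2 ^ k. light_haar k s n *\<^sub>R c s))) {..<2 ^ k}
       \<le> C * L2_set (\<lambda>s. norm (c s)) {..<2 ^ k} \<and>
     L2_set (\<lambda>r. norm (\<Sum>n<m. light_haar k r n *\<^sub>R (\<Sum>s<2 ^ k. heavy_haar k s n *\<^sub>R c s))) {..<2 ^ k}
       \<le> C * L2_set (\<lambda>s. norm (c s)) {..<2 ^ k}"
proof -
  obtain C where C: "0 \<le> C" and heavy: "\<And>k m (c :: nat \<Rightarrow> 'a). m \<le> 2 ^ k \<Longrightarrow>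
     L2_set (\<lambda>r. norm (\<Sum>n<m. heavy_haar k r n *\<^sub>R (\<Sum>s<2 ^ k. light_haar k s n *\<^sub>R c s))) {..<2 ^ k}
       \<le> C * L2_set (\<lambda>s. norm (c s)) {..<2 ^ k}"
    using heavy_truncation_bounded by blast
  have light: "L2_set (\<lambda>s. norm (\<Sum>n<m. light_haar k s n *\<^sub>R (\<Sum>r<2 ^ k. heavy_haar k r n *\<^sub>R c r))) {..<2 ^ k}
       \<le> C * L2_set (\<lambda>s. norm (c s)) {..<2 ^ k}" if "m \<le> 2 ^ k" for k m and c :: "nat \<Rightarrow> 'a"
  proof -
    define M where "M r s = (\<Sum>n<m. heavy_haar k r n * light_haar k s n)" for r s
    have M1: "(\<Sum>n<m. heavy_haar k r n *\<^sub>R (\<Sum>s<2 ^ k. light_haar k s n *\<^sub>R c s)) = (\<Sum>s<2 ^ k. M r s *\<^sub>R c s)"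
      for r and c :: "nat \<Rightarrow> 'a"
      unfolding M_def scaleR_sum_right scaleR_sum_left scaleR_scaleR by (rule sum.swap)
    have M2: "(\<Sum>n<m. light_haar k s n *\<^sub>R (\<Sum>r<2 ^ k. heavy_haar k r n *\<^sub>R c r)) = (\<Sum>r<2 ^ k. M r s *\<^sub>R c r)" for s
      unfolding M_def scaleR_sum_right scaleR_sum_left scaleR_scaleR
      by (subst sum.swap) (simp add: mult.commute)
    show ?thesis
      unfolding M2 by (rule transpose_bounded[OF _ C]) (use heavy[OF that] in \<open>simp only: M1\<close>)
  qed
  show ?thesis using C heavy light by blast
qed

lemma light_column_le:
  assumes "n < 2 ^ k"
  shows "L2_set (\<lambda>r. light_haar k r n) {..<2 ^ k} \<le> 1"
proof -
  have "(light_haar k r n)\<^sup>2 \<le> haar k r n * haar k r n" for r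
  proof -
    have "(haar k r n)\<^sup>2 / (haar_weight k r)\<^sup>2 \<le> (haar k r n)\<^sup>2 / 1"
      using haar_weight_ge_1[of k r] by (intro divide_left_mono one_le_power) auto
    then show ?thesis by (simp add: light_haar_def power_divide power2_eq_square)
  qed
  then have "(\<Sum>r<2 ^ k. (light_haar k r n)\<^sup>2) \<le> (\<Sum>r<2 ^ k. haar k r n * haar k r n)"
    by (rule sum_mono)
  then show ?thesis
    unfolding haar_columns_orthonormal[OF assms assms] L2_set_def by simp
qed

text \<open>A point lies in one dyadic interval of each length, so the energy is a partial sum of
  the geometric series in \<open>\<theta>\<close>; the induction keeps the remainder
  \<open>\<theta> ^ Suc k\<close>.\<close>

lemma interval_energy_unit:
  "(1 - \<theta>) * interval_energy k (\<lambda>n. of_bool (n = q) :: real) \<le> 1"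
proof -
  have "(1 - \<theta>) * interval_energy k (\<lambda>n. of_bool (n = q) :: real) \<le> 1 - \<theta> ^ Suc k"
    for q
  proof (induction k arbitrary: q)
    case 0
    then show ?case using \<theta> by simp
  next
    case (Suc k)
    define f :: "nat \<Rightarrow> nat \<Rightarrow> real" where "f q n = of_bool (n = q)" for q n
    have IH: "(1 - \<theta>) * interval_energy k (f q) \<le> 1 - \<theta> ^ Suc k" for q
      using Suc.IH[of q] by (simp add: f_def[abs_def])
    have "interval_energy k (f q) + interval_energy k (\<lambda>n. f q (2 ^ k + n)) = interval_energy k (f q) \<or>
      interval_energy k (f q) + interval_energy k (\<lambda>n. f q (2 ^ k + n)) = interval_energy k (f (q - 2 ^ k))"
    proof (cases "q < 2 ^ k")
      case True
      then have "interval_energy k (\<lambda>n. f q (2 ^ k + n)) = interval_energy k (\<lambda>_. 0 :: real)"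
        by (intro interval_energy_cong) (auto simp: f_def)
      then show ?thesis by simp
    next
      case False
      then have "interval_energy k (f q) = interval_energy k (\<lambda>_. 0 :: real)"
        by (intro interval_energy_cong) (auto simp: f_def)
      moreover have "(\<lambda>n. f q (2 ^ k + n)) = f (q - 2 ^ k)"
        using False by (auto simp: f_def fun_eq_iff)
      ultimately show ?thesis by simp
    qed
    then have "(1 - \<theta>) * (interval_energy k (f q) + interval_energy k (\<lambda>n. f q (2 ^ k + n))) \<le> 1 - \<theta> ^ Suc k"
      using IH by metis
    moreover have "(1 - \<theta>) * (\<theta> ^ Suc k * (norm (\<Sum>n<2 ^ Suc k. f q n))\<^sup>2) \<le> (1 - \<theta>) * (\<theta> ^ Suc k * 1)"
      using \<theta> by (intro mult_left_mono) (auto simp: f_def of_bool_def)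
    ultimately have "(1 - \<theta>) * interval_energy (Suc k) (f q) \<le> 1 - \<theta> ^ Suc k + (1 - \<theta>) * (\<theta> ^ Suc k * 1)"
      unfolding interval_energy.simps distrib_left by linarith
    also have "\<dots> = 1 - \<theta> ^ Suc (Suc k)" by (simp add: algebra_simps)
    finally show ?case by (simp add: f_def[abs_def])
  qed
  moreover have "0 \<le> \<theta> ^ Suc k" using \<theta> by simp
  ultimately show ?thesis by (meson diff_le_eq le_add_same_cancel1 order_trans)
qed

text \<open>A column is the image of a unit vector, so its square sum is a
  \<open>haar_energy\<close>.\<close>

lemma heavy_column_le:
  assumes "n < 2 ^ k"
  shows "L2_set (\<lambda>r. heavy_haar k r n) {..<2 ^ k} \<le> sqrt (2 / (1 - \<theta>))"
proof -
  have "(\<Sum>m<2 ^ k. heavy_haar k r m *\<^sub>R (of_bool (m = n) :: real)) = heavy_haar k r n" for r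
    using assms by (simp add: of_bool_def if_distrib cong: if_cong)
  then have "(L2_set (\<lambda>r. heavy_haar k r n) {..<2 ^ k})\<^sup>2 = haar_energy k (\<lambda>m. of_bool (m = n) :: real)"
    unfolding haar_energy_heavy by (simp add: L2_set_def)
  also have "\<dots> \<le> 2 * interval_energy k (\<lambda>m. of_bool (m = n) :: real)"
    by (rule haar_energy_le)
  also have "\<dots> \<le> 2 * (1 / (1 - \<theta>))"
    using interval_energy_unit[of k n] \<theta> by (simp add: field_simps)
  finally show ?thesis by (intro real_le_rsqrt) simp
qed

text \<open>A flat vector meets row 0 only, whose weight multiplies \<open>sqrt 2 ^ k\<close> here
  and divides it for \<open>light_haar\<close>; the quotient of the two sums is
  \<open>(2 * \<theta>) ^ k\<close>.\<close>

lemma sum_heavy_row: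
  assumes "r < 2 ^ k"
  shows "(\<Sum>n<2 ^ k. heavy_haar k r n) = of_bool (r = 0) * (sqrt 2 ^ k * sqrt (2 * \<theta>) ^ k)"
proof -
  have "(\<Sum>n<2 ^ k. heavy_haar k r n) = haar_weight k r * (\<Sum>n<2 ^ k. haar k r n)"
    by (simp add: heavy_haar_def sum_distrib_left)
  then show ?thesis
    using sum_haar_row[OF assms] by (cases "r = 0") (simp_all add: haar_weight_def)
qed

lemma sum_light_row:
  assumes "r < 2 ^ k"
  shows "(\<Sum>n<2 ^ k. light_haar k r n) = of_bool (r = 0) * (sqrt 2 ^ k / sqrt (2 * \<theta>) ^ k)"
proof -
  have "(\<Sum>n<2 ^ k. light_haar k r n) = (\<Sum>n<2 ^ k. haar k r n) / haar_weight k r"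
    by (simp add: light_haar_def sum_divide_distrib)
  then show ?thesis
    using sum_haar_row[OF assms] by (cases "r = 0") (simp_all add: haar_weight_def)
qed

end

section \<open>Complemented copies of the sequence space\<close>

lemma sums_interleave2:
  fixes f :: "nat \<Rightarrow> 'a::real_normed_vector"
  assumes "f sums s" "(\<lambda>n. f (2 * n)) sums a" "(\<lambda>n. f (2 * n + 1)) sums b"
  shows "s = a + b"
proof -
  have "(\<lambda>n. sum f {n * 2..<n * 2 + 2}) sums s"
    using sums_group[OF assms(1), of 2] by simp
  moreover have "sum f {n * 2..<n * 2 + 2} = f (2 * n) + f (2 * n + 1)" for n
    by (simp add: mult.commute)
  ultimately have "(\<lambda>n. f (2 * n) + f (2 * n + 1)) sums s" by simp
  then show ?thesis
    using sums_add[OF assms(2,3)] sums_unique2 by blast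
qed

lemma sums_even_reindex:
  fixes f :: "nat \<Rightarrow> 'a::real_normed_vector"
  assumes "\<And>n. f (2 * n + 1) = 0" "(\<lambda>n. f (2 * n)) sums a"
  shows "f sums a"
proof -
  have "f n = 0" if "n \<notin> range (\<lambda>n. 2 * n)" for n
  proof -
    have "odd n" using that by (auto elim!: evenE)
    then show ?thesis using assms(1) by (auto elim!: oddE)
  qed
  then show ?thesis
    using assms(2) sums_mono_reindex[of "\<lambda>n::nat. 2 * n" f a] by (auto simp: strict_mono_def)
qed

section \<open>Systems equivalent to the l2 unit vectors, with complemented span\<close>

context euclidean_banach_space_over
begin

text \<open>The two estimates bound synthesis and analysis, so expanding along \<open>gs\<close> and
  \<open>g\<close> is a bounded projection onto a copy of l2. They are stated for finite sets only;
  \<open>l2_map\<close> provides the limits.\<close>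

definition l2_system :: "real \<Rightarrow> (nat \<Rightarrow> 'x) \<Rightarrow> (nat \<Rightarrow> 'x \<Rightarrow> 'k) \<Rightarrow> bool" where
  "l2_system K g gs \<longleftrightarrow> 0 \<le> K \<and> (\<forall>n. scalar_linear (gs n)) \<and>
     (\<forall>n m. gs n (g m) = of_bool (m = n)) \<and>
     (\<forall>F c. finite F \<longrightarrow> norm (\<Sum>n\<in>F. sc (c n) (g n)) \<le> K * L2_set (\<lambda>n. norm (c n)) F) \<and>
     (\<forall>F f. finite F \<longrightarrow> L2_set (\<lambda>n. norm (gs n f)) F \<le> K * norm f)"

lemma l2_systemD:
  assumes "l2_system K g gs"
  shows "0 \<le> K" "scalar_linear (gs n)" "gs n (g m) = of_bool (m = n)"
    "finite F \<Longrightarrow> norm (\<Sum>n\<in>F. sc (c n) (g n)) \<le> K * L2_set (\<lambda>n. norm (c n)) F"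
    "finite F \<Longrightarrow> L2_set (\<lambda>n. norm (gs n f)) F \<le> K * norm f"
  using assms by (auto simp: l2_system_def)

lemma l2_system_mono:
  assumes l2: "l2_system K g gs" and "K \<le> K'"
  shows "l2_system K' g gs"
  unfolding l2_system_def
proof (intro conjI allI impI)
  show "0 \<le> K'" "scalar_linear (gs n)" "gs n (g m) = of_bool (m = n)" for n m
    using l2_systemD[OF l2] assms(2) by auto
  fix F :: "nat set" assume "finite F"
  show "norm (\<Sum>n\<in>F. sc (c n) (g n)) \<le> K' * L2_set (\<lambda>n. norm (c n)) F" for c
    using l2_systemD(4)[OF l2 \<open>finite F\<close>, of c]
      mult_right_mono[OF assms(2) L2_set_nonneg[of "\<lambda>n. norm (c n)" F]] by linarith
  show "L2_set (\<lambda>n. norm (gs n f)) F \<le> K' * norm f" for f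
    using l2_systemD(5)[OF l2 \<open>finite F\<close>, of f] mult_right_mono[OF assms(2) norm_ge_zero[of f]] by linarith
qed

lemma l2_system_subfamily:
  assumes l2: "l2_system K g gs" and p: "inj p"
  shows "l2_system K (\<lambda>n. g (p n)) (\<lambda>n. gs (p n))"
  unfolding l2_system_def
proof (intro conjI allI impI)
  show "0 \<le> K" "scalar_linear (gs (p n))" for n
    using l2_systemD[OF l2] by auto
  show "gs (p n) (g (p m)) = of_bool (m = n)" for m n
    using p by (simp add: l2_systemD(3)[OF l2] inj_eq)
  fix F :: "nat set" assume F: "finite F"
  have inj: "inj_on p F" using p by (meson inj_on_subset subset_UNIV)
  show "norm (\<Sum>n\<in>F. sc (c n) (g (p n))) \<le> K * L2_set (\<lambda>n. norm (c n)) F" for c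
    using l2_systemD(4)[OF l2, of "p ` F" "\<lambda>n. c (inv p n)"] F p
    by (simp add: sum.reindex[OF inj] L2_set_def)
  show "L2_set (\<lambda>n. norm (gs (p n) f)) F \<le> K * norm f" for f
    using l2_systemD(5)[OF l2, of "p ` F" f] F by (simp add: sum.reindex[OF inj] L2_set_def)
qed

lemma norm_le_L2_set:
  assumes "finite F" "n \<in> F"
  shows "norm (c n) \<le> L2_set (\<lambda>n. norm (c n)) F"
  using member_le_L2_set[OF assms, of "\<lambda>n. norm (c n)"] by simp

lemma l2_system_bounds:
  assumes "l2_system K g gs"
  shows "norm (g n) \<le> K" "norm (gs n f) \<le> K * norm f"
  using l2_systemD(4)[OF assms, of "{n}" "\<lambda>_. 1"] l2_systemD(5)[OF assms, of "{n}" f] by simp_all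

text \<open>The bound makes the coefficients square summable, and the synthesis estimate turns small
  tails of the square sum into small tails of the vector series.\<close>

lemma l2_system_summable:
  assumes l2: "l2_system K g gs" and c: "\<And>F. finite F \<Longrightarrow> L2_set (\<lambda>n. norm (c n)) F \<le> B"
  shows "(\<lambda>n. sc (c n) (g n)) sums (\<Sum>n. sc (c n) (g n))"
    and "norm (\<Sum>n. sc (c n) (g n)) \<le> K * B"
proof -
  note K = l2_systemD(1)[OF l2]
  have B: "0 \<le> B" using c[of "{}"] by simp
  have sq: "summable (\<lambda>n. (norm (c n))\<^sup>2)"
  proof (rule bounded_imp_summable)
    show "(\<Sum>k\<le>n. (norm (c k))\<^sup>2) \<le> B\<^sup>2" for n
      using c[of "{..n}"] B by (simp add: L2_set_def sqrt_le_D)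
  qed simp
  have "summable (\<lambda>n. sc (c n) (g n))"
    unfolding summable_Cauchy
  proof (intro allI impI)
    fix e :: real assume e: "0 < e"
    define d where "d = e / (K + 1)"
    have d: "0 < d" "K * d < e"
      using e K by (auto simp: d_def field_simps)
    obtain N where N: "\<And>m n. N \<le> m \<Longrightarrow> norm (\<Sum>k=m..<n. (norm (c k))\<^sup>2) < d\<^sup>2"
      using sq[unfolded summable_Cauchy] d(1) by (meson zero_less_power)
    show "\<exists>N. \<forall>m\<ge>N. \<forall>n. norm (\<Sum>n=m..<n. sc (c n) (g n)) < e"
    proof (intro exI allI impI)
      fix m n assume "N \<le> m"
      then have "L2_set (\<lambda>n. norm (c n)) {m..<n} \<le> d"
        using N[of m n] d(1) unfolding L2_set_def
        by (intro real_le_lsqrt) (auto simp: sum_nonneg)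
      then have "norm (\<Sum>n=m..<n. sc (c n) (g n)) \<le> K * d"
        using l2_systemD(4)[OF l2, of "{m..<n}" c] mult_left_mono[OF _ K] by fastforce
      then show "norm (\<Sum>n=m..<n. sc (c n) (g n)) < e" using d(2) by simp
    qed
  qed
  then show s: "(\<lambda>n. sc (c n) (g n)) sums (\<Sum>n. sc (c n) (g n))"
    by (rule summable_sums)
  have "norm (\<Sum>n<m. sc (c n) (g n)) \<le> K * B" for m
    using l2_systemD(4)[OF l2, of "{..<m}" c] mult_left_mono[OF c[of "{..<m}"] K] by simp
  then show "norm (\<Sum>n. sc (c n) (g n)) \<le> K * B"
    using tendsto_norm[OF s[unfolded sums_def]]
    by (intro LIMSEQ_le_const2) auto
qed

text \<open>For a matching pair this is the projection onto the closed span; for different systems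
  it moves the coordinates of one to the vectors of the other.\<close>

definition l2_map :: "(nat \<Rightarrow> 'x) \<Rightarrow> (nat \<Rightarrow> 'x \<Rightarrow> 'k) \<Rightarrow> 'x \<Rightarrow> 'x" where
  "l2_map g gs x = (\<Sum>n. sc (gs n x) (g n))"

lemma scalar_linear_simps:
  assumes "scalar_linear \<phi>"
  shows "\<phi> (x + y) = \<phi> x + \<phi> y" "\<phi> (x - y) = \<phi> x - \<phi> y" "\<phi> (r *\<^sub>R x) = r *\<^sub>R \<phi> x"
    "\<phi> (sc c x) = c * \<phi> x" "\<phi> 0 = 0" "\<phi> (sum F A) = (\<Sum>a\<in>A. \<phi> (F a))"
  using assms unfolding scalar_linear_def
  by (auto simp: linear_simps bounded_linear.linear linear_sum)

lemma l2_map_sums: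
  assumes "l2_system K g gs" "l2_system K' g' gs'"
  shows "(\<lambda>n. sc (gs' n x) (g n)) sums l2_map g gs' x"
    and "norm (l2_map g gs' x) \<le> K * (K' * norm x)"
  unfolding l2_map_def using l2_system_summable[OF assms(1) l2_systemD(5)[OF assms(2)]] by auto

lemma l2_map_linear:
  assumes l2: "l2_system K g gs" "l2_system K' g' gs'"
  shows "bounded_linear (l2_map g gs')" "l2_map g gs' (sc c x) = sc c (l2_map g gs' x)"
proof -
  note s = l2_map_sums(1)[OF l2] and lin = scalar_linear_simps[OF l2_systemD(2)[OF l2(2)]]
  show "bounded_linear (l2_map g gs')"
  proof (rule bounded_linear_intro)
    show "l2_map g gs' (x + y) = l2_map g gs' x + l2_map g gs' y" for x y
      using sums_add[OF s[of x] s[of y]] s[of "x + y"]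
      by (simp add: lin sc.add_left sums_unique2)
    show "l2_map g gs' (r *\<^sub>R x) = r *\<^sub>R l2_map g gs' x" for r x
      using sums_scaleR_right[OF s[of x], of r] s[of "r *\<^sub>R x"]
      by (simp add: lin sc.scaleR_left sums_unique2)
    show "norm (l2_map g gs' x) \<le> norm x * (K * K')" for x
      using l2_map_sums(2)[OF l2, of x] by (simp add: mult_ac)
  qed
  show "l2_map g gs' (sc c x) = sc c (l2_map g gs' x)"
    using bounded_linear.sums[OF sc.bounded_linear_right s[of x], of c] s[of "sc c x"]
    by (simp add: lin sums_unique2)
qed

lemma l2_map_coord:
  assumes l2: "l2_system K g gs" "l2_system K' g' gs'"
  shows "gs n (l2_map g gs' x) = gs' n x"
  by (rule sums_biorthogonal_unique[OF l2_systemD(2)[OF l2(1)] _ l2_map_sums(1)[OF l2]])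
     (simp add: l2_systemD(3)[OF l2(1)])

text \<open>
  Shifting the \<open>\<ell>\<^sub>2\<close>-coordinates of \<open>x\<close> to the even ones embeds the space into itself, with
  complement spanned by the odd part of the system; this is the isomorphism between the space and
  its direct sum with \<open>\<ell>\<^sub>2\<close>.
\<close>

lemma l2_absorption:
  assumes l2: "l2_system K h hs"
  obtains R S where "bounded_linear R" "bounded_linear S"
    "\<And>c x. R (sc c x) = sc c (R x)" "\<And>c x. S (sc c x) = sc c (S x)"
    "\<And>x. S (R x) = x" "\<And>n. S (h (2 * n + 1)) = 0" "\<And>n x. hs (2 * n + 1) (R x) = 0"
    "\<And>x. x = R (S x) + l2_map (\<lambda>n. h (2 * n + 1)) (\<lambda>n. hs (2 * n + 1)) x"
proof -
  have even: "l2_system K (\<lambda>n. h (2 * n)) (\<lambda>n. hs (2 * n))"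
    and odd: "l2_system K (\<lambda>n. h (2 * n + 1)) (\<lambda>n. hs (2 * n + 1))"
    by (rule l2_system_subfamily[OF l2]; auto simp: inj_on_def)+
  define P D U where "P = l2_map h hs" and "D = l2_map (\<lambda>n. h (2 * n)) hs"
    and "U = l2_map h (\<lambda>n. hs (2 * n))"
  note P = l2_map_sums(1)[OF l2 l2, folded P_def] l2_map_linear[OF l2 l2, folded P_def]
    l2_map_coord[OF l2 l2, folded P_def]
  note D = l2_map_sums(1)[OF even l2, folded D_def] l2_map_linear[OF even l2, folded D_def]
    l2_map_coord[OF even l2, folded D_def]
  note U = l2_map_sums(1)[OF l2 even, folded U_def] l2_map_linear[OF l2 even, folded U_def]
    l2_map_coord[OF l2 even, folded U_def]
  note lin = scalar_linear_simps[OF l2_systemD(2)[OF l2]]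
  \<comment> \<open>Both maps fix the complement of the system. \<open>R\<close> sends
    \<open>h n\<close> to \<open>h (2 * n)\<close>; \<open>S\<close> sends \<open>h (2 * n)\<close>
    back to \<open>h n\<close> and kills the odd vectors.\<close>
  define R S where "R x = x - P x + D x" and "S x = x - P x + U x" for x
  have hs_odd_D: "hs (2 * n + 1) (D x) = 0" for n x
  proof -
    have "(\<lambda>m. hs (2 * n + 1) (sc (hs m x) (h (2 * m)))) sums hs (2 * n + 1) (D x)"
      using l2_systemD(2)[OF l2, of "2 * n + 1"] bounded_linear.sums[OF _ D(1)]
      unfolding scalar_linear_def by blast
    moreover have "2 * m \<noteq> 2 * n + 1" for m by presburger
    ultimately have "(\<lambda>m. 0) sums hs (2 * n + 1) (D x)"
      by (simp add: lin l2_systemD(3)[OF l2] del: mult_Suc_right)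
    then show ?thesis using sums_unique2 sums_zero by blast
  qed
  have hsR: "hs n (R x) = hs n (D x)" for n x
    by (simp add: R_def lin P)
  have hsS: "hs n (S x) = hs (2 * n) x" for n x
    by (simp add: S_def lin P U)
  have PR: "P (R x) = D x" for x
  proof (rule sums_unique2[OF P(1)])
    show "(\<lambda>n. sc (hs n (R x)) (h n)) sums D x"
      by (rule sums_even_reindex) (use D(1)[of x] in \<open>simp_all add: hsR hs_odd_D[simplified] D(4)\<close>)
  qed
  have UR: "U (R x) = P x" for x
    by (rule sums_unique2[OF U(1)]) (use P(1)[of x] in \<open>simp add: hsR D(4)\<close>)
  have SR: "S (R x) = x" for x
  proof -
    have "S (R x) = R x - P (R x) + U (R x)" by (simp add: S_def)
    then show ?thesis by (simp add: PR UR) (simp add: R_def)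
  qed
  have PS: "P (S x) = U x" for x
    by (rule sums_unique2[OF P(1)]) (use U(1)[of x] in \<open>simp add: hsS\<close>)
  have RS: "R (S x) = x - P x + D (S x)" for x
  proof -
    have "R (S x) = S x - P (S x) + D (S x)" by (simp add: R_def)
    then show ?thesis by (simp add: PS) (simp add: S_def)
  qed
  have split: "P x = D (S x) + l2_map (\<lambda>n. h (2 * n + 1)) (\<lambda>n. hs (2 * n + 1)) x" for x
  proof (rule sums_interleave2[OF P(1)])
    show "(\<lambda>n. sc (hs (2 * n) x) (h (2 * n))) sums D (S x)"
      using D(1)[of "S x"] by (simp add: hsS)
    show "(\<lambda>n. sc (hs (2 * n + 1) x) (h (2 * n + 1))) sums
        l2_map (\<lambda>n. h (2 * n + 1)) (\<lambda>n. hs (2 * n + 1)) x"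
      by (rule l2_map_sums(1)[OF odd odd])
  qed
  show ?thesis
  proof (rule that[of R S])
    show "bounded_linear R" "bounded_linear S"
      unfolding R_def[abs_def] S_def[abs_def]
      by (intro bounded_linear_add bounded_linear_sub bounded_linear_ident P D U)+
    show "R (sc c x) = sc c (R x)" "S (sc c x) = sc c (S x)" for c x
      by (simp_all add: R_def S_def P D U sc.add_right sc.diff_right)
    show "S (R x) = x" "hs (2 * n + 1) (R x) = 0" for x n
      using SR hsR hs_odd_D by auto
    show "S (h (2 * n + 1)) = 0" for n
    proof -
      have "(\<lambda>m. sc (hs m (h (2 * n + 1))) (h m)) = (\<lambda>m. if m = 2 * n + 1 then h m else 0)"
        by (auto simp: l2_systemD(3)[OF l2] fun_eq_iff)
      then have "P (h (2 * n + 1)) = h (2 * n + 1)"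
        using P(1)[of "h (2 * n + 1)"] sums_single[of "2 * n + 1" h] sums_unique2 by metis
      moreover have "(\<lambda>m. sc (hs (2 * m) (h (2 * n + 1))) (h m)) = (\<lambda>m. 0)"
      proof
        fix m
        have "2 * n + 1 \<noteq> 2 * m" by presburger
        then show "sc (hs (2 * m) (h (2 * n + 1))) (h m) = 0"
          by (simp add: l2_systemD(3)[OF l2] del: mult_Suc_right)
      qed
      then have "U (h (2 * n + 1)) = 0"
        using U(1)[of "h (2 * n + 1)"] sums_zero sums_unique2 by metis
      ultimately show ?thesis by (simp add: S_def)
    qed
    show "x = R (S x) + l2_map (\<lambda>n. h (2 * n + 1)) (\<lambda>n. hs (2 * n + 1)) x" for x
      using split[of x] by (simp add: RS)
  qed
qed

text \<open>The given basis is pushed forward by \<open>R\<close> and its coordinates are pulled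
  back by \<open>S\<close>; the odd vectors of the system become the free copy of l2.
  Biorthogonality follows from \<open>S (R x) = x\<close> and from the vanishing of \<open>S\<close>
  and \<open>hs\<close> on the other summand.\<close>

lemma basis_l2_decomposition:
  assumes e0: "schauder_basis sc e0" and l2: "l2_system K0 h hs"
  obtains K e es g gs where "l2_system K g gs" "\<And>n. scalar_linear (es n)"
    "\<And>n m. es n (e m) = of_bool (m = n)" "\<And>n m. es n (g m) = 0" "\<And>n m. gs n (e m) = 0"
    "\<And>n. norm (e n) \<le> K" "\<And>n f. norm (es n f) \<le> K * norm f"
    "\<And>f. \<exists>L. (\<lambda>n. sc (es n f) (e n)) sums L \<and> f = L + l2_map g gs f"
proof -
  obtain R S where R: "bounded_linear R" and S: "bounded_linear S"
    and Rs: "\<And>c x. R (sc c x) = sc c (R x)" and Ss: "\<And>c x. S (sc c x) = sc c (S x)"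
    and SR: "\<And>x. S (R x) = x" and Sh: "\<And>n. S (h (2 * n + 1)) = 0"
    and hsR: "\<And>n x. hs (2 * n + 1) (R x) = 0"
    and split: "\<And>x. x = R (S x) + l2_map (\<lambda>n. h (2 * n + 1)) (\<lambda>n. hs (2 * n + 1)) x"
    using l2_absorption[OF l2] by blast
  have odd: "l2_system K0 (\<lambda>n. h (2 * n + 1)) (\<lambda>n. hs (2 * n + 1))"
    by (rule l2_system_subfamily[OF l2]) (auto simp: inj_on_def)
  obtain K1 where K1: "\<And>f n. norm (\<Sum>i<n. sc (coord sc e0 i f) (e0 i)) \<le> K1 * norm f"
    using schauder_basis_constant[OF e0] by blast
  define N where "N n = norm (e0 n)" for n
  have N: "0 < N n" for n using schauder_basis_nonzero[OF e0, of n] by (simp add: N_def)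
  note lin = scalar_linear_simps[OF scalar_linear_coord[OF e0]]
  \<comment> \<open>The rescaling by \<open>N n\<close> is needed since the given basis may have
    unbounded vectors or unbounded coordinate functionals.\<close>
  define e where "e n = (1 / N n) *\<^sub>R R (e0 n)" for n
  define es where "es n f = N n *\<^sub>R coord sc e0 n (S f)" for n f
  obtain KR where KR: "\<And>x. norm (R x) \<le> norm x * KR" "0 \<le> KR"
    using bounded_linear.nonneg_bounded[OF R] by blast
  obtain KS where KS: "\<And>x. norm (S x) \<le> norm x * KS" "0 \<le> KS"
    using bounded_linear.nonneg_bounded[OF S] by blast
  have e: "norm (e n) \<le> KR" for n
    using KR(1)[of "e0 n"] N[of n] by (simp add: e_def N_def[symmetric] field_simps)
  have es: "norm (es n f) \<le> 2 * \<bar>K1\<bar> * KS * norm f" for n f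
  proof -
    define s where "s n = (\<Sum>i<n. sc (coord sc e0 i (S f)) (e0 i))" for n
    have "sc (coord sc e0 n (S f)) (e0 n) = s (Suc n) - s n"
      by (simp add: s_def)
    from arg_cong[OF this, of norm]
    have "norm (sc (coord sc e0 n (S f)) (e0 n)) \<le> 2 * (K1 * norm (S f))"
      using norm_triangle_ineq4[of "s (Suc n)" "s n"] K1[of "S f" "Suc n"] K1[of "S f" n]
      unfolding s_def[symmetric] by linarith
    also have "\<dots> \<le> 2 * (\<bar>K1\<bar> * (norm f * KS))"
      using KS(1)[of f] by (intro mult_left_mono mult_mono) auto
    finally show ?thesis using N[of n] by (simp add: es_def norm_scale N_def mult_ac)
  qed
  have eslin: "scalar_linear (es n)" for n
  proof -
    have "bounded_linear (\<lambda>f. coord sc e0 n (S f))"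
      using scalar_linear_coord[OF e0, of n] S unfolding scalar_linear_def
      by (auto intro: bounded_linear_compose)
    then show ?thesis
      unfolding scalar_linear_def es_def
      by (auto intro: bounded_linear_scaleR_right[THEN bounded_linear_compose] simp: Ss lin)
  qed
  define K where "K = max K0 (max KR (2 * \<bar>K1\<bar> * KS))"
  have K: "K0 \<le> K" "KR \<le> K" "2 * \<bar>K1\<bar> * KS \<le> K" by (auto simp: K_def)
  show ?thesis
  proof (rule that[of K "\<lambda>n. h (2 * n + 1)" "\<lambda>n. hs (2 * n + 1)" es e])
    show "l2_system K (\<lambda>n. h (2 * n + 1)) (\<lambda>n. hs (2 * n + 1))"
      by (rule l2_system_mono[OF odd K(1)])
    show "scalar_linear (es n)" for n by (rule eslin)
    show "es n (e m) = of_bool (m = n)" for n m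
    proof -
      have "coord sc e0 n (e0 m) = of_bool (m = n)"
        using coord_finite_sum[OF e0, of "{m}" n "\<lambda>_. 1"] by auto
      then show ?thesis
        using N[of m] by (auto simp: es_def e_def SR lin linear_simps[OF S])
    qed
    show "es n (h (2 * m + 1)) = 0" for n m
      unfolding es_def Sh by (simp add: lin)
    show "hs (2 * n + 1) (e m) = 0" for n m
      unfolding e_def scalar_linear_simps[OF l2_systemD(2)[OF l2]] hsR by simp
    show "norm (e n) \<le> K" for n using e[of n] K(2) by simp
    show "norm (es n f) \<le> K * norm f" for n f
      using es[of n f] mult_right_mono[OF K(3), of "norm f"] by simp
    show "\<exists>L. (\<lambda>n. sc (es n f) (e n)) sums L \<and>
        f = L + l2_map (\<lambda>n. h (2 * n + 1)) (\<lambda>n. hs (2 * n + 1)) f" for f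
    proof (intro exI[of _ "R (S f)"] conjI)
      have "(\<lambda>n. R (sc (coord sc e0 n (S f)) (e0 n))) sums R (S f)"
        by (rule bounded_linear.sums[OF R coord_sums[OF e0]])
      moreover have "R (sc (coord sc e0 n (S f)) (e0 n)) = sc (es n f) (e n)" for n
        using N[of n] by (simp add: Rs es_def e_def sc.scaleR_left sc.scaleR_right)
      ultimately show "(\<lambda>n. sc (es n f) (e n)) sums R (S f)" by simp
      show "f = R (S f) + l2_map (\<lambda>n. h (2 * n + 1)) (\<lambda>n. hs (2 * n + 1)) f"
        by (rule split)
    qed
  qed
qed

section \<open>From a complemented copy of l2 to an l2 system\<close>

lemma ell2_add:
  assumes "u \<in> ell2" "v \<in> (ell2 :: (nat \<Rightarrow> 'k) set)"
  shows "(\<lambda>n. u n + v n) \<in> ell2"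
proof -
  have "(norm (u n + v n))\<^sup>2 \<le> 2 * (norm (u n))\<^sup>2 + 2 * (norm (v n))\<^sup>2" for n
    using zero_le_power2[of "norm (u n - v n)"] by (simp add: power2_norm_eq_inner inner_simps)
  then have le: "norm ((norm (u n + v n))\<^sup>2) \<le> 2 * (norm (u n))\<^sup>2 + 2 * (norm (v n))\<^sup>2" for n
    by simp
  have "summable (\<lambda>n. 2 * (norm (u n))\<^sup>2 + 2 * (norm (v n))\<^sup>2)"
    using assms unfolding ell2_def mem_Collect_eq by (rule summable_add[OF summable_mult summable_mult])
  then have "summable (\<lambda>n. (norm (u n + v n))\<^sup>2)"
    by (rule summable_comparison_test'[OF _ le])
  then show ?thesis by (simp add: ell2_def)
qed

lemma ell2_scale:
  assumes "u \<in> (ell2 :: (nat \<Rightarrow> 'k) set)"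
  shows "(\<lambda>n. c * u n) \<in> ell2"
  using assms summable_mult[of "\<lambda>n. (norm (u n))\<^sup>2" "(norm c)\<^sup>2"]
  by (simp add: ell2_def norm_mult power_mult_distrib)

lemma ell2_finite_support:
  assumes "finite F"
  shows "(\<lambda>i. if i \<in> F then c i else 0) \<in> (ell2 :: (nat \<Rightarrow> 'k) set)"
    and "ell2_norm (\<lambda>i. if i \<in> F then c i else (0 :: 'k)) = L2_set (\<lambda>i. norm (c i)) F"
proof -
  have eq: "(\<lambda>i. (norm (if i \<in> F then c i else 0))\<^sup>2) = (\<lambda>i. if i \<in> F then (norm (c i))\<^sup>2 else 0)"
    by auto
  have s: "(\<lambda>i. if i \<in> F then (norm (c i))\<^sup>2 else 0) sums (\<Sum>i\<in>F. (norm (c i))\<^sup>2)"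
    by (rule sums_If_finite_set[OF assms])
  show "(\<lambda>i. if i \<in> F then c i else 0) \<in> (ell2 :: (nat \<Rightarrow> 'k) set)"
    unfolding ell2_def mem_Collect_eq eq using s by (rule sums_summable)
  show "ell2_norm (\<lambda>i. if i \<in> F then c i else 0) = L2_set (\<lambda>i. norm (c i)) F"
    unfolding ell2_norm_def eq sums_unique[OF s, symmetric] L2_set_def ..
qed

lemma L2_set_le_ell2_norm:
  assumes "u \<in> (ell2 :: (nat \<Rightarrow> 'k) set)" "finite F"
  shows "L2_set (\<lambda>i. norm (u i)) F \<le> ell2_norm u"
  unfolding L2_set_def ell2_norm_def
  using assms by (intro real_sqrt_le_mono sum_le_suminf) (auto simp: ell2_def)

text \<open>The vectors are the images of the unit vectors under the isomorphism \<open>T\<close>,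
  and the functionals are the coordinates of \<open>V\<close>, the inverse of \<open>T\<close>
  applied after the projection \<open>P\<close>.\<close>

lemma complemented_l2_system:
  assumes Y: "complemented_subspace sc Y" "ell2_isomorphic_to sc Y"
  obtains K g gs where "l2_system K g gs"
proof -
  obtain P KP where Plin: "Vector_Spaces.linear sc sc P" and KP: "\<And>x. norm (P x) \<le> KP * norm x"
    and PY: "range P = Y" and Pid: "\<And>y. y \<in> Y \<Longrightarrow> P y = y"
    using Y(1) unfolding complemented_subspace_def by blast
  obtain T K1 K2 where bij: "bij_betw T ell2 Y"
    and Tadd: "\<And>u v. u \<in> ell2 \<Longrightarrow> v \<in> ell2 \<Longrightarrow> T (\<lambda>n. u n + v n) = T u + T v"
    and Tscale: "\<And>c u. u \<in> ell2 \<Longrightarrow> T (\<lambda>n. c * u n) = sc c (T u)"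
    and K1: "\<And>u. u \<in> ell2 \<Longrightarrow> norm (T u) \<le> K1 * ell2_norm u"
    and K2: "\<And>u. u \<in> ell2 \<Longrightarrow> ell2_norm u \<le> K2 * norm (T u)"
    using Y(2) unfolding ell2_isomorphic_to_def by blast
  interpret P: Vector_Spaces.linear sc sc P by (rule Plin)
  define V where "V x = inv_into ell2 T (P x)" for x
  have V: "V x \<in> ell2" "T (V x) = P x" for x
  proof -
    have "P x \<in> T ` ell2" using bij PY by (auto simp: bij_betw_def)
    then show "V x \<in> ell2" "T (V x) = P x"
      unfolding V_def by (rule inv_into_into, rule f_inv_into_f)
  qed
  have Veq: "V x = u" if "u \<in> ell2" "T u = P x" for x u
    using bij that V[of x] unfolding bij_betw_def inj_on_def by metis
  have Vadd: "V (x + y) = (\<lambda>n. V x n + V y n)" for x y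
    by (rule Veq) (auto simp: Tadd V P.add intro: ell2_add V)
  have Vscale: "V (sc c x) = (\<lambda>n. c * V x n)" for c x
    by (rule Veq) (auto simp: Tscale V P.scale intro: ell2_scale V)
  define g where "g n = T (\<lambda>i. if i \<in> {n} then 1 else 0)" for n
  have Tfin: "T (\<lambda>i. if i \<in> F then c i else 0) = (\<Sum>n\<in>F. sc (c n) (g n))" if "finite F" for F c
    using that
  proof (induction F)
    case empty
    show ?case using Tscale[OF ell2_finite_support(1)[of "{}"], of 0] by simp
  next
    case (insert m F)
    have "(\<lambda>i. if i \<in> insert m F then c i else 0)
        = (\<lambda>i. c m * (if i \<in> {m} then 1 else 0) + (if i \<in> F then c i else 0))"
      using insert by auto
    then have "T (\<lambda>i. if i \<in> insert m F then c i else 0)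
        = sc (c m) (g m) + T (\<lambda>i. if i \<in> F then c i else 0)"
      using insert by (simp only: Tadd[OF ell2_scale ell2_finite_support(1)] ell2_finite_support(1)
          Tscale g_def finite.intros)
    then show ?case using insert by simp
  qed
  define K where "K = max \<bar>K1\<bar> (\<bar>K2\<bar> * \<bar>KP\<bar>)"
  have K: "0 \<le> K" "K1 \<le> K" "\<bar>K2\<bar> * \<bar>KP\<bar> \<le> K" by (auto simp: K_def)
  have VK: "L2_set (\<lambda>n. norm (V f n)) F \<le> K * norm f" if "finite F" for F f
  proof -
    have "L2_set (\<lambda>n. norm (V f n)) F \<le> K2 * norm (P f)"
      using L2_set_le_ell2_norm[OF V(1) that] K2[OF V(1)] V(2) order_trans by metis
    also have "\<dots> \<le> \<bar>K2\<bar> * (\<bar>KP\<bar> * norm f)"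
      using KP[of f] mult_right_mono[OF abs_ge_self[of KP], of "norm f"]
      by (intro mult_mono) auto
    also have "\<dots> \<le> K * norm f"
      using mult_right_mono[OF K(3), of "norm f"] by (simp add: mult.assoc)
    finally show ?thesis .
  qed
  have "l2_system K g (\<lambda>n x. V x n)"
    unfolding l2_system_def
  proof (intro conjI allI impI)
    show "0 \<le> K" by (rule K)
    show "scalar_linear (\<lambda>x. V x n)" for n
      unfolding scalar_linear_def
    proof (intro conjI allI bounded_linear_intro)
      show "V (x + y) n = V x n + V y n" "V (sc c x) n = c * V x n" for x y c
        by (simp_all add: Vadd Vscale)
      show "V (r *\<^sub>R x) n = r *\<^sub>R V x n" for r x
        using fun_cong[OF Vscale[of "of_real r" x], of n] by (simp add: scale_of_real scaleR_conv_of_real)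
      show "norm (V x n) \<le> norm x * K" for x
        using VK[of "{n}" x] by (simp add: mult.commute)
    qed
    show "V (g m) n = of_bool (m = n)" for n m
    proof -
      have e: "(\<lambda>i. if i \<in> {m} then 1 else 0) \<in> (ell2 :: (nat \<Rightarrow> 'k) set)"
        by (rule ell2_finite_support) simp
      then have "g m \<in> Y" using bij unfolding g_def bij_betw_def by blast
      then have "V (g m) = (\<lambda>i. if i \<in> {m} then 1 else 0)"
        by (intro Veq[OF e]) (simp only: Pid g_def)
      then show ?thesis by simp
    qed
    fix F :: "nat set" assume F: "finite F"
    show "norm (\<Sum>n\<in>F. sc (c n) (g n)) \<le> K * L2_set (\<lambda>n. norm (c n)) F" for c
      using K1[OF ell2_finite_support(1)[OF F, of c]]
        mult_right_mono[OF K(2) L2_set_nonneg[of "\<lambda>n. norm (c n)" F]]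
      unfolding Tfin[OF F] ell2_finite_support(2)[OF F] by linarith
    show "L2_set (\<lambda>n. norm (V f n)) F \<le> K * norm f" for f by (rule VK[OF F])
  qed
  then show ?thesis by (rule that)
qed

end

section \<open>Blockwise transforms of biorthogonal systems\<close>

text \<open>The dyadic block \<open>k\<close> consists of the indices \<open>2 ^ k - 1 + n\<close> with \<open>n < 2 ^ k\<close>.\<close>

definition block_start :: "nat \<Rightarrow> nat" where
  "block_start k = 2 ^ k - 1"

text \<open>Counted from 1, block \<open>k\<close> is the range from \<open>2 ^ k\<close> to
  \<open>2 ^ (k + 1) - 1\<close>; hence the shift by \<open>Suc\<close>.\<close>

definition block_index :: "nat \<Rightarrow> nat" where
  "block_index j = floor_log (Suc j)"

definition block_offset :: "nat \<Rightarrow> nat" where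
  "block_offset j = j - block_start (block_index j)"

lemma block_start_0 [simp]: "block_start 0 = 0"
  by (simp add: block_start_def)

lemma block_start_Suc: "block_start (Suc k) = block_start k + 2 ^ k"
proof -
  have "(1::nat) \<le> 2 ^ k" by simp
  then show ?thesis by (simp add: block_start_def)
qed

lemma block_index_eq [simp]: "n < 2 ^ k \<Longrightarrow> block_index (block_start k + n) = k"
  unfolding block_index_def block_start_def by (rule floor_log_eqI) auto

lemma block_offset_eq [simp]: "n < 2 ^ k \<Longrightarrow> block_offset (block_start k + n) = n"
  by (simp add: block_offset_def)

lemma block_decomp: "j = block_start (block_index j) + block_offset j"
  and block_offset_less: "block_offset j < 2 ^ block_index j"
proof -
  have 1: "2 ^ block_index j \<le> Suc j" unfolding block_index_def by (rule floor_log_exp2_le) simp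
  have 2: "Suc j < 2 * 2 ^ block_index j" unfolding block_index_def by (rule floor_log_exp2_gt)
  show "j = block_start (block_index j) + block_offset j"
    using 1 by (simp add: block_offset_def block_start_def)
  show "block_offset j < 2 ^ block_index j"
    using 1 2 by (simp add: block_offset_def block_start_def)
qed

lemma block_cases:
  obtains k n where "j = block_start k + n" "n < 2 ^ k"
  using block_decomp block_offset_less by blast

lemma block_start_mono: "k \<le> l \<Longrightarrow> block_start k \<le> block_start l"
  unfolding block_start_def by (intro diff_le_mono power_increasing) auto

lemma strict_mono_block_start: "strict_mono block_start"
  by (rule strict_monoI_Suc) (simp add: block_start_Suc)

lemma block_start_inj: "block_start k = block_start l \<longleftrightarrow> k = l"
  using strict_mono_eq[OF strict_mono_block_start] .

lemma block_start_add_inj: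
  assumes "n < 2 ^ k" "m < 2 ^ l"
  shows "block_start k + n = block_start l + m \<longleftrightarrow> k = l \<and> n = m"
  using assms by (metis block_index_eq block_offset_eq)

lemma less_block_start_iff: "j < block_start K \<longleftrightarrow> block_index j < K"
proof
  show "block_index j < K" if "j < block_start K"
  proof (rule ccontr)
    assume "\<not> block_index j < K"
    then have "block_start K \<le> block_start (block_index j)" by (intro block_start_mono) simp
    then show False using block_decomp[of j] that by simp
  qed
  show "j < block_start K" if "block_index j < K"
  proof -
    have "j < block_start (Suc (block_index j))"
      using block_decomp[of j] block_offset_less[of j] by (simp add: block_start_Suc)
    also have "\<dots> \<le> block_start K" using that by (intro block_start_mono) simp
    finally show ?thesis .
  qed
qed

lemma sum_blocks:
  fixes f :: "nat \<Rightarrow> 'a::comm_monoid_add"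
  shows "(\<Sum>j<block_start k + m. f j) = (\<Sum>j<block_start k. f j) + (\<Sum>n<m. f (block_start k + n))"
  by (induction m) (auto simp: add.assoc)

lemma sum_block_start:
  fixes f :: "nat \<Rightarrow> 'a::comm_monoid_add"
  shows "(\<Sum>j<block_start K. f j) = (\<Sum>k<K. \<Sum>n<2 ^ k. f (block_start k + n))"
  by (induction K) (auto simp: block_start_Suc sum_blocks)

lemma finite_subset_block_start:
  assumes "finite D"
  obtains K where "D \<subseteq> {..<block_start K}"
proof -
  obtain m where m: "D \<subseteq> {..<m}"
    using finite_nat_iff_bounded assms by blast
  have "m < 2 ^ m" by (rule less_exp)
  then have "m \<le> block_start m" unfolding block_start_def by linarith
  then show ?thesis using m that[of m] by (meson lessThan_subset_iff subset_trans)
qed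

lemma filterlim_block_start: "filterlim block_start at_top sequentially"
  by (rule filterlim_subseq[OF strict_mono_block_start])

lemma filterlim_block_index: "filterlim block_index at_top sequentially"
  unfolding filterlim_at_top
proof
  fix K
  have "block_start K \<le> j \<Longrightarrow> K \<le> block_index j" for j
    using less_block_start_iff[of j K] by linarith
  then show "\<forall>\<^sub>F j in sequentially. K \<le> block_index j"
    unfolding eventually_sequentially by blast
qed

text \<open>Each block of \<open>G\<close> is transformed by \<open>W\<close>, and the functionals
  by the inverse transpose \<open>W'\<close>. The estimates concern single blocks, so
  \<open>G\<close> may contain vectors outside any l2 system. The truncation bound controls partial
  sums that end inside a block.\<close>

locale block_transform = euclidean_banach_space_over sc
  for sc :: "'k::{real_normed_field,euclidean_space} \<Rightarrow> 'x::banach \<Rightarrow> 'x" +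
  fixes G :: "nat \<Rightarrow> 'x" and Gs :: "nat \<Rightarrow> 'x \<Rightarrow> 'k" and W W' :: "nat \<Rightarrow> nat \<Rightarrow> nat \<Rightarrow> real"
    and K C :: real
  assumes linear: "scalar_linear (Gs n)"
    and biorthogonal: "Gs n (G m) = of_bool (m = n)"
    and inverse_columns: "n < 2 ^ k \<Longrightarrow> m < 2 ^ k \<Longrightarrow> (\<Sum>r<2 ^ k. W' k r n * W k r m) = of_bool (n = m)"
    and inverse_rows: "r < 2 ^ k \<Longrightarrow> s < 2 ^ k \<Longrightarrow> (\<Sum>n<2 ^ k. W k r n * W' k s n) = of_bool (r = s)"
    and truncation: "m \<le> 2 ^ k \<Longrightarrow>
      L2_set (\<lambda>r. norm (\<Sum>n<m. W k r n *\<^sub>R (\<Sum>s<2 ^ k. W' k s n *\<^sub>R (c s :: 'k)))) {..<2 ^ k}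
        \<le> C * L2_set (\<lambda>s. norm (c s)) {..<2 ^ k}"
    and synthesis: "norm (\<Sum>r<2 ^ k. sc (c r) (G (block_start k + r))) \<le> K * L2_set (\<lambda>r. norm (c r)) {..<2 ^ k}"
    and K_nonneg: "0 \<le> K"
begin

definition transformed :: "nat \<Rightarrow> 'x" where
  "transformed j = (\<Sum>r<2 ^ block_index j. W (block_index j) r (block_offset j) *\<^sub>R
     G (block_start (block_index j) + r))"

definition transformed_dual :: "nat \<Rightarrow> 'x \<Rightarrow> 'k" where
  "transformed_dual j f = (\<Sum>r<2 ^ block_index j. W' (block_index j) r (block_offset j) *\<^sub>R
     Gs (block_start (block_index j) + r) f)"

lemma transformed_block:
  "n < 2 ^ k \<Longrightarrow> transformed (block_start k + n) = (\<Sum>r<2 ^ k. W k r n *\<^sub>R G (block_start k + r))"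
  by (simp add: transformed_def)

lemma transformed_dual_block:
  "n < 2 ^ k \<Longrightarrow>
    transformed_dual (block_start k + n) f = (\<Sum>r<2 ^ k. W' k r n *\<^sub>R Gs (block_start k + r) f)"
  by (simp add: transformed_dual_def)

lemma scalar_linear_transformed_dual: "scalar_linear (transformed_dual j)"
  unfolding scalar_linear_def
proof
  show "bounded_linear (transformed_dual j)"
    unfolding transformed_dual_def[abs_def] using linear
    by (intro bounded_linear_sum bounded_linear_scaleR_right[THEN bounded_linear_compose])
       (auto simp: scalar_linear_def)
  show "\<forall>c x. transformed_dual j (sc c x) = c * transformed_dual j x"
    by (simp add: transformed_dual_def scalar_linear_simps[OF linear] sum_distrib_left)
qed

lemma functional_transformed:
  assumes "scalar_linear \<phi>"
  shows "\<phi> (transformed j) = (\<Sum>r<2 ^ block_index j. W (block_index j) r (block_offset j) *\<^sub>R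
    \<phi> (G (block_start (block_index j) + r)))"
  by (simp add: transformed_def scalar_linear_simps[OF assms])

lemma transformed_dual_transformed: "transformed_dual i (transformed j) = of_bool (j = i)"
proof (cases i rule: block_cases)
  case i: (1 k n)
  show ?thesis
  proof (cases j rule: block_cases)
    case j: (1 l m)
    have Gs: "Gs (block_start k + r) (transformed j) = (if k = l then W k r m *\<^sub>R 1 else 0)"
      if "r < 2 ^ k" for r
    proof -
      have "Gs (block_start k + r) (transformed j)
          = (\<Sum>s<2 ^ l. W l s m *\<^sub>R of_bool (block_start l + s = block_start k + r))"
        using j by (simp add: functional_transformed[OF linear] biorthogonal)
      also have "\<dots> = (\<Sum>s<2 ^ l. if s = r then if k = l then W k r m *\<^sub>R 1 else 0 else 0)"
        using that by (intro sum.cong) (auto simp: block_start_add_inj)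
      also have "\<dots> = (if k = l then W k r m *\<^sub>R 1 else 0)"
        using that by auto
      finally show ?thesis .
    qed
    have "transformed_dual i (transformed j) = (if k = l then (\<Sum>r<2 ^ k. W' k r n * W k r m) *\<^sub>R 1 else 0)"
      unfolding i(1) transformed_dual_block[OF i(2)]
      by (simp add: Gs scaleR_sum_left)
    then show ?thesis
      using i j by (auto simp: inverse_columns block_start_add_inj)
  qed
qed

lemma sum_transformed:
  assumes "m \<le> 2 ^ k"
  shows "(\<Sum>n<m. sc (c n) (transformed (block_start k + n)))
    = (\<Sum>r<2 ^ k. sc (\<Sum>n<m. W k r n *\<^sub>R c n) (G (block_start k + r)))"
proof -
  have "(\<Sum>n<m. sc (c n) (transformed (block_start k + n)))
      = (\<Sum>n<m. \<Sum>r<2 ^ k. sc (W k r n *\<^sub>R c n) (G (block_start k + r)))"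
    using assms by (intro sum.cong) (auto simp: transformed_block sc.sum_right sc.scaleR_left sc.scaleR_right)
  also have "\<dots> = (\<Sum>r<2 ^ k. sc (\<Sum>n<m. W k r n *\<^sub>R c n) (G (block_start k + r)))"
    by (subst sum.swap) (simp add: sc.sum_left)
  finally show ?thesis .
qed

lemma sum_transformed_dual:
  assumes "m \<le> 2 ^ k"
  shows "(\<Sum>n<m. sc (transformed_dual (block_start k + n) f) (transformed (block_start k + n)))
    = (\<Sum>r<2 ^ k. sc (\<Sum>n<m. W k r n *\<^sub>R (\<Sum>s<2 ^ k. W' k s n *\<^sub>R Gs (block_start k + s) f))
        (G (block_start k + r)))"
proof -
  have "(\<Sum>n<m. sc (transformed_dual (block_start k + n) f) (transformed (block_start k + n)))
      = (\<Sum>n<m. sc (\<Sum>s<2 ^ k. W' k s n *\<^sub>R Gs (block_start k + s) f) (transformed (block_start k + n)))"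
    using assms by (intro sum.cong) (auto simp: transformed_dual_block)
  then show ?thesis using sum_transformed[OF assms] by simp
qed

lemma norm_partial_block_le:
  assumes "m \<le> 2 ^ k"
  shows "norm (\<Sum>n<m. sc (transformed_dual (block_start k + n) f) (transformed (block_start k + n)))
    \<le> K * (C * L2_set (\<lambda>r. norm (Gs (block_start k + r) f)) {..<2 ^ k})"
  unfolding sum_transformed_dual[OF assms]
  by (rule order_trans[OF synthesis]) (intro mult_left_mono truncation assms K_nonneg)

text \<open>\<open>W\<close> and \<open>W'\<close> invert each other on the block, so old and new
  expansions agree at the end of every block.\<close>

lemma sum_full_block:
  "(\<Sum>n<2 ^ k. sc (transformed_dual (block_start k + n) f) (transformed (block_start k + n)))
    = (\<Sum>r<2 ^ k. sc (Gs (block_start k + r) f) (G (block_start k + r)))"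
proof -
  have "(\<Sum>n<2 ^ k. W k r n *\<^sub>R (\<Sum>s<2 ^ k. W' k s n *\<^sub>R c s)) = c r" if "r < 2 ^ k"
    for r and c :: "nat \<Rightarrow> 'k"
  proof -
    have "(\<Sum>n<2 ^ k. W k r n *\<^sub>R (\<Sum>s<2 ^ k. W' k s n *\<^sub>R c s))
        = (\<Sum>s<2 ^ k. (\<Sum>n<2 ^ k. W k r n * W' k s n) *\<^sub>R c s)"
      unfolding scaleR_sum_right scaleR_sum_left scaleR_scaleR by (rule sum.swap)
    also have "\<dots> = (\<Sum>s<2 ^ k. if r = s then c s else 0)"
      using that by (intro sum.cong) (auto simp: inverse_rows)
    finally show ?thesis using that by simp
  qed
  then show ?thesis by (simp add: sum_transformed_dual)
qed

lemma sum_full_blocks: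
  "(\<Sum>j<block_start k. sc (transformed_dual j f) (transformed j)) = (\<Sum>j<block_start k. sc (Gs j f) (G j))"
  unfolding sum_block_start sum_full_block ..

text \<open>A partial sum consists of full blocks, which converge by \<open>lim\<close>, and a piece
  of one block, which the truncation bound compares with the coefficients of that block; these tend
  to 0 by \<open>small\<close>.\<close>

lemma transformed_sums:
  assumes lim: "(\<lambda>k. \<Sum>j<block_start k. sc (Gs j f) (G j)) \<longlonglongrightarrow> L"
    and small: "(\<lambda>k. L2_set (\<lambda>r. norm (Gs (block_start k + r) f)) {..<2 ^ k}) \<longlonglongrightarrow> 0"
  shows "(\<lambda>j. sc (transformed_dual j f) (transformed j)) sums L"
  unfolding sums_def
proof -
  define s where "s m = (\<Sum>j<m. sc (transformed_dual j f) (transformed j))" for m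
  define t where "t m = (\<Sum>n<block_offset m. sc (transformed_dual (block_start (block_index m) + n) f)
    (transformed (block_start (block_index m) + n)))" for m
  have s: "s m = s (block_start (block_index m)) + t m" for m
    using sum_blocks[of "\<lambda>j. sc (transformed_dual j f) (transformed j)" "block_index m" "block_offset m"]
    by (simp add: s_def t_def flip: block_decomp)
  have 1: "(\<lambda>m. s (block_start (block_index m))) \<longlonglongrightarrow> L"
    using filterlim_compose[OF lim filterlim_block_index] by (simp add: s_def sum_full_blocks)
  have 2: "t \<longlonglongrightarrow> 0"
  proof (rule Lim_null_comparison)
    show "\<forall>\<^sub>F m in sequentially. norm (t m) \<le>
        K * (C * L2_set (\<lambda>r. norm (Gs (block_start (block_index m) + r) f)) {..<2 ^ block_index m})"
      unfolding t_def using block_offset_less by (intro always_eventually allI norm_partial_block_le) (simp add: less_imp_le)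
    have "(\<lambda>m. K * (C * L2_set (\<lambda>r. norm (Gs (block_start (block_index m) + r) f)) {..<2 ^ block_index m}))
        \<longlonglongrightarrow> K * (C * 0)"
      by (intro tendsto_mult tendsto_const filterlim_compose[OF small filterlim_block_index])
    then show "(\<lambda>m. K * (C * L2_set (\<lambda>r. norm (Gs (block_start (block_index m) + r) f)) {..<2 ^ block_index m}))
        \<longlonglongrightarrow> 0" by simp
  qed
  show "(\<lambda>m. \<Sum>j<m. sc (transformed_dual j f) (transformed j)) \<longlonglongrightarrow> L"
    using tendsto_add[OF 1 2] by (simp add: s[symmetric] s_def[symmetric])
qed

lemma norm_transformed_le:
  assumes "\<And>k n. n < 2 ^ k \<Longrightarrow> L2_set (\<lambda>r. W k r n) {..<2 ^ k} \<le> B"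
  shows "norm (transformed j) \<le> K * B"
proof (cases j rule: block_cases)
  case (1 k n)
  have "norm (\<Sum>r<2 ^ k. sc (of_real (W k r n)) (G (block_start k + r)))
      \<le> K * L2_set (\<lambda>r. norm (of_real (W k r n) :: 'k)) {..<2 ^ k}"
    by (rule synthesis)
  also have "L2_set (\<lambda>r. norm (of_real (W k r n) :: 'k)) {..<2 ^ k} = L2_set (\<lambda>r. W k r n) {..<2 ^ k}"
    by (simp add: L2_set_def)
  also have "K * \<dots> \<le> K * B"
    by (intro mult_left_mono assms 1 K_nonneg)
  finally show ?thesis using 1 by (simp add: transformed_block scale_of_real)
qed

lemma norm_transformed_dual_le:
  assumes "\<And>k n. n < 2 ^ k \<Longrightarrow> L2_set (\<lambda>r. W' k r n) {..<2 ^ k} \<le> B"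
    and "\<And>k. L2_set (\<lambda>r. norm (Gs (block_start k + r) f)) {..<2 ^ k} \<le> D"
  shows "norm (transformed_dual j f) \<le> B * D"
proof (cases j rule: block_cases)
  case (1 k n)
  have B: "0 \<le> B" using assms(1)[OF 1(2)] L2_set_nonneg order_trans by blast
  have "norm (transformed_dual j f) \<le> (\<Sum>r<2 ^ k. \<bar>W' k r n\<bar> * \<bar>norm (Gs (block_start k + r) f)\<bar>)"
    unfolding 1(1) transformed_dual_block[OF 1(2)] by (rule order_trans[OF norm_sum]) simp
  also have "\<dots> \<le> L2_set (\<lambda>r. W' k r n) {..<2 ^ k} * L2_set (\<lambda>r. norm (Gs (block_start k + r) f)) {..<2 ^ k}"
    by (rule L2_set_mult_ineq)
  also have "\<dots> \<le> B * D"
    by (intro mult_mono assms 1 B L2_set_nonneg)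
  finally show ?thesis .
qed

end

context euclidean_banach_space_over
begin

text \<open>The square sum over a block is a difference of partial sums of a convergent series at
  consecutive block starts.\<close>

lemma l2_system_block_tendsto_0:
  assumes l2: "l2_system K g gs"
  shows "(\<lambda>k. L2_set (\<lambda>r. norm (gs (block_start k + r) f)) {..<2 ^ k}) \<longlonglongrightarrow> 0"
proof -
  define a where "a j = (norm (gs j f))\<^sup>2" for j
  have K: "0 \<le> K" by (rule l2_systemD(1)[OF l2])
  have "summable a"
  proof (rule bounded_imp_summable)
    show "(\<Sum>j\<le>n. a j) \<le> (K * norm f)\<^sup>2" for n
      using l2_systemD(5)[OF l2, of "{..n}" f] K unfolding a_def
      by (intro sqrt_le_D) (simp add: L2_set_def)
  qed (simp add: a_def)
  then have lim: "(\<lambda>n. \<Sum>j<n. a j) \<longlonglongrightarrow> suminf a"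
    using summable_LIMSEQ by blast
  have "(\<lambda>k. (\<Sum>j<block_start (Suc k). a j) - (\<Sum>j<block_start k. a j)) \<longlonglongrightarrow> suminf a - suminf a"
    by (intro tendsto_diff filterlim_compose[OF lim] filterlim_block_start
        filterlim_compose[OF filterlim_block_start filterlim_Suc])
  then have "(\<lambda>k. \<Sum>n<2 ^ k. a (block_start k + n)) \<longlonglongrightarrow> 0"
    by (simp add: block_start_Suc sum_blocks)
  then have "(\<lambda>k. sqrt (\<Sum>n<2 ^ k. a (block_start k + n))) \<longlonglongrightarrow> sqrt 0"
    by (rule tendsto_real_sqrt)
  then show ?thesis by (simp add: L2_set_def a_def)
qed

lemma l2_system_block_le:
  assumes l2: "l2_system K g gs"
  shows "L2_set (\<lambda>r. norm (gs (block_start k + r) f)) {..<2 ^ k} \<le> K * norm f"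
    and "norm (\<Sum>r<2 ^ k. sc (c r) (g (block_start k + r))) \<le> K * L2_set (\<lambda>r. norm (c r)) {..<2 ^ k}"
proof -
  have "l2_system K (\<lambda>r. g (block_start k + r)) (\<lambda>r. gs (block_start k + r))"
    by (rule l2_system_subfamily[OF l2]) (simp add: inj_def)
  from l2_systemD(4,5)[OF this, of "{..<2 ^ k}"]
  show "L2_set (\<lambda>r. norm (gs (block_start k + r) f)) {..<2 ^ k} \<le> K * norm f"
    "norm (\<Sum>r<2 ^ k. sc (c r) (g (block_start k + r))) \<le> K * L2_set (\<lambda>r. norm (c r)) {..<2 ^ k}"
    by simp_all
qed

lemma l2_block_transform:
  assumes l2: "l2_system K g gs"
    and "\<And>k n m. n < 2 ^ k \<Longrightarrow> m < 2 ^ k \<Longrightarrow> (\<Sum>r<2 ^ k. W' k r n * W k r m) = of_bool (n = m)"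
    and "\<And>k r s. r < 2 ^ k \<Longrightarrow> s < 2 ^ k \<Longrightarrow> (\<Sum>n<2 ^ k. W k r n * W' k s n) = of_bool (r = s)"
    and "\<And>k m (c :: nat \<Rightarrow> 'k). m \<le> 2 ^ k \<Longrightarrow>
      L2_set (\<lambda>r. norm (\<Sum>n<m. W k r n *\<^sub>R (\<Sum>s<2 ^ k. W' k s n *\<^sub>R c s))) {..<2 ^ k}
        \<le> C * L2_set (\<lambda>s. norm (c s)) {..<2 ^ k}"
  shows "block_transform sc g gs W W' K C"
  by unfold_locales (use assms l2_systemD[OF l2] l2_system_block_le[OF l2] in auto)

lemma l2_block_transform_sums:
  assumes l2: "l2_system K g gs" and W: "block_transform sc g gs W W' K C"
  shows "(\<lambda>j. sc (block_transform.transformed_dual gs W' j f) (block_transform.transformed g W j))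
    sums l2_map g gs f"
proof -
  interpret W: block_transform sc g gs W W' K C by (rule W)
  show ?thesis
  proof (rule W.transformed_sums[OF _ l2_system_block_tendsto_0[OF l2]])
    show "(\<lambda>k. \<Sum>j<block_start k. sc (gs j f) (g j)) \<longlonglongrightarrow> l2_map g gs f"
      using filterlim_compose[OF l2_map_sums(1)[OF l2 l2, unfolded sums_def] filterlim_block_start] .
  qed
qed

end

section \<open>Construction of the basis\<close>

lemma sum_lessThan_triple:
  fixes f :: "nat \<Rightarrow> 'a::comm_monoid_add"
  shows "(\<Sum>i<3 * M. f i) = (\<Sum>q<M. f (3 * q) + f (3 * q + 1) + f (3 * q + 2))"
proof (induction M)
  case (Suc M)
  have "3 * Suc M = Suc (Suc (Suc (3 * M)))" by simp
  then have "(\<Sum>i<3 * Suc M. f i) = (\<Sum>i<3 * M. f i) + f (3 * M) + f (3 * M + 1) + f (3 * M + 2)"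
    unfolding \<open>3 * Suc M = _\<close> by simp
  then show ?case using Suc.IH by (simp add: add.assoc)
qed simp

lemma tendsto_triple:
  fixes s :: "nat \<Rightarrow> 'a::metric_space"
  assumes "(\<lambda>n. s (3 * n)) \<longlonglongrightarrow> l" "(\<lambda>n. s (3 * n + 1)) \<longlonglongrightarrow> l" "(\<lambda>n. s (3 * n + 2)) \<longlonglongrightarrow> l"
  shows "s \<longlonglongrightarrow> l"
proof (rule metric_LIMSEQ_I)
  fix r :: real assume r: "0 < r"
  obtain N0 N1 N2 where N: "\<And>n. n \<ge> N0 \<Longrightarrow> dist (s (3 * n)) l < r"
    "\<And>n. n \<ge> N1 \<Longrightarrow> dist (s (3 * n + 1)) l < r" "\<And>n. n \<ge> N2 \<Longrightarrow> dist (s (3 * n + 2)) l < r"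
    using assms[THEN metric_LIMSEQ_D, OF r] by blast
  show "\<exists>no. \<forall>n\<ge>no. dist (s n) l < r"
  proof (intro exI[of _ "3 * (N0 + N1 + N2)"] allI impI)
    fix n assume n: "3 * (N0 + N1 + N2) \<le> n"
    define q where "q = n div 3"
    have q: "N0 + N1 + N2 \<le> q" using div_le_mono[OF n, of 3] by (simp add: q_def)
    have "n = 3 * q \<or> n = 3 * q + 1 \<or> n = 3 * q + 2" unfolding q_def by linarith
    then show "dist (s n) l < r" using N q by auto
  qed
qed

text \<open>Two of the three subsequences are only known to be summable jointly, so the cut between
  them needs a null term.\<close>

lemma sums_interleave3:
  fixes t :: "nat \<Rightarrow> 'a::real_normed_vector"
  assumes a: "(\<lambda>n. t (3 * n)) sums a" and b: "(\<lambda>n. t (3 * n + 1) + t (3 * n + 2)) sums b"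
    and t: "(\<lambda>n. t (3 * n + 1)) \<longlonglongrightarrow> 0"
  shows "t sums (a + b)"
  unfolding sums_def
proof (rule tendsto_triple)
  have "(\<lambda>n. t (3 * n) + (t (3 * n + 1) + t (3 * n + 2))) sums (a + b)"
    by (rule sums_add[OF a b])
  then show 0: "(\<lambda>n. \<Sum>i<3 * n. t i) \<longlonglongrightarrow> a + b"
    unfolding sum_lessThan_triple by (simp add: sums_def add.assoc)
  have a0: "(\<lambda>n. t (3 * n)) \<longlonglongrightarrow> 0"
    using a by (intro summable_LIMSEQ_zero) (rule sums_summable)
  show 1: "(\<lambda>n. \<Sum>i<3 * n + 1. t i) \<longlonglongrightarrow> a + b"
    using tendsto_add[OF 0 a0] by simp
  show "(\<lambda>n. \<Sum>i<3 * n + 2. t i) \<longlonglongrightarrow> a + b"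
    using tendsto_add[OF 1 t] by simp
qed

text \<open>This is the output of \<open>basis_l2_decomposition\<close>: the space as the direct sum
  of the span of a basic sequence \<open>e\<close> and a copy of l2.\<close>

locale basis_with_l2 = euclidean_banach_space_over sc + haar_weights \<theta>
  for sc :: "'k::{real_normed_field,euclidean_space} \<Rightarrow> 'x::banach \<Rightarrow> 'x" and \<theta> :: real +
  fixes K :: real and e g :: "nat \<Rightarrow> 'x" and es gs :: "nat \<Rightarrow> 'x \<Rightarrow> 'k"
  assumes l2: "l2_system K g gs"
    and es_linear: "scalar_linear (es n)"
    and es_e: "es n (e m) = of_bool (m = n)"
    and es_g: "es n (g m) = 0"
    and gs_e: "gs n (e m) = 0"
    and e_bound: "norm (e n) \<le> K"
    and es_bound: "norm (es n f) \<le> K * norm f"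
    and expansion: "\<exists>L. (\<lambda>n. sc (es n f) (e n)) sums L \<and> f = L + l2_map g gs f"
begin

section \<open>The conditional sequence \<open>y\<close>\<close>

lemma K_nonneg: "0 \<le> K" and gs_linear: "scalar_linear (gs n)"
  and gs_g: "gs n (g m) = of_bool (m = n)"
  using l2_systemD[OF l2] by auto

lemma K_ge_1: "1 \<le> K"
proof -
  have "1 \<le> K * norm (g 0)"
    using l2_system_bounds(2)[OF l2, of 0 "g 0"] by (simp add: gs_g)
  also have "\<dots> \<le> K * K"
    by (intro mult_left_mono l2_system_bounds(1)[OF l2] K_nonneg)
  finally have "1 \<le> K * K" .
  then show ?thesis
    using mult_right_mono[of K 1 K] K_nonneg by (cases "K \<le> 1") auto
qed

text \<open>
  The vectors \<open>g (block_start k)\<close> are set aside. Split into two sequences, they are turned by the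
  weighted Haar matrices into a sequence \<open>x\<close> and a dual copy \<open>z\<close> of it.
\<close>

definition u :: "nat \<Rightarrow> 'x" where "u n = g (block_start (2 * n))"
definition us :: "nat \<Rightarrow> 'x \<Rightarrow> 'k" where "us n = gs (block_start (2 * n))"
definition v :: "nat \<Rightarrow> 'x" where "v n = g (block_start (2 * n + 1))"
definition vs :: "nat \<Rightarrow> 'x \<Rightarrow> 'k" where "vs n = gs (block_start (2 * n + 1))"

lemma l2_lead: "l2_system K (\<lambda>n. g (block_start n)) (\<lambda>n. gs (block_start n))"
  by (rule l2_system_subfamily[OF l2]) (simp add: inj_def block_start_inj)

lemma l2_u: "l2_system K u us"
  unfolding u_def[abs_def] us_def[abs_def]
  by (rule l2_system_subfamily[OF l2_lead, of "\<lambda>n. 2 * n"]) (simp add: inj_def)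

lemma l2_v: "l2_system K v vs"
  unfolding v_def[abs_def] vs_def[abs_def]
  by (rule l2_system_subfamily[OF l2_lead, of "\<lambda>n. 2 * n + 1"]) (simp add: inj_def)

text \<open>One witness is fixed by choice so that it can serve as a parameter of the
  interpretations of \<open>block_transform\<close>.\<close>

definition trunc_const :: real where
  "trunc_const = (SOME C. 0 \<le> C \<and> (\<forall>k m (c :: nat \<Rightarrow> 'k). m \<le> 2 ^ k \<longrightarrow>
     L2_set (\<lambda>r. norm (\<Sum>n<m. heavy_haar k r n *\<^sub>R (\<Sum>s<2 ^ k. light_haar k s n *\<^sub>R c s))) {..<2 ^ k}
       \<le> C * L2_set (\<lambda>s. norm (c s)) {..<2 ^ k} \<and>
     L2_set (\<lambda>r. norm (\<Sum>n<m. light_haar k r n *\<^sub>R (\<Sum>s<2 ^ k. heavy_haar k s n *\<^sub>R c s))) {..<2 ^ k}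
       \<le> C * L2_set (\<lambda>s. norm (c s)) {..<2 ^ k}))"

lemma trunc_const:
  fixes c :: "nat \<Rightarrow> 'k"
  assumes "m \<le> 2 ^ k"
  shows "L2_set (\<lambda>r. norm (\<Sum>n<m. heavy_haar k r n *\<^sub>R (\<Sum>s<2 ^ k. light_haar k s n *\<^sub>R c s))) {..<2 ^ k}
       \<le> trunc_const * L2_set (\<lambda>s. norm (c s)) {..<2 ^ k}"
    and "L2_set (\<lambda>r. norm (\<Sum>n<m. light_haar k r n *\<^sub>R (\<Sum>s<2 ^ k. heavy_haar k s n *\<^sub>R c s))) {..<2 ^ k}
       \<le> trunc_const * L2_set (\<lambda>s. norm (c s)) {..<2 ^ k}"
  using someI_ex[OF weighted_haar_truncation_bounded[where ?'a = 'k], folded trunc_const_def] assms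
  by blast+

lemma transform_u: "block_transform sc u us heavy_haar light_haar K trunc_const"
  by (rule l2_block_transform[OF l2_u heavy_light_columns(1) heavy_light_rows(1) trunc_const(1)])

lemma transform_v: "block_transform sc v vs light_haar heavy_haar K trunc_const"
  by (rule l2_block_transform[OF l2_v heavy_light_columns(2) heavy_light_rows(2) trunc_const(2)])

interpretation X: block_transform sc u us heavy_haar light_haar K trunc_const
  by (rule transform_u)

interpretation Z: block_transform sc v vs light_haar heavy_haar K trunc_const
  by (rule transform_v)

abbreviation "x \<equiv> X.transformed"
abbreviation "xs \<equiv> X.transformed_dual"
abbreviation "z \<equiv> Z.transformed"
abbreviation "zs \<equiv> Z.transformed_dual"

definition y :: "nat \<Rightarrow> 'x" where
  "y j = (if j mod 3 = 0 then e (j div 3)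
     else if j mod 3 = 1 then x (j div 3) + z (j div 3) else x (j div 3) - z (j div 3))"

definition ys :: "nat \<Rightarrow> 'x \<Rightarrow> 'k" where
  "ys j f = (if j mod 3 = 0 then es (j div 3) f
     else if j mod 3 = 1 then (1/2) *\<^sub>R (xs (j div 3) f + zs (j div 3) f)
     else (1/2) *\<^sub>R (xs (j div 3) f - zs (j div 3) f))"

lemmas xs_linear = X.scalar_linear_transformed_dual
lemmas zs_linear = Z.scalar_linear_transformed_dual

lemma functional_xz_eq_0:
  assumes "scalar_linear \<phi>"
  shows "(\<And>n. \<phi> (u n) = 0) \<Longrightarrow> \<phi> (x j) = 0" "(\<And>n. \<phi> (v n) = 0) \<Longrightarrow> \<phi> (z j) = 0"
  by (simp_all add: X.functional_transformed[OF assms] Z.functional_transformed[OF assms])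

lemma xs_zs_eq_0:
  shows "(\<And>n. us n f = 0) \<Longrightarrow> xs j f = 0" "(\<And>n. vs n f = 0) \<Longrightarrow> zs j f = 0"
  by (simp_all add: X.transformed_dual_def Z.transformed_dual_def)

lemma us_vs_cross: "us n (v m) = 0" "vs n (u m) = 0"
proof -
  have "2 * m + 1 \<noteq> 2 * n" "2 * m \<noteq> 2 * n + 1" by presburger+
  then show "us n (v m) = 0" "vs n (u m) = 0"
    unfolding u_def us_def v_def vs_def gs_g block_start_inj by simp_all
qed

lemma cross_vanishing:
  shows "es n (x m) = 0" "es n (z m) = 0" "xs n (e m) = 0" "zs n (e m) = 0"
    "xs n (z m) = 0" "zs n (x m) = 0"
proof -
  show "es n (x m) = 0" "es n (z m) = 0"
    by (rule functional_xz_eq_0[OF es_linear]; simp add: u_def v_def es_g)+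
  show "xs n (e m) = 0" "zs n (e m) = 0"
    by (rule xs_zs_eq_0; simp add: us_def vs_def gs_e)+
  show "xs n (z m) = 0"
    by (rule functional_xz_eq_0(2)[OF xs_linear], rule xs_zs_eq_0) (rule us_vs_cross)
  show "zs n (x m) = 0"
    by (rule functional_xz_eq_0(1)[OF zs_linear], rule xs_zs_eq_0) (rule us_vs_cross)
qed

lemma mod_3_cases:
  fixes j :: nat
  obtains "j mod 3 = 0" | "j mod 3 = 1" | "j mod 3 = 2"
  by linarith

lemma ys_linear: "scalar_linear (ys j)"
proof -
  have half: "scalar_linear (\<lambda>f. (1/2) *\<^sub>R (\<phi> f + \<psi> f))" "scalar_linear (\<lambda>f. (1/2) *\<^sub>R (\<phi> f - \<psi> f))"
    if "scalar_linear \<phi>" "scalar_linear \<psi>" for \<phi> \<psi>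
    using that unfolding scalar_linear_def
    by (auto intro!: bounded_linear_scaleR_right[THEN bounded_linear_compose] bounded_linear_add bounded_linear_sub
        simp: distrib_left right_diff_distrib scaleR_add_right scaleR_diff_right)
  show ?thesis
    by (cases j rule: mod_3_cases)
       (simp_all add: ys_def[abs_def] es_linear half xs_linear zs_linear)
qed

lemma ys_y: "ys n (y m) = of_bool (m = n)"
proof -
  have "m = n \<longleftrightarrow> m mod 3 = n mod 3 \<and> m div 3 = n div 3"
    by (metis div_mult_mod_eq)
  then show ?thesis
    by (cases m rule: mod_3_cases; cases n rule: mod_3_cases)
       (simp_all add: y_def ys_def es_e cross_vanishing scalar_linear_simps[OF es_linear]
          scalar_linear_simps[OF xs_linear] scalar_linear_simps[OF zs_linear]
          X.transformed_dual_transformed Z.transformed_dual_transformed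
          scaleR_2[symmetric] flip: scaleR_add_left)
qed

lemma not_lead:
  assumes "block_offset j \<noteq> 0"
  shows "us n (g j) = 0" "vs n (g j) = 0" "gs j (u n) = 0" "gs j (v n) = 0"
proof -
  have "block_start k \<noteq> j" for k
    using assms block_offset_eq[of 0 k] by auto
  then show "us n (g j) = 0" "vs n (g j) = 0" "gs j (u n) = 0" "gs j (v n) = 0"
    unfolding u_def us_def v_def vs_def gs_g by (auto simp: eq_commute)
qed

lemma ys_g: "block_offset j \<noteq> 0 \<Longrightarrow> ys n (g j) = 0"
  unfolding ys_def by (simp add: es_g xs_zs_eq_0 not_lead)

lemma gs_y: "block_offset j \<noteq> 0 \<Longrightarrow> gs j (y n) = 0"
  unfolding y_def
  by (simp add: gs_e functional_xz_eq_0[OF gs_linear] not_lead scalar_linear_simps[OF gs_linear])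

definition col_bound :: real where
  "col_bound = max 1 (sqrt (2 / (1 - \<theta>)))"

definition y_bound :: real where
  "y_bound = 2 * (K * col_bound)"

lemma col_bound: "1 \<le> col_bound" "n < 2 ^ k \<Longrightarrow> L2_set (\<lambda>r. heavy_haar k r n) {..<2 ^ k} \<le> col_bound"
  "n < 2 ^ k \<Longrightarrow> L2_set (\<lambda>r. light_haar k r n) {..<2 ^ k} \<le> col_bound"
  unfolding col_bound_def using heavy_column_le light_column_le by (force intro: max.coboundedI1 max.coboundedI2)+

lemma K_le_y_bound: "K \<le> y_bound" "K * col_bound \<le> y_bound"
  using mult_left_mono[OF col_bound(1) K_nonneg] K_nonneg by (simp_all add: y_bound_def)

lemma xz_bounds:
  "norm (x j) \<le> K * col_bound" "norm (z j) \<le> K * col_bound"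
  "norm (xs j f) \<le> K * col_bound * norm f" "norm (zs j f) \<le> K * col_bound * norm f"
proof -
  show "norm (x j) \<le> K * col_bound" "norm (z j) \<le> K * col_bound"
    using X.norm_transformed_le[OF col_bound(2)] Z.norm_transformed_le[OF col_bound(3)] by blast+
  show "norm (xs j f) \<le> K * col_bound * norm f"
    using X.norm_transformed_dual_le[OF col_bound(3) l2_system_block_le(1)[OF l2_u], of j f]
    by (simp add: mult_ac)
  show "norm (zs j f) \<le> K * col_bound * norm f"
    using Z.norm_transformed_dual_le[OF col_bound(2) l2_system_block_le(1)[OF l2_v], of j f]
    by (simp add: mult_ac)
qed

lemma y_norm_le: "norm (y j) \<le> y_bound"
proof -
  have "norm (x i + z i) \<le> y_bound" "norm (x i - z i) \<le> y_bound" for i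
    using xz_bounds(1,2)[of i] norm_triangle_ineq[of "x i" "z i"] norm_triangle_ineq4[of "x i" "z i"]
    unfolding y_bound_def by linarith+
  then show ?thesis
    unfolding y_def using order_trans[OF e_bound K_le_y_bound(1)] by simp
qed

lemma ys_norm_le: "norm (ys j f) \<le> y_bound * norm f"
proof -
  have "norm ((1/2) *\<^sub>R (xs i f + zs i f)) \<le> K * col_bound * norm f"
    "norm ((1/2) *\<^sub>R (xs i f - zs i f)) \<le> K * col_bound * norm f" for i
    using xz_bounds(3,4)[of i f] norm_triangle_ineq[of "xs i f" "zs i f"] norm_triangle_ineq4[of "xs i f" "zs i f"]
    by simp_all
  moreover have "K * col_bound * norm f \<le> y_bound * norm f" "K * norm f \<le> y_bound * norm f"
    by (intro mult_right_mono K_le_y_bound norm_ge_zero)+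
  ultimately have "norm ((1/2) *\<^sub>R (xs i f + zs i f)) \<le> y_bound * norm f"
    "norm ((1/2) *\<^sub>R (xs i f - zs i f)) \<le> y_bound * norm f"
    "norm (es i f) \<le> y_bound * norm f" for i
    using order_trans es_bound by blast+
  then show ?thesis
    unfolding ys_def by (simp only: split: if_split) blast
qed

text \<open>The terms for \<open>x n + z n\<close> and \<open>x n - z n\<close> add up to the
  \<open>n\<close>-th terms of the expansions along \<open>x\<close> and \<open>z\<close>, which
  converge as block transforms.\<close>

lemma y_sums:
  assumes "(\<lambda>n. sc (es n f) (e n)) sums L"
  shows "(\<lambda>j. sc (ys j f) (y j)) sums (L + (l2_map u us f + l2_map v vs f))"
proof (rule sums_interleave3)
  show "(\<lambda>n. sc (ys (3 * n) f) (y (3 * n))) sums L"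
    using assms by (simp add: y_def ys_def)
  have y1: "y (3 * n + 1) = x n + z n" "ys (3 * n + 1) f = (1/2) *\<^sub>R (xs n f + zs n f)"
    and y2: "y (3 * n + 2) = x n - z n" "ys (3 * n + 2) f = (1/2) *\<^sub>R (xs n f - zs n f)" for n
  proof -
    have "(3 * n + 1) mod 3 = 1" "(3 * n + 1) div 3 = n" "(3 * n + 2) mod 3 = 2" "(3 * n + 2) div 3 = n"
      by presburger+
    then show "y (3 * n + 1) = x n + z n" "ys (3 * n + 1) f = (1/2) *\<^sub>R (xs n f + zs n f)"
      "y (3 * n + 2) = x n - z n" "ys (3 * n + 2) f = (1/2) *\<^sub>R (xs n f - zs n f)"
      unfolding y_def ys_def by simp_all
  qed
  have xsum: "(\<lambda>n. sc (xs n f) (x n)) sums l2_map u us f"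
    by (rule l2_block_transform_sums[OF l2_u transform_u])
  have zsum: "(\<lambda>n. sc (zs n f) (z n)) sums l2_map v vs f"
    by (rule l2_block_transform_sums[OF l2_v transform_v])
  have "sc ((1/2) *\<^sub>R (p + q)) (s + t) + sc ((1/2) *\<^sub>R (p - q)) (s - t) = sc p s + sc q t" for p q s t
  proof -
    have "sc ((1/2) *\<^sub>R (p + q)) (s + t) + sc ((1/2) *\<^sub>R (p - q)) (s - t)
        = (1/2) *\<^sub>R (2 *\<^sub>R (sc p s + sc q t))"
      unfolding sc.scaleR_left scaleR_2
      by (simp add: sc.add_left sc.diff_left sc.add_right sc.diff_right flip: scaleR_add_right)
    then show ?thesis by simp
  qed
  then show "(\<lambda>n. sc (ys (3 * n + 1) f) (y (3 * n + 1)) + sc (ys (3 * n + 2) f) (y (3 * n + 2)))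
      sums (l2_map u us f + l2_map v vs f)"
    using sums_add[OF xsum zsum] unfolding y1 y2 by simp
  have D: "0 \<le> K * col_bound" using K_nonneg col_bound(1) by simp
  \<comment> \<open>Terms of a convergent series tend to 0, and \<open>xs n\<close> recovers the
    coefficient from its term with a uniform bound.\<close>
  have xs0: "(\<lambda>n. xs n f) \<longlonglongrightarrow> 0"
  proof (rule Lim_null_comparison)
    show "\<forall>\<^sub>F n in sequentially. norm (xs n f) \<le> K * col_bound * norm (sc (xs n f) (x n))"
    proof (intro always_eventually allI)
      fix n
      have "xs n (sc (xs n f) (x n)) = xs n f"
        by (simp add: scalar_linear_simps[OF xs_linear] X.transformed_dual_transformed)
      then show "norm (xs n f) \<le> K * col_bound * norm (sc (xs n f) (x n))"
        using xz_bounds(3)[of n "sc (xs n f) (x n)"] by simp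
    qed
    show "(\<lambda>n. K * col_bound * norm (sc (xs n f) (x n))) \<longlonglongrightarrow> 0"
      by (intro tendsto_mult_right_zero tendsto_norm_zero summable_LIMSEQ_zero sums_summable[OF xsum])
  qed
  have zs0: "(\<lambda>n. zs n f) \<longlonglongrightarrow> 0"
  proof (rule Lim_null_comparison)
    show "\<forall>\<^sub>F n in sequentially. norm (zs n f) \<le> K * col_bound * norm (sc (zs n f) (z n))"
    proof (intro always_eventually allI)
      fix n
      have "zs n (sc (zs n f) (z n)) = zs n f"
        by (simp add: scalar_linear_simps[OF zs_linear] Z.transformed_dual_transformed)
      then show "norm (zs n f) \<le> K * col_bound * norm (sc (zs n f) (z n))"
        using xz_bounds(4)[of n "sc (zs n f) (z n)"] by simp
    qed
    show "(\<lambda>n. K * col_bound * norm (sc (zs n f) (z n))) \<longlonglongrightarrow> 0"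
      by (intro tendsto_mult_right_zero tendsto_norm_zero summable_LIMSEQ_zero sums_summable[OF zsum])
  qed
  show "(\<lambda>n. sc (ys (3 * n + 1) f) (y (3 * n + 1))) \<longlonglongrightarrow> 0"
  proof (rule Lim_null_comparison)
    show "\<forall>\<^sub>F n in sequentially. norm (sc (ys (3 * n + 1) f) (y (3 * n + 1)))
        \<le> norm (ys (3 * n + 1) f) * y_bound"
      unfolding norm_scale by (intro always_eventually allI mult_left_mono y_norm_le norm_ge_zero)
    have "(\<lambda>n. norm ((1/2) *\<^sub>R (xs n f + zs n f)) * y_bound) \<longlonglongrightarrow> norm ((1/2) *\<^sub>R (0 + 0 :: 'k)) * y_bound"
      by (intro tendsto_intros xs0 zs0)
    then show "(\<lambda>n. norm (ys (3 * n + 1) f) * y_bound) \<longlonglongrightarrow> 0"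
      unfolding y1 by simp
  qed
qed

text \<open>With \<open>p = sqrt 2 ^ k\<close> and \<open>w * w = (2 * \<theta>) ^ k\<close>, the
  full sum has norm at most \<open>2 * p * K / w\<close> and the selected part at least
  \<open>p * w / K\<close>; their quotient is the stated factor.\<close>

lemma y_conditional:
  obtains A c where "A \<subseteq> {..<3 * block_start (Suc k)}" "(\<Sum>i<3 * block_start (Suc k). sc (c i) (y i)) \<noteq> 0"
    "(2 * \<theta>) ^ k / (2 * K\<^sup>2) * norm (\<Sum>i<3 * block_start (Suc k). sc (c i) (y i)) \<le> norm (\<Sum>i\<in>A. sc (c i) (y i))"
proof -
  define M where "M = block_start (Suc k)"
  \<comment> \<open>Signs \<open>1\<close> and \<open>-1\<close> on block \<open>k\<close> cancel
    \<open>x\<close> and leave \<open>2 * z\<close>; \<open>A\<close> keeps only the vectors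
    \<open>x + z\<close>. Three vectors \<open>y\<close> belong to each index of the block, hence
    the range \<open>3 * M\<close>.\<close>
  define c :: "nat \<Rightarrow> 'k" where "c i = (if block_index (i div 3) = k then
      if i mod 3 = 1 then 1 else if i mod 3 = 2 then - 1 else 0 else 0)" for i
  define A where "A = {i \<in> {..<3 * M}. i mod 3 = 1}"
  define p where "p = sqrt 2 ^ k"
  define w where "w = sqrt (2 * \<theta>) ^ k"
  have p: "0 < p" by (simp add: p_def)
  have w: "0 < w" using \<theta> by (simp add: w_def)
  have ww: "w * w = (2 * \<theta>) ^ k" 
    using \<theta> unfolding w_def power_mult_distrib[symmetric] by simp
  have block: "(\<Sum>q<M. if block_index q = k then h q else 0) = (\<Sum>n<2 ^ k. h (block_start k + n))"
    for h :: "nat \<Rightarrow> 'x"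
  proof -
    have "(\<Sum>q<block_start k. if block_index q = k then h q else 0) = 0"
      by (intro sum.neutral) (auto simp: less_block_start_iff)
    then show ?thesis
      unfolding M_def block_start_Suc sum_blocks by simp
  qed
  have div_mod: "(3 * q) mod 3 = 0" "(3 * q) div 3 = q" "(3 * q + 1) mod 3 = 1" "(3 * q + 1) div 3 = q"
    "(3 * q + 2) mod 3 = 2" "(3 * q + 2) div 3 = q" for q :: nat
    by presburger+
  have "(\<Sum>i<3 * M. sc (c i) (y i)) = (\<Sum>q<M. if block_index q = k then 2 *\<^sub>R z q else 0)"
    unfolding sum_lessThan_triple
    by (intro sum.cong) (simp_all only: c_def y_def div_mod, simp_all add: scaleR_2)
  also have "\<dots> = 2 *\<^sub>R (\<Sum>n<2 ^ k. sc 1 (z (block_start k + n)))"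
    unfolding block by (simp add: scaleR_sum_right)
  also have "(\<Sum>n<2 ^ k. sc 1 (z (block_start k + n)))
      = (\<Sum>r<2 ^ k. sc ((\<Sum>n<2 ^ k. light_haar k r n) *\<^sub>R 1) (v (block_start k + r)))"
    using Z.sum_transformed[of "2 ^ k" k "\<lambda>_. 1"] by (simp add: scaleR_sum_left)
  also have "\<dots> = (\<Sum>r<(2::nat) ^ k. if r = 0 then (p / w) *\<^sub>R v (block_start k) else 0)"
    by (intro sum.cong) (auto simp: sum_light_row p_def w_def sc.scaleR_left)
  also have "\<dots> = (p / w) *\<^sub>R v (block_start k)" by simp
  finally have F: "(\<Sum>i<3 * M. sc (c i) (y i)) = (2 * p / w) *\<^sub>R v (block_start k)" by simp
  have "(\<Sum>i\<in>A. sc (c i) (y i)) = (\<Sum>i<3 * M. if i mod 3 = 1 then sc (c i) (y i) else 0)"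
    unfolding A_def by (rule sum.inter_filter) simp
  also have "\<dots> = (\<Sum>q<M. if block_index q = k then x q + z q else 0)"
    unfolding sum_lessThan_triple
    by (intro sum.cong) (simp_all only: c_def y_def div_mod, simp_all)
  also have "\<dots> = (\<Sum>n<2 ^ k. sc 1 (x (block_start k + n))) + (\<Sum>n<2 ^ k. z (block_start k + n))"
    unfolding block by (simp add: sum.distrib)
  also have "(\<Sum>n<2 ^ k. sc 1 (x (block_start k + n)))
      = (\<Sum>r<2 ^ k. sc ((\<Sum>n<2 ^ k. heavy_haar k r n) *\<^sub>R 1) (u (block_start k + r)))"
    using X.sum_transformed[of "2 ^ k" k "\<lambda>_. 1"] by (simp add: scaleR_sum_left)
  also have "\<dots> = (\<Sum>r<(2::nat) ^ k. if r = 0 then (p * w) *\<^sub>R u (block_start k) else 0)"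
    by (intro sum.cong) (auto simp: sum_heavy_row p_def w_def sc.scaleR_left)
  also have "\<dots> = (p * w) *\<^sub>R u (block_start k)" by simp
  finally have PF: "(\<Sum>i\<in>A. sc (c i) (y i)) = (p * w) *\<^sub>R u (block_start k) + (\<Sum>n<2 ^ k. z (block_start k + n))" .
  note us_lin = l2_systemD(2)[OF l2_u]
  \<comment> \<open>This functional annihilates every \<open>z n\<close>, so the leftover sum of the
    \<open>z n\<close> cannot cancel the multiple of \<open>u\<close>.\<close>
  have "us (block_start k) (\<Sum>i\<in>A. sc (c i) (y i)) = (p * w) *\<^sub>R 1"
    unfolding PF scalar_linear_simps[OF us_lin]
    by (simp add: functional_xz_eq_0(2)[OF us_lin us_vs_cross(1)] l2_systemD(3)[OF l2_u])
  then have "p * w \<le> K * norm (\<Sum>i\<in>A. sc (c i) (y i))"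
    using l2_system_bounds(2)[OF l2_u, of "block_start k" "\<Sum>i\<in>A. sc (c i) (y i)"] p w by simp
  then have low: "p * w / K \<le> norm (\<Sum>i\<in>A. sc (c i) (y i))"
    using K_ge_1 by (simp add: field_simps)
  have "norm (\<Sum>i<3 * M. sc (c i) (y i)) \<le> (2 * p / w) * K"
    unfolding F using p w mult_left_mono[OF l2_system_bounds(1)[OF l2_v], of "2 * p / w" "block_start k"] by simp
  then have "(2 * \<theta>) ^ k / (2 * K\<^sup>2) * norm (\<Sum>i<3 * M. sc (c i) (y i)) \<le> (w * w) / (2 * K\<^sup>2) * ((2 * p / w) * K)"
    unfolding ww using \<theta> by (intro mult_left_mono) auto
  also have "\<dots> = p * w / K"
    using w K_ge_1 by (simp add: field_simps power2_eq_square)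
  finally have up: "(2 * \<theta>) ^ k / (2 * K\<^sup>2) * norm (\<Sum>i<3 * M. sc (c i) (y i)) \<le> p * w / K" .
  have "v (block_start k) \<noteq> 0"
    using l2_systemD(3)[OF l2_v, of "block_start k" "block_start k"]
      scalar_linear_simps(5)[OF l2_systemD(2)[OF l2_v], of "block_start k"] by auto
  then have "(\<Sum>i<3 * M. sc (c i) (y i)) \<noteq> 0" using p w by (simp add: F)
  then show ?thesis
    using that[of A c] up low unfolding M_def[symmetric] by (auto simp: A_def)
qed

section \<open>Insertion of \<open>y\<close> into the leading slots freed by \<open>u\<close> and
  \<open>v\<close>\<close>

definition G :: "nat \<Rightarrow> 'x" where
  "G j = (if block_offset j = 0 then y (block_index j) else g j)"

definition Gs :: "nat \<Rightarrow> 'x \<Rightarrow> 'k" where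
  "Gs j = (if block_offset j = 0 then ys (block_index j) else gs j)"

lemma block_index_0: "block_index (block_start k) = k" and block_offset_0: "block_offset (block_start k) = 0"
  using block_index_eq[of 0 k] block_offset_eq[of 0 k] by simp_all

lemma G_block:
  "G (block_start k) = y k" "Gs (block_start k) = ys k"
  "0 < r \<Longrightarrow> r < 2 ^ k \<Longrightarrow> G (block_start k + r) = g (block_start k + r)"
  "0 < r \<Longrightarrow> r < 2 ^ k \<Longrightarrow> Gs (block_start k + r) = gs (block_start k + r)"
  by (simp_all add: G_def Gs_def block_index_0 block_offset_0)

lemma Gs_G: "Gs n (G m) = of_bool (m = n)"
proof -
  have "m = n \<longleftrightarrow> block_index m = block_index n \<and> block_offset m = block_offset n"
    by (metis block_decomp)
  then show ?thesis
    by (auto simp: G_def Gs_def ys_y ys_g gs_y gs_g)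
qed

lemma sum_split_0:
  fixes h :: "nat \<Rightarrow> 'a::comm_monoid_add"
  shows "(\<Sum>r<2 ^ k. h r) = h 0 + (\<Sum>r=1..<2 ^ k. h r)"
  using sum.atLeast_Suc_lessThan[of 0 "2 ^ k" h] by (simp add: lessThan_atLeast0)

lemma L2_set_tail_le: "L2_set (h :: nat \<Rightarrow> real) {1..<2 ^ k} \<le> L2_set h {..<2 ^ k}"
  unfolding L2_set_def by (intro real_sqrt_le_mono sum_mono2) auto

lemma norm_g_tail_le:
  "norm (\<Sum>r=1..<2 ^ k. sc (c r) (g (block_start k + r))) \<le> K * L2_set (\<lambda>r. norm (c r)) {..<2 ^ k}"
proof -
  have "l2_system K (\<lambda>r. g (block_start k + r)) (\<lambda>r. gs (block_start k + r))"
    by (rule l2_system_subfamily[OF l2]) (simp add: inj_def)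
  from l2_systemD(4)[OF this, of "{1..<2 ^ k}" c]
  show ?thesis
    using mult_left_mono[OF L2_set_tail_le[of "\<lambda>r. norm (c r)" k] K_nonneg] by simp
qed

text \<open>Only slot 0 is foreign to the l2 system, and a single coefficient is at most the
  square-sum norm of its block.\<close>

lemma G_synthesis:
  "norm (\<Sum>r<2 ^ k. sc (c r) (G (block_start k + r))) \<le> (y_bound + K) * L2_set (\<lambda>r. norm (c r)) {..<2 ^ k}"
proof -
  have "(\<Sum>r<2 ^ k. sc (c r) (G (block_start k + r)))
      = sc (c 0) (y k) + (\<Sum>r=1..<2 ^ k. sc (c r) (g (block_start k + r)))"
    unfolding sum_split_0 by (simp add: G_block)
  also have "norm \<dots> \<le> norm (c 0) * norm (y k) + K * L2_set (\<lambda>r. norm (c r)) {..<2 ^ k}"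
    using norm_g_tail_le[of c k] by (intro order_trans[OF norm_triangle_ineq]) (simp add: norm_scale)
  also have "norm (c 0) * norm (y k) \<le> L2_set (\<lambda>r. norm (c r)) {..<2 ^ k} * y_bound"
    by (intro mult_mono norm_le_L2_set y_norm_le) auto
  finally show ?thesis by (simp add: algebra_simps)
qed

text \<open>For an orthogonal matrix this is a coordinate projection in an orthonormal system, hence
  a contraction.\<close>

lemma haar_truncation:
  fixes c :: "nat \<Rightarrow> 'k"
  assumes "m \<le> 2 ^ k"
  shows "L2_set (\<lambda>r. norm (\<Sum>n<m. haar k r n *\<^sub>R (\<Sum>s<2 ^ k. haar k s n *\<^sub>R c s))) {..<2 ^ k}
    \<le> 1 * L2_set (\<lambda>s. norm (c s)) {..<2 ^ k}"
proof -
  define d where "d n = (\<Sum>s<2 ^ k. haar k s n *\<^sub>R c s)" for n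
  have "(\<Sum>r<2 ^ k. (norm (\<Sum>n<m. haar k r n *\<^sub>R d n))\<^sup>2) = (\<Sum>n<m. (norm (d n))\<^sup>2)"
    using assms by (intro orthonormal_columns_isometry haar_columns_orthonormal) auto
  also have "\<dots> \<le> (\<Sum>n<2 ^ k. (norm (d n))\<^sup>2)"
    using assms by (intro sum_mono2) auto
  also have "\<dots> = (\<Sum>s<2 ^ k. (norm (c s))\<^sup>2)"
    unfolding d_def by (intro orthonormal_columns_isometry haar_rows_orthonormal) auto
  finally show ?thesis unfolding L2_set_def d_def by simp
qed

interpretation B: block_transform sc G Gs haar haar "y_bound + K" 1
proof
  show "scalar_linear (Gs n)" for n by (simp add: Gs_def ys_linear gs_linear)
  show "0 \<le> y_bound + K" using K_nonneg K_le_y_bound(1) by simp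
qed (use Gs_G haar_columns_orthonormal haar_rows_orthonormal haar_truncation G_synthesis in auto)

abbreviation "b \<equiv> B.transformed"
abbreviation "bs \<equiv> B.transformed_dual"

text \<open>Up to a block start, the expansion along \<open>G\<close> is that along \<open>y\<close>
  plus that along \<open>g\<close> without its leading terms. The \<open>y\<close> series converges
  to \<open>L\<close> plus exactly the removed part, namely the components along \<open>u\<close>
  and \<open>v\<close>, so the total is \<open>f\<close>.\<close>

lemma b_sums: "(\<lambda>j. sc (bs j f) (b j)) sums f"
proof (rule B.transformed_sums)
  obtain L where L: "(\<lambda>n. sc (es n f) (e n)) sums L" "f = L + l2_map g gs f"
    using expansion by blast
  define lead where "lead k = (\<Sum>i<k. sc (gs (block_start i) f) (g (block_start i)))" for k
  have lead_sums: "(\<lambda>i. sc (gs (block_start i) f) (g (block_start i))) sums (l2_map u us f + l2_map v vs f)"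
  proof -
    have s: "(\<lambda>i. sc (gs (block_start i) f) (g (block_start i)))
        sums l2_map (\<lambda>n. g (block_start n)) (\<lambda>n. gs (block_start n)) f"
      by (rule l2_map_sums(1)[OF l2_lead l2_lead])
    moreover have "l2_map (\<lambda>n. g (block_start n)) (\<lambda>n. gs (block_start n)) f = l2_map u us f + l2_map v vs f"
      by (rule sums_interleave2[OF s])
         (use l2_map_sums(1)[OF l2_u l2_u, of f] l2_map_sums(1)[OF l2_v l2_v, of f]
           in \<open>simp_all add: u_def us_def v_def vs_def\<close>)
    ultimately show ?thesis by simp
  qed
  have eq: "(\<Sum>j<block_start k. sc (Gs j f) (G j)) =
      (\<Sum>i<k. sc (ys i f) (y i)) + ((\<Sum>j<block_start k. sc (gs j f) (g j)) - lead k)" for k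
  proof -
    have "(\<Sum>r<2 ^ i. sc (Gs (block_start i + r) f) (G (block_start i + r))) = sc (ys i f) (y i) +
        ((\<Sum>r<2 ^ i. sc (gs (block_start i + r) f) (g (block_start i + r))) - sc (gs (block_start i) f) (g (block_start i)))"
      for i
      unfolding sum_split_0 by (simp add: G_block)
    then show ?thesis
      unfolding sum_block_start lead_def by (simp add: sum.distrib sum_subtractf)
  qed
  have "(\<lambda>k. (\<Sum>i<k. sc (ys i f) (y i)) + ((\<Sum>j<block_start k. sc (gs j f) (g j)) - lead k))
      \<longlonglongrightarrow> (L + (l2_map u us f + l2_map v vs f)) + (l2_map g gs f - (l2_map u us f + l2_map v vs f))"
    unfolding lead_def
    by (intro tendsto_add tendsto_diff y_sums[OF L(1), unfolded sums_def] lead_sums[unfolded sums_def]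
        filterlim_compose[OF l2_map_sums(1)[OF l2 l2, unfolded sums_def] filterlim_block_start])
  then show "(\<lambda>k. \<Sum>j<block_start k. sc (Gs j f) (G j)) \<longlonglongrightarrow> f"
    unfolding eq using L(2) by (simp add: algebra_simps)
  have ys0: "(\<lambda>k. norm (ys k f)) \<longlonglongrightarrow> 0"
  proof (rule Lim_null_comparison)
    show "\<forall>\<^sub>F k in sequentially. norm (norm (ys k f)) \<le> y_bound * norm (sc (ys k f) (y k))"
    proof (intro always_eventually allI)
      fix k
      have "ys k (sc (ys k f) (y k)) = ys k f"
        by (simp add: scalar_linear_simps[OF ys_linear] ys_y)
      then show "norm (norm (ys k f)) \<le> y_bound * norm (sc (ys k f) (y k))"
        using ys_norm_le[of k "sc (ys k f) (y k)"] by simp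
    qed
    show "(\<lambda>k. y_bound * norm (sc (ys k f) (y k))) \<longlonglongrightarrow> 0"
      by (intro tendsto_mult_right_zero tendsto_norm_zero summable_LIMSEQ_zero sums_summable[OF y_sums[OF L(1)]])
  qed
  show "(\<lambda>k. L2_set (\<lambda>r. norm (Gs (block_start k + r) f)) {..<2 ^ k}) \<longlonglongrightarrow> 0"
  proof (rule Lim_null_comparison)
    show "\<forall>\<^sub>F k in sequentially. norm (L2_set (\<lambda>r. norm (Gs (block_start k + r) f)) {..<2 ^ k})
        \<le> norm (ys k f) + L2_set (\<lambda>r. norm (gs (block_start k + r) f)) {..<2 ^ k}"
    proof (intro always_eventually allI)
      fix k
      have "L2_set (\<lambda>r. norm (Gs (block_start k + r) f)) {..<2 ^ k}
          \<le> L2_set (\<lambda>r. (if r = 0 then norm (ys k f) else 0) + norm (gs (block_start k + r) f)) {..<2 ^ k}"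
        by (rule L2_set_mono) (auto simp: G_block)
      also have "\<dots> \<le> L2_set (\<lambda>r. if r = 0 then norm (ys k f) else 0) {..<(2::nat) ^ k}
          + L2_set (\<lambda>r. norm (gs (block_start k + r) f)) {..<2 ^ k}"
        by (rule L2_set_triangle_ineq)
      also have "L2_set (\<lambda>r. if r = 0 then norm (ys k f) else 0) {..<(2::nat) ^ k} = norm (ys k f)"
        by (simp add: L2_set_def sum_split_0)
      finally show "norm (L2_set (\<lambda>r. norm (Gs (block_start k + r) f)) {..<2 ^ k})
          \<le> norm (ys k f) + L2_set (\<lambda>r. norm (gs (block_start k + r) f)) {..<2 ^ k}"
        by (simp add: L2_set_nonneg)
    qed
    show "(\<lambda>k. norm (ys k f) + L2_set (\<lambda>r. norm (gs (block_start k + r) f)) {..<2 ^ k}) \<longlonglongrightarrow> 0"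
      using tendsto_add[OF ys0 l2_system_block_tendsto_0[OF l2, of f]] by simp
  qed
qed

lemma b_biorthogonal: "bs n (b m) = (if m = n then 1 else 0)"
  by (simp add: B.transformed_dual_transformed)

lemma b_basis: "schauder_basis sc b"
  by (rule schauder_basisI(1)[OF B.scalar_linear_transformed_dual b_biorthogonal b_sums])

lemma coord_b: "coord sc b n f = bs n f"
  by (rule schauder_basisI(2)[OF B.scalar_linear_transformed_dual b_biorthogonal b_sums])

section \<open>Splitting \<open>b\<close> into its \<open>y\<close> part and its l2 part\<close>

definition \<mu> :: "nat \<Rightarrow> real" where
  "\<mu> j = (1 / sqrt 2) ^ block_index j"

lemma \<mu>_nonneg: "0 \<le> \<mu> j"
  by (simp add: \<mu>_def)

text \<open>\<open>\<mu> j\<close> is the constant entry of Haar row 0, the coefficient of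
  \<open>y\<close> in \<open>b j\<close>. An index in block \<open>k\<close> satisfies
  \<open>j + 1 < 2 * 2 ^ k\<close>, which costs the factor \<open>sqrt 2\<close>.\<close>

lemma \<mu>_le: "\<mu> j \<le> sqrt 2 / sqrt (real (j + 1))"
proof -
  have "j + 1 < 2 * 2 ^ block_index j"
    unfolding block_index_def using floor_log_exp2_gt[of "Suc j"] by simp
  then have "real (j + 1) \<le> real (2 * 2 ^ block_index j)" by (simp only: of_nat_le_iff less_imp_le)
  then have "sqrt (real (j + 1)) \<le> sqrt (real (2 * 2 ^ block_index j))" by (rule real_sqrt_le_mono)
  also have "\<dots> = sqrt 2 * sqrt 2 ^ block_index j"
    by (simp add: real_sqrt_mult real_sqrt_power)
  finally have "sqrt (real (j + 1)) \<le> sqrt 2 * sqrt 2 ^ block_index j" .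
  then show ?thesis by (simp add: \<mu>_def power_divide field_simps)
qed

definition q :: "nat \<Rightarrow> 'x" where
  "q j = (\<Sum>r=1..<2 ^ block_index j. haar (block_index j) r (block_offset j) *\<^sub>R g (block_start (block_index j) + r))"

lemma b_split: "b j = \<mu> j *\<^sub>R y (block_index j) + q j"
  unfolding B.transformed_def q_def sum_split_0 \<mu>_def
  by (simp add: haar_0 G_block)

lemma bs_split:
  "bs j f = \<mu> j *\<^sub>R ys (block_index j) f +
    (\<Sum>r=1..<2 ^ block_index j. haar (block_index j) r (block_offset j) *\<^sub>R gs (block_start (block_index j) + r) f)"
  unfolding B.transformed_dual_def sum_split_0 \<mu>_def
  by (simp add: haar_0 G_block)

text \<open>The coefficients along \<open>g\<close> arise from \<open>a\<close> by an isometry in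
  each block, followed by deletion of row 0. Extending \<open>a\<close> by 0 to full blocks makes
  the isometry applicable.\<close>

lemma norm_sum_q_le:
  assumes D: "finite D"
  shows "norm (\<Sum>j\<in>D. sc (a j) (q j)) \<le> K * sqrt (\<Sum>j\<in>D. (norm (a j))\<^sup>2)"
proof -
  obtain M where M: "D \<subseteq> {..<block_start M}" using finite_subset_block_start[OF D] .
  define a' where "a' j = (if j \<in> D then a j else 0)" for j
  define d where "d k r = (\<Sum>n<2 ^ k. haar k r n *\<^sub>R a' (block_start k + n))" for k r
  define d' where "d' j = (if block_offset j = 0 then 0 else d (block_index j) (block_offset j))" for j
  have "(\<Sum>j\<in>D. sc (a j) (q j)) = (\<Sum>j<block_start M. sc (a' j) (q j))"
    using M by (intro sum.mono_neutral_cong_left) (auto simp: a'_def)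
  also have "\<dots> = (\<Sum>k<M. \<Sum>n<2 ^ k. sc (a' (block_start k + n)) (q (block_start k + n)))"
    by (rule sum_block_start)
  also have "\<dots> = (\<Sum>k<M. \<Sum>r<2 ^ k. sc (d' (block_start k + r)) (g (block_start k + r)))"
  proof (rule sum.cong[OF refl])
    fix k
    have "(\<Sum>n<2 ^ k. sc (a' (block_start k + n)) (q (block_start k + n)))
        = (\<Sum>n<2 ^ k. \<Sum>r=1..<2 ^ k. sc (haar k r n *\<^sub>R a' (block_start k + n)) (g (block_start k + r)))"
      by (intro sum.cong) (auto simp: q_def sc.sum_right sc.scaleR_left sc.scaleR_right)
    also have "\<dots> = (\<Sum>r=1..<2 ^ k. sc (d k r) (g (block_start k + r)))"
      by (subst sum.swap) (simp add: d_def sc.sum_left)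
    also have "\<dots> = (\<Sum>r<2 ^ k. sc (d' (block_start k + r)) (g (block_start k + r)))"
      unfolding sum_split_0 by (simp add: d'_def block_offset_0)
    finally show "(\<Sum>n<2 ^ k. sc (a' (block_start k + n)) (q (block_start k + n)))
        = (\<Sum>r<2 ^ k. sc (d' (block_start k + r)) (g (block_start k + r)))" .
  qed
  also have "\<dots> = (\<Sum>j<block_start M. sc (d' j) (g j))" by (rule sum_block_start[symmetric])
  finally have eq: "(\<Sum>j\<in>D. sc (a j) (q j)) = (\<Sum>j<block_start M. sc (d' j) (g j))" .
  have "(\<Sum>j<block_start M. (norm (d' j))\<^sup>2) = (\<Sum>k<M. \<Sum>r<2 ^ k. (norm (d' (block_start k + r)))\<^sup>2)"
    by (rule sum_block_start)
  also have "\<dots> \<le> (\<Sum>k<M. \<Sum>r<2 ^ k. (norm (d k r))\<^sup>2)"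
    by (intro sum_mono) (auto simp: d'_def)
  also have "\<dots> = (\<Sum>k<M. \<Sum>n<2 ^ k. (norm (a' (block_start k + n)))\<^sup>2)"
    unfolding d_def by (rule sum.cong[OF refl], rule orthonormal_columns_isometry)
      (auto simp: haar_columns_orthonormal)
  also have "\<dots> = (\<Sum>j<block_start M. (norm (a' j))\<^sup>2)" by (rule sum_block_start[symmetric])
  also have "\<dots> = (\<Sum>j\<in>D. (norm (a j))\<^sup>2)"
    using M by (intro sum.mono_neutral_cong_right) (auto simp: a'_def)
  finally have "L2_set (\<lambda>j. norm (d' j)) {..<block_start M} \<le> sqrt (\<Sum>j\<in>D. (norm (a j))\<^sup>2)"
    unfolding L2_set_def by (rule real_sqrt_le_mono)
  then show ?thesis
    unfolding eq using l2_systemD(4)[OF l2, of "{..<block_start M}" d'] mult_left_mono[OF _ K_nonneg]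
    by (meson finite_lessThan order_trans)
qed

text \<open>Without the \<open>y\<close> part, the coordinates in a block are an orthogonal
  transform of the values of \<open>gs\<close>, with the value in slot 0 replaced by 0.\<close>

lemma sum_square_residual_le:
  assumes F: "finite F"
  shows "(\<Sum>j\<in>F. (norm (bs j f - \<mu> j *\<^sub>R ys (block_index j) f))\<^sup>2) \<le> K\<^sup>2 * (norm f)\<^sup>2"
proof -
  obtain M where M: "F \<subseteq> {..<block_start M}" using finite_subset_block_start[OF F] .
  define d where "d k r = (if r = 0 then 0 else gs (block_start k + r) f)" for k r
  have res: "bs (block_start k + n) f - \<mu> (block_start k + n) *\<^sub>R ys (block_index (block_start k + n)) f
      = (\<Sum>r<2 ^ k. haar k r n *\<^sub>R d k r)" if "n < 2 ^ k" for k n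
    unfolding bs_split sum_split_0 using that by (auto simp: d_def intro!: sum.cong)
  have "(\<Sum>j\<in>F. (norm (bs j f - \<mu> j *\<^sub>R ys (block_index j) f))\<^sup>2)
      \<le> (\<Sum>j<block_start M. (norm (bs j f - \<mu> j *\<^sub>R ys (block_index j) f))\<^sup>2)"
    using M by (intro sum_mono2) auto
  also have "\<dots> = (\<Sum>k<M. \<Sum>n<2 ^ k. (norm (\<Sum>r<2 ^ k. haar k r n *\<^sub>R d k r))\<^sup>2)"
    unfolding sum_block_start by (intro sum.cong refl) (use res in simp)
  also have "\<dots> = (\<Sum>k<M. \<Sum>r<2 ^ k. (norm (d k r))\<^sup>2)"
    by (rule sum.cong[OF refl], rule orthonormal_columns_isometry)
      (auto simp: haar_rows_orthonormal)
  also have "\<dots> \<le> (\<Sum>k<M. \<Sum>r<2 ^ k. (norm (gs (block_start k + r) f))\<^sup>2)"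
    by (intro sum_mono) (auto simp: d_def)
  also have "\<dots> = (L2_set (\<lambda>j. norm (gs j f)) {..<block_start M})\<^sup>2"
    by (simp add: L2_set_def sum_nonneg sum_block_start)
  also have "\<dots> \<le> (K * norm f)\<^sup>2"
    by (intro power_mono l2_systemD(5)[OF l2]) auto
  finally show ?thesis by (simp add: power_mult_distrib)
qed

text \<open>The decaying component is the \<open>y\<close> part. The \<open>q\<close> part meets the
  l2 half of the upper estimate, and the \<open>y\<close> part, bounded by \<open>y_bound\<close>
  times \<open>\<mu> j\<close>, meets the weighted half.\<close>

lemma b_sqrt_democratic:
  "sqrt_democratic_basis sc b (sqrt 2 * y_bound) (\<lambda>j f. \<mu> j *\<^sub>R ys (block_index j) f)"
proof
  have y0: "0 \<le> y_bound" using K_nonneg K_le_y_bound(1) by linarith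
  have "1 * y_bound \<le> sqrt 2 * y_bound" using y0 by (intro mult_right_mono) auto
  then have le: "y_bound \<le> sqrt 2 * y_bound" "K \<le> sqrt 2 * y_bound" "1 \<le> sqrt 2 * y_bound"
    using K_le_y_bound(1) K_ge_1 by linarith+
  show "schauder_basis sc b" by (rule b_basis)
  show "1 \<le> sqrt 2 * y_bound" by (rule le)
  show "norm (\<Sum>j\<in>D. sc (a j) (b j)) \<le> sqrt 2 * y_bound * sqrt (\<Sum>j\<in>D. (norm (a j))\<^sup>2) +
      sqrt 2 * y_bound * (\<Sum>j\<in>D. norm (a j) / sqrt (real (j + 1)))" if D: "finite D" for D a
  proof -
    have "(\<Sum>j\<in>D. sc (a j) (b j)) = (\<Sum>j\<in>D. sc (a j) (q j)) + (\<Sum>j\<in>D. \<mu> j *\<^sub>R sc (a j) (y (block_index j)))"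
      by (simp add: b_split sc.add_right sc.scaleR_right sum.distrib add.commute)
    also have "norm \<dots> \<le> norm (\<Sum>j\<in>D. sc (a j) (q j)) + norm (\<Sum>j\<in>D. \<mu> j *\<^sub>R sc (a j) (y (block_index j)))"
      by (rule norm_triangle_ineq)
    also have "norm (\<Sum>j\<in>D. sc (a j) (q j)) \<le> sqrt 2 * y_bound * sqrt (\<Sum>j\<in>D. (norm (a j))\<^sup>2)"
      by (rule order_trans[OF norm_sum_q_le[OF D] mult_right_mono[OF le(2)]]) (simp add: sum_nonneg)
    also have "norm (\<Sum>j\<in>D. \<mu> j *\<^sub>R sc (a j) (y (block_index j)))
        \<le> (\<Sum>j\<in>D. sqrt 2 * y_bound * (norm (a j) / sqrt (real (j + 1))))"
    proof (rule sum_norm_le)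
      fix j
      have "norm (\<mu> j *\<^sub>R sc (a j) (y (block_index j))) = \<mu> j * (norm (a j) * norm (y (block_index j)))"
        by (simp add: norm_scale \<mu>_nonneg)
      also have "\<dots> \<le> (sqrt 2 / sqrt (real (j + 1))) * (norm (a j) * y_bound)"
        by (intro mult_mono \<mu>_le order_refl y_norm_le) auto
      finally show "norm (\<mu> j *\<^sub>R sc (a j) (y (block_index j))) \<le> sqrt 2 * y_bound * (norm (a j) / sqrt (real (j + 1)))"
        by (simp add: mult_ac)
    qed
    finally show ?thesis by (simp only: sum_distrib_left)
  qed
  show "(\<Sum>j\<in>F. (norm (coord sc b j f - \<mu> j *\<^sub>R ys (block_index j) f))\<^sup>2) \<le> (sqrt 2 * y_bound)\<^sup>2 * (norm f)\<^sup>2"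
    if "finite F" for F f
    unfolding coord_b
    by (rule order_trans[OF sum_square_residual_le[OF that] mult_right_mono[OF power_mono[OF le(2) K_nonneg]]]) simp
  show "norm (\<mu> j *\<^sub>R ys (block_index j) f) \<le> sqrt 2 * y_bound * norm f / sqrt (real (j + 1))" for j f
  proof -
    have "norm (\<mu> j *\<^sub>R ys (block_index j) f) = \<mu> j * norm (ys (block_index j) f)"
      by (simp add: \<mu>_nonneg)
    also have "\<dots> \<le> (sqrt 2 / sqrt (real (j + 1))) * (y_bound * norm f)"
      by (intro mult_mono \<mu>_le ys_norm_le) auto
    finally show ?thesis by (simp add: mult_ac)
  qed
qed

text \<open>A projection with respect to \<open>y\<close> becomes one with respect to
  \<open>b\<close> by taking whole blocks: on a combination \<open>F\<close> of the
  \<open>y i\<close> the functionals of the other slots vanish, so block \<open>k\<close> of the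
  expansion sums to \<open>c k\<close> times \<open>y k\<close>.\<close>

lemma w_conditionality_ge:
  assumes A: "A \<subseteq> {..<N}" and nz: "(\<Sum>i<N. sc (c i) (y i)) \<noteq> 0" and m: "block_start N \<le> m"
  shows "ennreal (norm (\<Sum>i\<in>A. sc (c i) (y i)) / norm (\<Sum>i<N. sc (c i) (y i))) \<le> w_conditionality sc b m"
proof -
  define F where "F = (\<Sum>i<N. sc (c i) (y i))"
  define A' where "A' = {j \<in> {..<block_start N}. block_index j \<in> A}"
  have gsF: "gs j F = 0" if "block_offset j \<noteq> 0" for j
    unfolding F_def scalar_linear_simps[OF gs_linear] using gs_y[OF that] by simp
  have ysF: "ys k F = (if k < N then c k else 0)" for k
  proof -
    have "ys k F = (\<Sum>i<N. if i = k then c i else 0)"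
      unfolding F_def scalar_linear_simps[OF ys_linear] by (intro sum.cong) (auto simp: ys_y)
    then show ?thesis by simp
  qed
  have GsF: "Gs (block_start k + r) F = (if r = 0 then ys k F else 0)" if "r < 2 ^ k" for k r
    using that by (auto simp: G_block gsF)
  have "coord_proj sc b A' F = (\<Sum>j\<in>A'. sc (bs j F) (b j))"
    by (simp add: coord_proj_finite A'_def coord_b)
  also have "\<dots> = (\<Sum>j<block_start N. if block_index j \<in> A then sc (bs j F) (b j) else 0)"
    unfolding A'_def by (rule sum.inter_filter) simp
  also have "\<dots> = (\<Sum>k<N. if k \<in> A then sc (c k) (y k) else 0)"
    unfolding sum_block_start
  proof (rule sum.cong[OF refl])
    fix k assume k: "k \<in> {..<N}"
    have "(\<Sum>n<2 ^ k. sc (bs (block_start k + n) F) (b (block_start k + n)))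
        = (\<Sum>r<(2::nat) ^ k. if r = 0 then sc (c k) (y k) else 0)"
      unfolding B.sum_full_block using k by (intro sum.cong) (auto simp: GsF ysF G_block)
    then show "(\<Sum>n<2 ^ k. if block_index (block_start k + n) \<in> A
        then sc (bs (block_start k + n) F) (b (block_start k + n)) else 0) = (if k \<in> A then sc (c k) (y k) else 0)"
      by simp
  qed
  also have "\<dots> = (\<Sum>k\<in>A. sc (c k) (y k))"
    using A by (intro sum.mono_neutral_cong_right) auto
  finally have proj: "coord_proj sc b A' F = (\<Sum>k\<in>A. sc (c k) (y k))" .
  have "supp sc b F \<subseteq> {..<m}"
  proof
    fix j assume j: "j \<in> supp sc b F"
    show "j \<in> {..<m}"
    proof (rule ccontr)
      assume "j \<notin> {..<m}"
      then have "N \<le> block_index j" using less_block_start_iff[of j N] m by simp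
      then have "bs j F = 0"
        unfolding B.transformed_dual_def by (intro sum.neutral) (auto simp: GsF ysF)
      then show False using j by (simp add: supp_def coord_b)
    qed
  qed
  then have "(F, A') \<in> {(f, A). f \<noteq> 0 \<and> supp sc b f \<subseteq> {..<m}}" using nz by (simp add: F_def)
  then have "ennreal (norm (coord_proj sc b A' F) / norm F) \<le> w_conditionality sc b m"
    unfolding w_conditionality_def by (rule SUP_upper2) simp
  then show ?thesis by (simp only: proj F_def[symmetric])
qed

text \<open>Block \<open>k\<close> of the Haar system uses at most \<open>6 * 2 ^ k\<close> vectors
  of \<open>y\<close>, and \<open>N\<close> vectors of \<open>y\<close> occupy fewer than
  \<open>2 ^ N\<close> vectors of \<open>b\<close>.\<close>

lemma w_conditionality_growth:
  assumes "2 ^ (6 * 2 ^ k) \<le> m"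
  shows "ennreal ((2 * \<theta>) ^ k / (2 * K\<^sup>2)) \<le> w_conditionality sc b m"
proof -
  define N where "N = 3 * block_start (Suc k)"
  obtain A c where A: "A \<subseteq> {..<N}" and nz: "(\<Sum>i<N. sc (c i) (y i)) \<noteq> 0"
    and le: "(2 * \<theta>) ^ k / (2 * K\<^sup>2) * norm (\<Sum>i<N. sc (c i) (y i)) \<le> norm (\<Sum>i\<in>A. sc (c i) (y i))"
    unfolding N_def by (rule y_conditional)
  have "N \<le> 6 * 2 ^ k" by (simp add: N_def block_start_def)
  then have "(2::nat) ^ N \<le> 2 ^ (6 * 2 ^ k)" by (intro power_increasing) auto
  then have "block_start N \<le> m" using assms unfolding block_start_def by linarith
  then have "ennreal (norm (\<Sum>i\<in>A. sc (c i) (y i)) / norm (\<Sum>i<N. sc (c i) (y i))) \<le> w_conditionality sc b m"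
    by (rule w_conditionality_ge[OF A nz])
  moreover have "(2 * \<theta>) ^ k / (2 * K\<^sup>2) \<le> norm (\<Sum>i\<in>A. sc (c i) (y i)) / norm (\<Sum>i<N. sc (c i) (y i))"
    using le nz by (subst pos_le_divide_eq) auto
  ultimately show ?thesis using order_trans[OF ennreal_leI] by blast
qed

text \<open>Projecting \<open>y 0\<close> onto itself is possible already for \<open>m = 1\<close>;
  this covers the range of small \<open>m\<close>, below the first threshold of
  \<open>w_conditionality_growth\<close>.\<close>

lemma w_conditionality_ge_1:
  assumes "1 \<le> m"
  shows "1 \<le> w_conditionality sc b m"
proof -
  have "y 0 \<noteq> 0" using ys_y[of 0 0] scalar_linear_simps(5)[OF ys_linear, of 0] by auto
  then have "ennreal (norm (\<Sum>i\<in>{..<1}. sc 1 (y i)) / norm (\<Sum>i<1. sc 1 (y i))) \<le> w_conditionality sc b m"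
    using assms by (intro w_conditionality_ge) (auto simp: block_start_def)
  then show ?thesis using \<open>y 0 \<noteq> 0\<close> by simp
qed

lemma exists_conditional_almost_greedy_basis:
  "\<exists>b. schauder_basis sc b \<and> almost_greedy sc b \<and>
     approx_on {1..} (fundamental_function b) (\<lambda>m. ennreal (real m powr (1/2))) \<and>
     (\<forall>m\<ge>1. 1 \<le> w_conditionality sc b m) \<and>
     (\<exists>\<kappa>>0. \<forall>k m. 2 ^ (6 * 2 ^ k) \<le> m \<longrightarrow> ennreal (\<kappa> * (2 * \<theta>) ^ k) \<le> w_conditionality sc b m)"
proof -
  interpret D: sqrt_democratic_basis sc b "sqrt 2 * y_bound" "\<lambda>j f. \<mu> j *\<^sub>R ys (block_index j) f"
    by (rule b_sqrt_democratic)
  have "0 < 1 / (2 * K\<^sup>2)" using K_ge_1 by simp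
  then show ?thesis
    using b_basis D.almost_greedy D.fundamental_function_approx w_conditionality_ge_1 w_conditionality_growth
    by (intro exI[of _ b] conjI exI[of _ "1 / (2 * K\<^sup>2)"]) auto
qed

end

text \<open>\<open>k\<close> is the integer binary logarithm of a sixth of the integer binary
  logarithm of \<open>m\<close>, so \<open>2 ^ k\<close> matches \<open>ln m\<close> up to a factor;
  \<open>64 = 2 ^ 6\<close> makes that sixth at least 1.\<close>

lemma log_scale_index:
  assumes "64 \<le> m"
  obtains k :: nat where "2 ^ (6 * 2 ^ k) \<le> m" "ln (real m) \<le> 12 * 2 ^ k"
proof -
  define q p k where "q = floor_log m" and "p = q div 6" and "k = floor_log p"
  have "floor_log 64 = 6" using floor_log_power[of 6] by simp
  then have q: "6 \<le> q" using floor_log_le_iff[OF assms] by (simp add: q_def)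
  then have p: "0 < p" by (simp add: p_def)
  have kp: "2 ^ k \<le> p" unfolding k_def by (rule floor_log_exp2_le[OF p])
  have pk: "p < 2 * 2 ^ k" unfolding k_def by (rule floor_log_exp2_gt)
  have "6 * 2 ^ k \<le> q" using kp unfolding p_def by linarith
  then have "(2::nat) ^ (6 * 2 ^ k) \<le> 2 ^ q" by (intro power_increasing) auto
  also have "\<dots> \<le> m" unfolding q_def using assms by (intro floor_log_exp2_le) simp
  finally have 1: "2 ^ (6 * 2 ^ k) \<le> m" .
  have "q < 6 * p + 6" unfolding p_def by linarith
  then have q12: "q + 1 \<le> 12 * 2 ^ k" using pk by linarith
  have "m < 2 * 2 ^ q" unfolding q_def by (rule floor_log_exp2_gt)
  then have "m \<le> 2 ^ (q + 1)" by simp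
  then have "real m \<le> real (2 ^ (q + 1))" by (simp only: of_nat_le_iff)
  then have "real m \<le> 2 ^ (q + 1)" by simp
  then have "ln (real m) \<le> ln (2 ^ (q + 1))" using assms by simp
  also have "\<dots> = real (q + 1) * ln 2" by (rule ln_realpow)
  also have "\<dots> \<le> real (q + 1) * 1" using ln_2_less_1 by (intro mult_left_mono) auto
  also have "\<dots> \<le> real (12 * 2 ^ k)" using q12 by (simp only: mult_1_right of_nat_le_iff)
  finally have "ln (real m) \<le> 12 * 2 ^ k" by simp
  then show ?thesis using 1 that by blast
qed

lemma powr_le_self:
  fixes x a :: real
  assumes "1 \<le> x" "a < 1"
  shows "x powr a \<le> x"
  using powr_mono[of a 1 x] assms by simp

text \<open>In the constant, 64 serves \<open>m < 64\<close> through the lower bound 1, and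
  \<open>12 / \<kappa>\<close> serves larger \<open>m\<close> through the scale \<open>k\<close>
  with \<open>ln m \<le> 12 * 2 ^ k\<close>. As \<open>a < 1\<close>, both \<open>64 powr a\<close>
  and \<open>12 powr a\<close> are bounded by their bases.\<close>

lemma lesssim_log_powr:
  fixes w :: "nat \<Rightarrow> ennreal"
  assumes a: "0 < a" "a < 1" and \<kappa>: "0 < \<kappa>"
    and w1: "\<And>m. 1 \<le> m \<Longrightarrow> 1 \<le> w m"
    and wk: "\<And>k m. 2 ^ (6 * 2 ^ k) \<le> m \<Longrightarrow> ennreal (\<kappa> * (2 powr a) ^ k) \<le> w m"
  shows "lesssim_on {1..} (\<lambda>m. ennreal (ln (real m) powr a)) w"
  unfolding lesssim_on_def
proof (intro exI[of _ "64 + 12 / \<kappa>"] ballI)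
  fix m :: nat assume "m \<in> {1..}"
  then have m: "1 \<le> m" by simp
  show "ennreal (ln (real m) powr a) \<le> ennreal (64 + 12 / \<kappa>) * w m"
  proof (cases "64 \<le> m")
    case False
    have "ln (real m) \<le> 64" using m False ln_le_minus_one[of "real m"] by simp
    then have "ln (real m) powr a \<le> 64 powr a" using m a by (intro powr_mono2) auto
    also have "\<dots> \<le> 64" using powr_le_self[of 64 a] a by simp
    also have "\<dots> \<le> 64 + 12 / \<kappa>" using \<kappa> by simp
    finally have "ennreal (ln (real m) powr a) \<le> ennreal (64 + 12 / \<kappa>) * 1"
      by (simp add: ennreal_leI)
    also have "\<dots> \<le> ennreal (64 + 12 / \<kappa>) * w m" by (intro mult_left_mono w1 m) simp
    finally show ?thesis .
  next
    case True
    then obtain k :: nat where k: "2 ^ (6 * 2 ^ k) \<le> m" "ln (real m) \<le> 12 * 2 ^ k"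
      by (rule log_scale_index)
    have "ln (real m) powr a \<le> (12 * 2 ^ k) powr a" using k(2) m a by (intro powr_mono2) auto
    also have "\<dots> = 12 powr a * (2 powr a) ^ k"
    proof -
      have "(2 ^ k :: real) powr a = (2 powr a) ^ k"
        by (simp add: powr_powr mult.commute flip: powr_realpow)
      then show ?thesis by (simp add: powr_mult)
    qed
    also have "\<dots> \<le> 12 * (2 powr a) ^ k"
      using powr_le_self[of 12 a] a by (intro mult_right_mono) auto
    also have "\<dots> = 12 / \<kappa> * (\<kappa> * (2 powr a) ^ k)" using \<kappa> by simp
    also have "\<dots> \<le> (64 + 12 / \<kappa>) * (\<kappa> * (2 powr a) ^ k)" using \<kappa> by (intro mult_right_mono) auto
    finally have "ennreal (ln (real m) powr a) \<le> ennreal ((64 + 12 / \<kappa>) * (\<kappa> * (2 powr a) ^ k))"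
      by (rule ennreal_leI)
    also have "\<dots> = ennreal (64 + 12 / \<kappa>) * ennreal (\<kappa> * (2 powr a) ^ k)"
      using \<kappa> by (intro ennreal_mult) auto
    also have "\<dots> \<le> ennreal (64 + 12 / \<kappa>) * w m" by (intro mult_left_mono wk k) simp
    finally show ?thesis .
  qed
qed

lemma (in euclidean_banach_space_over) highly_conditional_almost_greedy_basis:
  fixes a :: real
  assumes a: "0 < a" "a < 1"
    and basis: "\<exists>e. schauder_basis sc e"
    and Y: "\<exists>Y. complemented_subspace sc Y \<and> ell2_isomorphic_to sc Y"
  shows "\<exists>b. schauder_basis sc b \<and> almost_greedy sc b \<and>
    approx_on {1..} (fundamental_function b) (\<lambda>m. ennreal (real m powr (1/2))) \<and>
    lesssim_on {1..} (\<lambda>m. ennreal (ln (real m) powr a)) (w_conditionality sc b)"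
proof -
  obtain e0 where e0: "schauder_basis sc e0" using basis by blast
  obtain K0 h hs where h: "l2_system K0 h hs" using Y complemented_l2_system by metis
  obtain K e es g gs where split: "l2_system K g gs" "\<And>n. scalar_linear (es n)"
    "\<And>n m. es n (e m) = of_bool (m = n)" "\<And>n m. es n (g m) = 0" "\<And>n m. gs n (e m) = 0"
    "\<And>n. norm (e n) \<le> K" "\<And>n f. norm (es n f) \<le> K * norm f"
    "\<And>f. \<exists>L. (\<lambda>n. sc (es n f) (e n)) sums L \<and> f = L + l2_map g gs f"
    by (rule basis_l2_decomposition[OF e0 h]) (rule that)
  \<comment> \<open>With this choice \<open>(2 * \<theta>) ^ k\<close> is
    \<open>(2 ^ k) powr a\<close>, which is comparable to \<open>ln m powr a\<close> at the scale
    where \<open>2 ^ k\<close> is comparable to \<open>ln m\<close>.\<close>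
  define \<theta> where "\<theta> = 2 powr a / 2"
  have "2 powr 0 < 2 powr a" "2 powr a < 2 powr 1" using a by (intro powr_less_mono; simp)+
  then interpret S: basis_with_l2 sc \<theta> K e g es gs
    by unfold_locales (use split in \<open>auto simp: \<theta>_def\<close>)
  have \<theta>: "2 * \<theta> = 2 powr a" by (simp add: \<theta>_def)
  obtain b \<kappa> where b: "schauder_basis sc b" "almost_greedy sc b"
      "approx_on {1..} (fundamental_function b) (\<lambda>m. ennreal (real m powr (1/2)))"
    and w: "\<And>m. 1 \<le> m \<Longrightarrow> 1 \<le> w_conditionality sc b m" "0 < \<kappa>"
      "\<And>k m. 2 ^ (6 * 2 ^ k) \<le> m \<Longrightarrow> ennreal (\<kappa> * (2 powr a) ^ k) \<le> w_conditionality sc b m"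
    using S.exists_conditional_almost_greedy_basis unfolding \<theta> by blast
  show ?thesis
    using b lesssim_log_powr[OF a w(2), of "w_conditionality sc b", OF w(1,3)] by blast
qed

theorem theorem3p13:
  fixes sc :: "complex \<Rightarrow> 'c::banach \<Rightarrow> 'c"
    and a :: real
  assumes "0 < a" and "a < 1"
  shows
    "((\<exists>e. schauder_basis (scaleR :: real \<Rightarrow> 'r::banach \<Rightarrow> 'r) e) \<and>
      (\<exists>Y. complemented_subspace (scaleR :: real \<Rightarrow> 'r \<Rightarrow> 'r) Y \<and>
           ell2_isomorphic_to (scaleR :: real \<Rightarrow> 'r \<Rightarrow> 'r) Y) \<longrightarrow>
      (\<exists>b. schauder_basis (scaleR :: real \<Rightarrow> 'r \<Rightarrow> 'r) b \<and>
           almost_greedy (scaleR :: real \<Rightarrow> 'r \<Rightarrow> 'r) b \<and>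
           approx_on {1..} (fundamental_function b) (\<lambda>m. ennreal (real m powr (1/2))) \<and>
           lesssim_on {1..} (\<lambda>m. ennreal (ln (real m) powr a))
             (w_conditionality (scaleR :: real \<Rightarrow> 'r \<Rightarrow> 'r) b)))
     \<and>
     (banach_space_over sc \<and>
      (\<exists>e. schauder_basis sc e) \<and>
      (\<exists>Y. complemented_subspace sc Y \<and> ell2_isomorphic_to sc Y) \<longrightarrow>
      (\<exists>b. schauder_basis sc b \<and>
           almost_greedy sc b \<and>
           approx_on {1..} (fundamental_function b) (\<lambda>m. ennreal (real m powr (1/2))) \<and>
           lesssim_on {1..} (\<lambda>m. ennreal (ln (real m) powr a)) (w_conditionality sc b)))"
proof (intro conjI impI; elim conjE)
  have "euclidean_banach_space_over (scaleR :: real \<Rightarrow> 'r \<Rightarrow> 'r)"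
    using banach_space_over_scaleR by (rule euclidean_banach_space_over.intro)
  then show "\<exists>b. schauder_basis (scaleR :: real \<Rightarrow> 'r \<Rightarrow> 'r) b \<and>
      almost_greedy (scaleR :: real \<Rightarrow> 'r \<Rightarrow> 'r) b \<and>
      approx_on {1..} (fundamental_function b) (\<lambda>m. ennreal (real m powr (1/2))) \<and>
      lesssim_on {1..} (\<lambda>m. ennreal (ln (real m) powr a))
        (w_conditionality (scaleR :: real \<Rightarrow> 'r \<Rightarrow> 'r) b)"
    if "\<exists>e. schauder_basis (scaleR :: real \<Rightarrow> 'r \<Rightarrow> 'r) e"
      "\<exists>Y. complemented_subspace (scaleR :: real \<Rightarrow> 'r \<Rightarrow> 'r) Y \<and>
        ell2_isomorphic_to (scaleR :: real \<Rightarrow> 'r \<Rightarrow> 'r) Y"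
    by (rule euclidean_banach_space_over.highly_conditional_almost_greedy_basis[OF _ assms that])
  show "\<exists>b. schauder_basis sc b \<and> almost_greedy sc b \<and>
      approx_on {1..} (fundamental_function b) (\<lambda>m. ennreal (real m powr (1/2))) \<and>
      lesssim_on {1..} (\<lambda>m. ennreal (ln (real m) powr a)) (w_conditionality sc b)"
    if "banach_space_over sc" "\<exists>e. schauder_basis sc e"
      "\<exists>Y. complemented_subspace sc Y \<and> ell2_isomorphic_to sc Y"
    using euclidean_banach_space_over.intro[OF that(1)]
    by (rule euclidean_banach_space_over.highly_conditional_almost_greedy_basis[OF _ assms that(2,3)])
qed

end
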